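(* Let $(H,\mathcal R)$ be a quasitriangular Hopf algebra, $A$ a left $H$-module algebra, $V,W$ quasi-commutative left $H$-module $A$-bimodules, $(\Omega^\bullet,\wedge,\mathrm d)$ a graded quasi-commutative left $H$-covariant differential calculus over $A$ with $\Omega=\Omega^1$, $\nabla_V\in\mathrm{Con}_A(V)$ and $\nabla_W\in\mathrm{Con}_A(W)$. Consider the $\mathbb K$-linear map $\nabla_V\,\widehat\oplus_{\mathcal R}\nabla_W:V\otimes W\to V\otimes_AW\otimes_A\Omega$ defined by $$\nabla_V\,\widehat\oplus_{\mathcal R}\nabla_W:=\tau^{-1}_{\mathcal R\,23}\circ\pi\circ(\nabla_V\otimes_{\mathcal R}\mathrm{id})+\pi\circ(\mathrm{id}\otimes_{\mathcal R}\nabla_W),$$ where $\pi$ denotes the canonical projections $V\otimes_A\Omega\otimes W\to V\otimes_A\Omega\otimes_AW$ and $V\otimes W\otimes_A\Omega\to V\otimes_AW\otimes_A\Omega$, and $\tau^{-1}_{\mathcal R\,23}$ is the inverse braiding map acting on the second and third entries of $V\otimes_A\Omega\otimes_AW$. Then $\nabla_V\,\widehat\oplus_{\mathcal R}\nabla_W$ induces a connection on the quotient module $V\otimes_AW$, $$\nabla_V\oplus_{\mathcal R}\nabla_W:V\otimes_AW\to V\otimes_AW\otimes_A\Omega,$$ defined by $(\nabla_V\oplus_{\mathcal R}\nabla_W)(v\otimes_Aw):=(\nabla_V\,\widehat\oplus_{\mathcal R}\nabla_W)(v\otimes w)$ for all $v\in V$, $w\in W$, extended by linearity to all of $V\ot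imes_AW$.
   Context: $\mathbb K$ is a commutative ring with unit; modules, algebras (associative, unital) and unadorned tensor products are over $\mathbb K$. For a Hopf algebra $H$ with coproduct $\Delta$, counit $\varepsilon$, antipode $S$, write $\Delta(\xi)=\xi_1\otimes\xi_2$ (sum understood). A quasitriangular Hopf algebra $(H,\mathcal R)$ is a Hopf algebra with an invertible $\mathcal R=R^\alpha\otimes R_\alpha\in H\otimes H$ satisfying $\xi_2\otimes\xi_1=\mathcal R\,\Delta(\xi)\,\mathcal R^{-1}$, $(\Delta\otimes\mathrm{id})\mathcal R=\mathcal R_{13}\mathcal R_{23}$, $(\mathrm{id}\otimes\Delta)\mathcal R=\mathcal R_{13}\mathcal R_{12}$; write $\mathcal R^{-1}=\bar R^\alpha\otimes\bar R_\alpha$. A left $H$-module algebra is an algebra $A$ with left $H$-action satisfying $\xi\triangleright(ab)=(\xi_1\triangleright a)(\xi_2\triangleright b)$, $\xi\triangleright1=\varepsilon(\xi)1$. A left $H$-module $A$-bimodule is an $A$-bimodule $V$ with left $H$-action satisfying $\xi\triangleright(a\cdot v)=(\xi_1\triangleright a)\cdot(\xi_2\triangleright v)$, $\xi\triangleright(v\cdot a)=(\xi_1\triangleright v)\cdot(\xi_2\triangleright a)$; it is quasi-commutative if $v\cdot a=(\bar R^\alpha\triangleright a)\cdot(\bar R_\alpha\triangleright v)$ for all $a\in A$, $v\in V$. Tensor products (over $\mathbb K$ or $A$) carry the $H$-action $\xi\triangleright(v\otimes w)=(\xi_1\triangleright v)\otimes(\xi_2\triangleright w)$. A differential calculus over $A$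 is a graded algebra $(\Omega^\bullet=\bigoplus_{n\ge0}\Omega^n,\wedge)$ with $\Omega^0=A$ and $\mathbb K$-linear maps $\mathrm d:\Omega^n\to\Omega^{n+1}$ with $\mathrm d\circ\mathrm d=0$ and $\mathrm d(\theta\wedge\theta')=(\mathrm d\theta)\wedge\theta'+(-1)^{\deg\theta}\theta\wedge\mathrm d\theta'$, such that every $\theta\in\Omega:=\Omega^1$ is of the form $\sum_ia_i\,\mathrm db_i$ with $a_i,b_i\in A$. It is left $H$-covariant if $A$ and $\Omega^\bullet$ are left $H$-module algebras, the $H$-action preserves degree, and $\xi\triangleright\mathrm d\theta=\mathrm d(\xi\triangleright\theta)$. It is graded quasi-commutative if $\theta\wedge\theta'=(-1)^{\deg\theta\deg\theta'}(\bar R^\alpha\triangleright\theta')\wedge(\bar R_\alpha\triangleright\theta)$ for all homogeneous $\theta,\theta'\in\Omega^\bullet$ (including degree $0$). A (right) connection on $V$ is a $\mathbb K$-linear map $\nabla:V\to V\otimes_A\Omega$ with $\nabla(v\cdot a)=(\nabla v)\cdot a+v\otimes_A\mathrm da$; $\mathrm{Con}_A(V)$ is the set of these. For $\mathbb K$-linear maps $P:V\to\widetilde V$, $Q:W\to\widetilde W$ of left $H$-modules: $\xi\blacktriangleright Q:=\xi_1\triangleright\circ Q\circ S(\xi_2)\triangleright$ and $P\otimes_{\mathcal R}Q:=(P\circ\bar R^\alpha\triangleright)\otimes(\bar R_\alpha\blacktriangleright Q)$, where $(P\otimes Q)(v\otimes w)=P(v)\otimes Q(w)$. In particular $\nabla_V\otimes_{\mathcal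 R}\mathrm{id}=\nabla_V\otimes\mathrm{id}$ and $\mathrm{id}\otimes_{\mathcal R}\nabla_W=\bar R^\alpha\triangleright\otimes(\bar R_\alpha\blacktriangleright\nabla_W)$. The inverse braiding $\tau^{-1}_{\mathcal R}:\Omega\otimes_AW\to W\otimes_A\Omega$ is the (well defined) isomorphism $\theta\otimes_Aw\mapsto(R_\alpha\triangleright w)\otimes_A(R^\alpha\triangleright\theta)$. *)

theory Defs
  imports "HOL-Algebra.Module" "HOL-Algebra.QuotRing" "HOL-Algebra.Free_Abelian_Groups"
begin

section \<open>Tensor products\<close>

text \<open>
  The tensor product over a ring with carrier \<open>B\<close> of a right module \<open>V\<close> (right action \<open>ra\<close>) and a
  left module \<open>W\<close> (left action \<open>la\<close>) is the free abelian group on \<open>V \<times> W\<close> modulo the subgroup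
  generated by the usual biadditivity and balancing relations.  Its elements are cosets of formal
  sums.
\<close>

type_synonym ('v, 'w) tens = "(('v \<times> 'w) \<Rightarrow>\<^sub>0 int) set"

definition tens_rel ::
  "'b set \<Rightarrow> ('v \<Rightarrow> 'b \<Rightarrow> 'v) \<Rightarrow> ('b \<Rightarrow> 'w \<Rightarrow> 'w) \<Rightarrow> ('v, 'm) ring_scheme \<Rightarrow> ('w, 'n) ring_scheme
    \<Rightarrow> (('v \<times> 'w) \<Rightarrow>\<^sub>0 int) set" where
  "tens_rel B ra la V W =
     {frag_of (v \<oplus>\<^bsub>V\<^esub> v', w) - frag_of (v, w) - frag_of (v', w) | v v' w.
        v \<in> carrier V \<and> v' \<in> carrier V \<and> w \<in> carrier W} \<union>
     {frag_of (v, w \<oplus>\<^bsub>W\<^esub> w') - frag_of (v, w) - frag_of (v, w') | v w w'.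
        v \<in> carrier V \<and> w \<in> carrier W \<and> w' \<in> carrier W} \<union>
     {frag_of (ra v b, w) - frag_of (v, la b w) | v b w.
        v \<in> carrier V \<and> b \<in> B \<and> w \<in> carrier W}"

definition tens_null ::
  "'b set \<Rightarrow> ('v \<Rightarrow> 'b \<Rightarrow> 'v) \<Rightarrow> ('b \<Rightarrow> 'w \<Rightarrow> 'w) \<Rightarrow> ('v, 'm) ring_scheme \<Rightarrow> ('w, 'n) ring_scheme
    \<Rightarrow> (('v \<times> 'w) \<Rightarrow>\<^sub>0 int) set" where
  "tens_null B ra la V W =
     generate (free_Abelian_group (carrier V \<times> carrier W)) (tens_rel B ra la V W)"

definition tens_group ::
  "'b set \<Rightarrow> ('v \<Rightarrow> 'b \<Rightarrow> 'v) \<Rightarrow> ('b \<Rightarrow> 'w \<Rightarrow> 'w) \<Rightarrow> ('v, 'm) ring_scheme \<Rightarrow> ('w, 'n) ring_scheme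
    \<Rightarrow> ('v, 'w) tens monoid" where
  "tens_group B ra la V W =
     free_Abelian_group (carrier V \<times> carrier W) Mod tens_null B ra la V W"

definition tens_pure ::
  "'b set \<Rightarrow> ('v \<Rightarrow> 'b \<Rightarrow> 'v) \<Rightarrow> ('b \<Rightarrow> 'w \<Rightarrow> 'w) \<Rightarrow> ('v, 'm) ring_scheme \<Rightarrow> ('w, 'n) ring_scheme
    \<Rightarrow> 'v \<Rightarrow> 'w \<Rightarrow> ('v, 'w) tens" where
  "tens_pure B ra la V W v w =
     tens_null B ra la V W #>\<^bsub>free_Abelian_group (carrier V \<times> carrier W)\<^esub> frag_of (v, w)"

text \<open>
  \<open>tens_lift T f\<close> is the additive map into the abelian group \<open>T\<close> (written additively) determined by
  \<open>v \<otimes> w \<mapsto> f v w\<close>: it sends a coset to the common value that the additive extension of \<open>f\<close> to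
  formal sums takes on all representatives.  It is meaningful whenever \<open>f\<close> is biadditive and
  balanced, and then \<open>tens_lift T f (v \<otimes> w) = f v w\<close>; see \<open>tens_lift_pure\<close> below.  It renders all
  Sweedler-type expressions: if \<open>\<Delta>(\<xi>) = \<xi>\<^sub>1 \<otimes> \<xi>\<^sub>2\<close>, then \<open>tens_lift T f (\<Delta> \<xi>)\<close> is \<open>f \<xi>\<^sub>1 \<xi>\<^sub>2\<close>, sum
  understood.
\<close>

definition frag_eval ::
  "('t, 'm) ring_scheme \<Rightarrow> ('v \<Rightarrow> 'w \<Rightarrow> 't) \<Rightarrow> (('v \<times> 'w) \<Rightarrow>\<^sub>0 int) \<Rightarrow> 't" where
  "frag_eval T f c =
     (\<Oplus>\<^bsub>T\<^esub>p \<in> Poly_Mapping.keys c. [Poly_Mapping.lookup c p] \<cdot>\<^bsub>T\<^esub> f (fst p) (snd p))"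

definition tens_lift ::
  "('t, 'm) ring_scheme \<Rightarrow> ('v \<Rightarrow> 'w \<Rightarrow> 't) \<Rightarrow> ('v, 'w) tens \<Rightarrow> 't" where
  "tens_lift T f X = the_elem (frag_eval T f ` X)"


lemma frag_eval_superset:
  assumes T: "abelian_group T" and F: "finite F" "Poly_Mapping.keys c \<subseteq> F"
    and f: "\<And>v w. (v, w) \<in> F \<Longrightarrow> f v w \<in> carrier T"
  shows "frag_eval T f c = (\<Oplus>\<^bsub>T\<^esub>p \<in> F. [Poly_Mapping.lookup c p] \<cdot>\<^bsub>T\<^esub> f (fst p) (snd p))"
proof -
  interpret T: abelian_group T by (rule T)
  have z: "[(0 :: int)] \<cdot>\<^bsub>T\<^esub> x = \<zero>\<^bsub>T\<^esub>" for x by (simp add: add_pow_def)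
  show ?thesis
    unfolding frag_eval_def
    by (rule T.add.finprod_mono_neutral_cong_left)
       (use F f in \<open>auto simp: z in_keys_iff intro!: T.add.int_pow_closed\<close>)
qed

lemma frag_eval_add:
  assumes T: "abelian_group T"
    and f: "\<And>v w. (v, w) \<in> S \<Longrightarrow> f v w \<in> carrier T"
    and c: "Poly_Mapping.keys c \<subseteq> S" and d: "Poly_Mapping.keys d \<subseteq> S"
  shows "frag_eval T f (c + d) = frag_eval T f c \<oplus>\<^bsub>T\<^esub> frag_eval T f d"
proof -
  interpret T: abelian_group T by (rule T)
  let ?F = "Poly_Mapping.keys c \<union> Poly_Mapping.keys d"
  have F: "finite ?F" "Poly_Mapping.keys (c + d) \<subseteq> ?F" by (auto dest: subsetD [OF keys_add])
  have fF: "\<And>v w. (v, w) \<in> ?F \<Longrightarrow> f v w \<in> carrier T" using c d f by blast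
  have eq: "frag_eval T f c = (\<Oplus>\<^bsub>T\<^esub>p \<in> ?F. [Poly_Mapping.lookup c p] \<cdot>\<^bsub>T\<^esub> f (fst p) (snd p))"
    "frag_eval T f d = (\<Oplus>\<^bsub>T\<^esub>p \<in> ?F. [Poly_Mapping.lookup d p] \<cdot>\<^bsub>T\<^esub> f (fst p) (snd p))"
    "frag_eval T f (c + d) =
       (\<Oplus>\<^bsub>T\<^esub>p \<in> ?F. [Poly_Mapping.lookup (c + d) p] \<cdot>\<^bsub>T\<^esub> f (fst p) (snd p))"
    using F fF by (auto intro!: frag_eval_superset [OF T])
  have cl: "[k] \<cdot>\<^bsub>T\<^esub> f (fst p) (snd p) \<in> carrier T" if "p \<in> ?F" for p and k :: int
    using fF [of "fst p" "snd p"] that by (simp del: Un_iff)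
  have "(\<Oplus>\<^bsub>T\<^esub>p \<in> ?F. [Poly_Mapping.lookup (c + d) p] \<cdot>\<^bsub>T\<^esub> f (fst p) (snd p)) =
    (\<Oplus>\<^bsub>T\<^esub>p \<in> ?F. [Poly_Mapping.lookup c p] \<cdot>\<^bsub>T\<^esub> f (fst p) (snd p) \<oplus>\<^bsub>T\<^esub>
        [Poly_Mapping.lookup d p] \<cdot>\<^bsub>T\<^esub> f (fst p) (snd p))"
  proof (rule T.finsum_cong'[OF refl])
    show "(\<lambda>p. [Poly_Mapping.lookup c p] \<cdot>\<^bsub>T\<^esub> f (fst p) (snd p) \<oplus>\<^bsub>T\<^esub>
        [Poly_Mapping.lookup d p] \<cdot>\<^bsub>T\<^esub> f (fst p) (snd p)) \<in> ?F \<rightarrow> carrier T"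
      using cl by (blast intro: T.add.m_closed)
    fix p assume p: "p \<in> ?F"
    have "f (fst p) (snd p) \<in> carrier T" using fF [of "fst p" "snd p"] p by simp
    then show "[Poly_Mapping.lookup (c + d) p] \<cdot>\<^bsub>T\<^esub> f (fst p) (snd p) =
        [Poly_Mapping.lookup c p] \<cdot>\<^bsub>T\<^esub> f (fst p) (snd p) \<oplus>\<^bsub>T\<^esub>
        [Poly_Mapping.lookup d p] \<cdot>\<^bsub>T\<^esub> f (fst p) (snd p)"
      by (simp add: lookup_add T.add.int_pow_mult)
  qed
  also have "\<dots> = frag_eval T f c \<oplus>\<^bsub>T\<^esub> frag_eval T f d"
    unfolding eq using cl by (intro T.finsum_addf) (blast intro: T.add.m_closed)+
  finally show ?thesis using eq(3) by simp
qed

lemma frag_eval_of: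
  assumes "abelian_group T" "f v w \<in> carrier T"
  shows "frag_eval T f (frag_of (v, w)) = f v w"
proof -
  interpret T: abelian_group T by fact
  show ?thesis
    using assms by (simp add: frag_eval_def)
qed

lemma tens_lift_pure:
  fixes V :: "('v, 'm) ring_scheme" and W :: "('w, 'n) ring_scheme"
    and T :: "('t, 'q) ring_scheme"
  assumes T: "abelian_group T"
    and V: "\<And>x y. \<lbrakk>x \<in> carrier V; y \<in> carrier V\<rbrakk> \<Longrightarrow> x \<oplus>\<^bsub>V\<^esub> y \<in> carrier V"
    and W: "\<And>x y. \<lbrakk>x \<in> carrier W; y \<in> carrier W\<rbrakk> \<Longrightarrow> x \<oplus>\<^bsub>W\<^esub> y \<in> carrier W"
    and ra: "\<And>x b. \<lbrakk>x \<in> carrier V; b \<in> B\<rbrakk> \<Longrightarrow> ra x b \<in> carrier V"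
    and la: "\<And>b y. \<lbrakk>b \<in> B; y \<in> carrier W\<rbrakk> \<Longrightarrow> la b y \<in> carrier W"
    and f: "\<And>x y. \<lbrakk>x \<in> carrier V; y \<in> carrier W\<rbrakk> \<Longrightarrow> f x y \<in> carrier T"
    and fl: "\<And>x x' y. \<lbrakk>x \<in> carrier V; x' \<in> carrier V; y \<in> carrier W\<rbrakk>
               \<Longrightarrow> f (x \<oplus>\<^bsub>V\<^esub> x') y = f x y \<oplus>\<^bsub>T\<^esub> f x' y"
    and fr: "\<And>x y y'. \<lbrakk>x \<in> carrier V; y \<in> carrier W; y' \<in> carrier W\<rbrakk>
               \<Longrightarrow> f x (y \<oplus>\<^bsub>W\<^esub> y') = f x y \<oplus>\<^bsub>T\<^esub> f x y'"
    and fb: "\<And>x b y. \<lbrakk>x \<in> carrier V; b \<in> B; y \<in> carrier W\<rbrakk> \<Longrightarrow> f (ra x b) y = f x (la b y)"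
    and v: "v \<in> carrier V" and w: "w \<in> carrier W"
  shows "tens_lift T f (tens_pure B ra la V W v w) = f v w"
proof -
  interpret T: abelian_group T by (rule T)
  let ?S = "carrier V \<times> carrier W" and ?G = "free_Abelian_group (carrier V \<times> carrier W)"
  let ?N = "tens_null B ra la V W"
  have fS: "\<And>x y. (x, y) \<in> ?S \<Longrightarrow> f x y \<in> carrier T" using f by auto
  interpret h: group_hom ?G "add_monoid T" "frag_eval T f"
  proof (intro group_hom.intro group_hom_axioms.intro homI)
    show "group ?G" by simp
    show "group (add_monoid T)" by (rule T.add.is_group)
    fix c d assume "c \<in> carrier ?G" "d \<in> carrier ?G"
    then show "frag_eval T f (c \<otimes>\<^bsub>?G\<^esub> d) = frag_eval T f c \<otimes>\<^bsub>add_monoid T\<^esub> frag_eval T f d"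
      using frag_eval_add [OF T, of ?S f c d] fS by simp
  next
    fix c assume "c \<in> carrier ?G"
    then have "[k] \<cdot>\<^bsub>T\<^esub> f (fst p) (snd p) \<in> carrier T" if "p \<in> Poly_Mapping.keys c" for p and k :: int
      using fS [of "fst p" "snd p"] that by auto
    then show "frag_eval T f c \<in> carrier (add_monoid T)"
      unfolding frag_eval_def partial_object.simps by (intro T.finsum_closed) auto
  qed
  have ev: "frag_eval T f (frag_of (x, y)) = f x y" if "x \<in> carrier V" "y \<in> carrier W" for x y
    by (rule frag_eval_of [where T = T and f = f, OF T f [OF that]])
  have dif: "frag_eval T f (c - d) = frag_eval T f c \<ominus>\<^bsub>T\<^esub> frag_eval T f d"
    if "Poly_Mapping.keys c \<subseteq> ?S" "Poly_Mapping.keys d \<subseteq> ?S" for c d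
  proof -
    have "frag_eval T f (c - d) = frag_eval T f (c \<otimes>\<^bsub>?G\<^esub> inv\<^bsub>?G\<^esub> d)" using that by simp
    also have "\<dots> = frag_eval T f c \<oplus>\<^bsub>T\<^esub> inv\<^bsub>add_monoid T\<^esub> frag_eval T f d"
      using h.hom_mult [of c "inv\<^bsub>?G\<^esub> d"] h.hom_inv [of d] h.inv_closed [of d] that by simp
    finally show ?thesis by (simp add: a_minus_def a_inv_def)
  qed
  have kd: "Poly_Mapping.keys (c - d) \<subseteq> ?S"
    if "Poly_Mapping.keys c \<subseteq> ?S" "Poly_Mapping.keys d \<subseteq> ?S" for c d :: "('v \<times> 'w) \<Rightarrow>\<^sub>0 int"
    by (rule order_trans [OF keys_diff Un_least [OF that]])
  have cancel: "(x \<oplus>\<^bsub>T\<^esub> y) \<ominus>\<^bsub>T\<^esub> x \<ominus>\<^bsub>T\<^esub> y = \<zero>\<^bsub>T\<^esub>"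
    if "x \<in> carrier T" "y \<in> carrier T" for x y
  proof -
    have "(x \<oplus>\<^bsub>T\<^esub> y) \<ominus>\<^bsub>T\<^esub> x = y"
      unfolding a_minus_def using that by (metis T.a_comm T.a_assoc T.a_inv_closed T.r_neg T.r_zero)
    then show ?thesis using that by (simp add: a_minus_def T.r_neg)
  qed
  have rel: "tens_rel B ra la V W \<subseteq> kernel ?G (add_monoid T) (frag_eval T f)"
  proof
    fix c assume "c \<in> tens_rel B ra la V W"
    then consider
        (l) x x' y where "c = frag_of (x \<oplus>\<^bsub>V\<^esub> x', y) - frag_of (x, y) - frag_of (x', y)"
             "x \<in> carrier V" "x' \<in> carrier V" "y \<in> carrier W"
      | (r) x y y' where "c = frag_of (x, y \<oplus>\<^bsub>W\<^esub> y') - frag_of (x, y) - frag_of (x, y')"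
             "x \<in> carrier V" "y \<in> carrier W" "y' \<in> carrier W"
      | (b) x b y where "c = frag_of (ra x b, y) - frag_of (x, la b y)"
             "x \<in> carrier V" "b \<in> B" "y \<in> carrier W"
      unfolding tens_rel_def by (elim UnE CollectE exE conjE) simp_all
    then show "c \<in> kernel ?G (add_monoid T) (frag_eval T f)"
    proof cases
      case l
      then show ?thesis unfolding kernel_def using V f fl
        by (simp add: kd dif ev cancel)
    next
      case r
      then show ?thesis unfolding kernel_def using W f fr
        by (simp add: kd dif ev cancel)
    next
      case b
      then show ?thesis unfolding kernel_def using ra la f fb
        by (simp add: kd dif ev a_minus_def T.r_neg)
    qed
  qed
  have "?N \<subseteq> kernel ?G (add_monoid T) (frag_eval T f)"
    unfolding tens_null_def
    by (rule group.generate_subgroup_incl [OF _ rel h.subgroup_kernel]) simp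
  then have N: "n \<in> carrier ?G \<and> frag_eval T f n = \<zero>\<^bsub>T\<^esub>" if "n \<in> ?N" for n
    using that unfolding kernel_def by auto
  have vw: "frag_of (v, w) \<in> carrier ?G" using v w by simp
  have eq: "frag_eval T f (n \<otimes>\<^bsub>?G\<^esub> frag_of (v, w)) = f v w" if "n \<in> ?N" for n
    using h.hom_mult [of n "frag_of (v, w)"] N [OF that] vw v w f by (simp add: ev)
  have "tens_pure B ra la V W v w = (\<lambda>n. n \<otimes>\<^bsub>?G\<^esub> frag_of (v, w)) ` ?N"
    unfolding tens_pure_def r_coset_def by blast
  then have "frag_eval T f ` tens_pure B ra la V W v w = (\<lambda>n. f v w) ` ?N"
    by (simp only: image_image eq cong: image_cong)
  moreover have "\<one>\<^bsub>?G\<^esub> \<in> ?N" unfolding tens_null_def by (rule generate.one)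
  ultimately have "frag_eval T f ` tens_pure B ra la V W v w = {f v w}"
    by (simp only: image_constant)
  then show ?thesis by (simp add: tens_lift_def)
qed


section \<open>Modules, algebras and tensor products over the ground ring\<close>

text \<open>
  Modules over the ground ring \<open>K\<close> are those of \<^locale>\<open>module\<close>; the ring multiplication and unit
  fields of the record play no role there.
\<close>

definition k_linear ::
  "('k, 'l) ring_scheme \<Rightarrow> ('k, 'v, 'm) module_scheme \<Rightarrow> ('k, 'w, 'n) module_scheme
    \<Rightarrow> ('v \<Rightarrow> 'w) \<Rightarrow> bool" where
  "k_linear K V W f \<longleftrightarrow>
     f \<in> carrier V \<rightarrow> carrier W \<and>
     (\<forall>x\<in>carrier V. \<forall>y\<in>carrier V. f (x \<oplus>\<^bsub>V\<^esub> y) = f x \<oplus>\<^bsub>W\<^esub> f y) \<and>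
     (\<forall>k\<in>carrier K. \<forall>x\<in>carrier V. f (k \<odot>\<^bsub>V\<^esub> x) = k \<odot>\<^bsub>W\<^esub> f x)"

text \<open>Associative unital algebras; the library locale \<^locale>\<open>algebra\<close> is the commutative case.\<close>

locale k_algebra = module K A + ring A for K and A (structure) +
  assumes smult_mult_left:
      "\<lbrakk>k \<in> carrier K; a \<in> carrier A; b \<in> carrier A\<rbrakk> \<Longrightarrow> (k \<odot> a) \<otimes> b = k \<odot> (a \<otimes> b)"
    and smult_mult_right:
      "\<lbrakk>k \<in> carrier K; a \<in> carrier A; b \<in> carrier A\<rbrakk> \<Longrightarrow> a \<otimes> (k \<odot> b) = k \<odot> (a \<otimes> b)"

definition pure_K ::
  "('k, 'l) ring_scheme \<Rightarrow> ('k, 'v, 'm) module_scheme \<Rightarrow> ('k, 'w, 'n) module_scheme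
    \<Rightarrow> 'v \<Rightarrow> 'w \<Rightarrow> ('v, 'w) tens" where
  "pure_K K V W = tens_pure (carrier K) (\<lambda>v k. k \<odot>\<^bsub>V\<^esub> v) (\<lambda>k w. k \<odot>\<^bsub>W\<^esub> w) V W"

text \<open>
  \<open>V \<otimes> W\<close> as a \<open>K\<close>-module.  If \<open>V\<close> and \<open>W\<close> are algebras, multiplication and unit are those of the
  tensor product algebra, \<open>(v \<otimes> w)(v' \<otimes> w') = vv' \<otimes> ww'\<close>; otherwise these two fields are
  irrelevant.
\<close>

definition tensor_K ::
  "('k, 'l) ring_scheme \<Rightarrow> ('k, 'v, 'm) module_scheme \<Rightarrow> ('k, 'w, 'n) module_scheme
    \<Rightarrow> ('k, ('v, 'w) tens) module" where
  "tensor_K K V W =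
    (let G = tens_group (carrier K) (\<lambda>v k. k \<odot>\<^bsub>V\<^esub> v) (\<lambda>k w. k \<odot>\<^bsub>W\<^esub> w) V W;
         T = \<lparr>carrier = carrier G, monoid.mult = undefined, monoid.one = undefined,
              ring.zero = \<one>\<^bsub>G\<^esub>, add = monoid.mult G\<rparr>
     in \<lparr>carrier = carrier G,
         monoid.mult = (\<lambda>X Y. tens_lift T (\<lambda>v w. tens_lift T
            (\<lambda>v' w'. pure_K K V W (v \<otimes>\<^bsub>V\<^esub> v') (w \<otimes>\<^bsub>W\<^esub> w')) Y) X),
         monoid.one = pure_K K V W \<one>\<^bsub>V\<^esub> \<one>\<^bsub>W\<^esub>,
         ring.zero = \<one>\<^bsub>G\<^esub>,
         add = monoid.mult G,
         smult = (\<lambda>k. tens_lift T (\<lambda>v w. pure_K K V W (k \<odot>\<^bsub>V\<^esub> v) w))\<rparr>)"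

text \<open>\<open>P \<otimes> Q : V \<otimes> W \<rightarrow> V' \<otimes> W'\<close>; the source modules are not needed as arguments.\<close>

definition map_tensor ::
  "('k, 'l) ring_scheme \<Rightarrow> ('k, 'v1, 'm) module_scheme \<Rightarrow> ('k, 'w1, 'n) module_scheme
    \<Rightarrow> ('v \<Rightarrow> 'v1) \<Rightarrow> ('w \<Rightarrow> 'w1) \<Rightarrow> ('v, 'w) tens \<Rightarrow> ('v1, 'w1) tens" where
  "map_tensor K V' W' P Q =
     tens_lift (tensor_K K V' W') (\<lambda>v w. pure_K K V' W' (P v) (Q w))"


section \<open>Quasitriangular Hopf algebras\<close>

record ('k, 'h) hopf = "('k, 'h) module" +
  comult :: "'h \<Rightarrow> ('h, 'h) tens"
  counit :: "'h \<Rightarrow> 'k"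
  antipode :: "'h \<Rightarrow> 'h"

text \<open>The threefold tensor power is taken to be \<open>(H \<otimes> H) \<otimes> H\<close>.\<close>

abbreviation tensor2 ::
  "('k, 'l) ring_scheme \<Rightarrow> ('k, 'h, 'm) module_scheme \<Rightarrow> ('k, ('h, 'h) tens) module" where
  "tensor2 K H \<equiv> tensor_K K H H"

abbreviation tensor3 ::
  "('k, 'l) ring_scheme \<Rightarrow> ('k, 'h, 'm) module_scheme
    \<Rightarrow> ('k, (('h, 'h) tens, 'h) tens) module" where
  "tensor3 K H \<equiv> tensor_K K (tensor2 K H) H"

definition pure3 ::
  "('k, 'l) ring_scheme \<Rightarrow> ('k, 'h, 'm) module_scheme \<Rightarrow> 'h \<Rightarrow> 'h \<Rightarrow> 'h
    \<Rightarrow> (('h, 'h) tens, 'h) tens" where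
  "pure3 K H x y z = pure_K K (tensor2 K H) H (pure_K K H H x y) z"

definition comult_id ::
  "('k, 'l) ring_scheme \<Rightarrow> ('k, 'h, 'm) hopf_scheme \<Rightarrow> ('h, 'h) tens
    \<Rightarrow> (('h, 'h) tens, 'h) tens" where
  "comult_id K H = tens_lift (tensor3 K H) (\<lambda>x z. pure_K K (tensor2 K H) H (comult H x) z)"

definition id_comult ::
  "('k, 'l) ring_scheme \<Rightarrow> ('k, 'h, 'm) hopf_scheme \<Rightarrow> ('h, 'h) tens
    \<Rightarrow> (('h, 'h) tens, 'h) tens" where
  "id_comult K H = tens_lift (tensor3 K H)
     (\<lambda>x z. tens_lift (tensor3 K H) (\<lambda>y y'. pure3 K H x y y') (comult H z))"

locale hopf_algebra = k_algebra K H for K and H (structure) +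
  assumes comult_linear: "k_linear K H (tensor2 K H) (comult H)"
    and comult_mult:
      "\<lbrakk>x \<in> carrier H; y \<in> carrier H\<rbrakk>
        \<Longrightarrow> comult H (x \<otimes> y) = comult H x \<otimes>\<^bsub>tensor2 K H\<^esub> comult H y"
    and comult_one: "comult H \<one> = \<one>\<^bsub>tensor2 K H\<^esub>"
    and counit_closed: "x \<in> carrier H \<Longrightarrow> counit H x \<in> carrier K"
    and counit_add:
      "\<lbrakk>x \<in> carrier H; y \<in> carrier H\<rbrakk> \<Longrightarrow> counit H (x \<oplus> y) = counit H x \<oplus>\<^bsub>K\<^esub> counit H y"
    and counit_smult:
      "\<lbrakk>k \<in> carrier K; x \<in> carrier H\<rbrakk> \<Longrightarrow> counit H (k \<odot> x) = k \<otimes>\<^bsub>K\<^esub> counit H x"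
    and counit_mult:
      "\<lbrakk>x \<in> carrier H; y \<in> carrier H\<rbrakk> \<Longrightarrow> counit H (x \<otimes> y) = counit H x \<otimes>\<^bsub>K\<^esub> counit H y"
    and counit_one: "counit H \<one> = \<one>\<^bsub>K\<^esub>"
    and coassoc: "x \<in> carrier H \<Longrightarrow> comult_id K H (comult H x) = id_comult K H (comult H x)"
    and counit_left: "x \<in> carrier H \<Longrightarrow> tens_lift H (\<lambda>y z. counit H y \<odot> z) (comult H x) = x"
    and counit_right: "x \<in> carrier H \<Longrightarrow> tens_lift H (\<lambda>y z. counit H z \<odot> y) (comult H x) = x"
    and antipode_linear: "k_linear K H H (antipode H)"
    and antipode_left:
      "x \<in> carrier H
        \<Longrightarrow> tens_lift H (\<lambda>y z. antipode H y \<otimes> z) (comult H x) = counit H x \<odot> \<one>"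
    and antipode_right:
      "x \<in> carrier H
        \<Longrightarrow> tens_lift H (\<lambda>y z. y \<otimes> antipode H z) (comult H x) = counit H x \<odot> \<one>"

locale quasitriangular = hopf_algebra K H for K and H (structure) and R :: "('h, 'h) tens" +
  assumes R_invertible: "R \<in> Units (tensor2 K H)"
    and R_comult:
      "x \<in> carrier H
        \<Longrightarrow> tens_lift (tensor2 K H) (\<lambda>y z. pure_K K H H z y) (comult H x) =
            R \<otimes>\<^bsub>tensor2 K H\<^esub> comult H x \<otimes>\<^bsub>tensor2 K H\<^esub> inv\<^bsub>tensor2 K H\<^esub> R"
    and comult_id_R:
      "comult_id K H R =
         tens_lift (tensor3 K H) (\<lambda>r s. pure3 K H r \<one> s) R
         \<otimes>\<^bsub>tensor3 K H\<^esub> tens_lift (tensor3 K H) (\<lambda>r s. pure3 K H \<one> r s) R"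
    and id_comult_R:
      "id_comult K H R =
         tens_lift (tensor3 K H) (\<lambda>r s. pure3 K H r \<one> s) R
         \<otimes>\<^bsub>tensor3 K H\<^esub> tens_lift (tensor3 K H) (\<lambda>r s. pure3 K H r s \<one>) R"


section \<open>Module algebras and bimodules\<close>

record ('k, 'h, 'v) hmod = "('k, 'v) module" +
  hact :: "'h \<Rightarrow> 'v \<Rightarrow> 'v"

record ('k, 'h, 'a, 'v) hbimod = "('k, 'h, 'v) hmod" +
  lact :: "'a \<Rightarrow> 'v \<Rightarrow> 'v"
  ract :: "'v \<Rightarrow> 'a \<Rightarrow> 'v"

locale h_module = module K V
  for K and H :: "('k, 'h, 'p) hopf_scheme" and V :: "('k, 'h, 'v, 'm) hmod_scheme" (structure) +
  assumes hact_linear: "\<xi> \<in> carrier H \<Longrightarrow> k_linear K V V (hact V \<xi>)"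
    and hact_add:
      "\<lbrakk>\<xi> \<in> carrier H; \<eta> \<in> carrier H; v \<in> carrier V\<rbrakk>
        \<Longrightarrow> hact V (\<xi> \<oplus>\<^bsub>H\<^esub> \<eta>) v = hact V \<xi> v \<oplus> hact V \<eta> v"
    and hact_smult:
      "\<lbrakk>k \<in> carrier K; \<xi> \<in> carrier H; v \<in> carrier V\<rbrakk>
        \<Longrightarrow> hact V (k \<odot>\<^bsub>H\<^esub> \<xi>) v = k \<odot> hact V \<xi> v"
    and hact_mult:
      "\<lbrakk>\<xi> \<in> carrier H; \<eta> \<in> carrier H; v \<in> carrier V\<rbrakk>
        \<Longrightarrow> hact V (\<xi> \<otimes>\<^bsub>H\<^esub> \<eta>) v = hact V \<xi> (hact V \<eta> v)"
    and hact_one: "v \<in> carrier V \<Longrightarrow> hact V \<one>\<^bsub>H\<^esub> v = v"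

locale h_module_algebra = k_algebra K A + h_module K H A
  for K and H :: "('k, 'h, 'p) hopf_scheme" and A :: "('k, 'h, 'a, 'm) hmod_scheme" (structure) +
  assumes hact_alg_mult:
      "\<lbrakk>\<xi> \<in> carrier H; a \<in> carrier A; b \<in> carrier A\<rbrakk>
        \<Longrightarrow> hact A \<xi> (a \<otimes> b) =
            tens_lift A (\<lambda>\<xi>1 \<xi>2. hact A \<xi>1 a \<otimes> hact A \<xi>2 b) (comult H \<xi>)"
    and hact_alg_one: "\<xi> \<in> carrier H \<Longrightarrow> hact A \<xi> \<one> = counit H \<xi> \<odot> \<one>"

text \<open>
  Bimodules over the \<open>K\<close>-algebra \<open>A\<close>; both actions are \<open>K\<close>-bilinear for one and the same \<open>K\<close>-module
  structure on \<open>V\<close>.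
\<close>

locale h_bimodule = h_module K H V
  for K and H :: "('k, 'h, 'p) hopf_scheme" and A :: "('k, 'h, 'a, 'n) hmod_scheme"
    and V :: "('k, 'h, 'a, 'v, 'm) hbimod_scheme" (structure) +
  assumes lact_linear: "a \<in> carrier A \<Longrightarrow> k_linear K V V (lact V a)"
    and lact_add:
      "\<lbrakk>a \<in> carrier A; b \<in> carrier A; v \<in> carrier V\<rbrakk>
        \<Longrightarrow> lact V (a \<oplus>\<^bsub>A\<^esub> b) v = lact V a v \<oplus> lact V b v"
    and lact_smult:
      "\<lbrakk>k \<in> carrier K; a \<in> carrier A; v \<in> carrier V\<rbrakk>
        \<Longrightarrow> lact V (k \<odot>\<^bsub>A\<^esub> a) v = k \<odot> lact V a v"
    and lact_mult:
      "\<lbrakk>a \<in> carrier A; b \<in> carrier A; v \<in> carrier V\<rbrakk>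
        \<Longrightarrow> lact V (a \<otimes>\<^bsub>A\<^esub> b) v = lact V a (lact V b v)"
    and lact_one: "v \<in> carrier V \<Longrightarrow> lact V \<one>\<^bsub>A\<^esub> v = v"
    and ract_linear: "a \<in> carrier A \<Longrightarrow> k_linear K V V (\<lambda>v. ract V v a)"
    and ract_add:
      "\<lbrakk>a \<in> carrier A; b \<in> carrier A; v \<in> carrier V\<rbrakk>
        \<Longrightarrow> ract V v (a \<oplus>\<^bsub>A\<^esub> b) = ract V v a \<oplus> ract V v b"
    and ract_smult:
      "\<lbrakk>k \<in> carrier K; a \<in> carrier A; v \<in> carrier V\<rbrakk>
        \<Longrightarrow> ract V v (k \<odot>\<^bsub>A\<^esub> a) = k \<odot> ract V v a"
    and ract_mult:
      "\<lbrakk>a \<in> carrier A; b \<in> carrier A; v \<in> carrier V\<rbrakk>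
        \<Longrightarrow> ract V v (a \<otimes>\<^bsub>A\<^esub> b) = ract V (ract V v a) b"
    and ract_one: "v \<in> carrier V \<Longrightarrow> ract V v \<one>\<^bsub>A\<^esub> = v"
    and lact_ract:
      "\<lbrakk>a \<in> carrier A; b \<in> carrier A; v \<in> carrier V\<rbrakk>
        \<Longrightarrow> ract V (lact V a v) b = lact V a (ract V v b)"
    and hact_lact:
      "\<lbrakk>\<xi> \<in> carrier H; a \<in> carrier A; v \<in> carrier V\<rbrakk>
        \<Longrightarrow> hact V \<xi> (lact V a v) =
            tens_lift V (\<lambda>\<xi>1 \<xi>2. lact V (hact A \<xi>1 a) (hact V \<xi>2 v)) (comult H \<xi>)"
    and hact_ract:
      "\<lbrakk>\<xi> \<in> carrier H; a \<in> carrier A; v \<in> carrier V\<rbrakk>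
        \<Longrightarrow> hact V \<xi> (ract V v a) =
            tens_lift V (\<lambda>\<xi>1 \<xi>2. ract V (hact V \<xi>1 v) (hact A \<xi>2 a)) (comult H \<xi>)"

definition quasi_commutative ::
  "('k, 'l) ring_scheme \<Rightarrow> ('k, 'h, 'p) hopf_scheme \<Rightarrow> ('h, 'h) tens
    \<Rightarrow> ('k, 'h, 'a, 'n) hmod_scheme \<Rightarrow> ('k, 'h, 'a, 'v, 'm) hbimod_scheme \<Rightarrow> bool" where
  "quasi_commutative K H R A V \<longleftrightarrow>
     (\<forall>a\<in>carrier A. \<forall>v\<in>carrier V.
        ract V v a =
        tens_lift V (\<lambda>r s. lact V (hact A r a) (hact V s v)) (inv\<^bsub>tensor2 K H\<^esub> R))"

definition pure_A ::
  "('k, 'h, 'a, 'n) hmod_scheme \<Rightarrow> ('k, 'h, 'a, 'v, 'm) hbimod_scheme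
    \<Rightarrow> ('k, 'h, 'a, 'w, 'q) hbimod_scheme \<Rightarrow> 'v \<Rightarrow> 'w \<Rightarrow> ('v, 'w) tens" where
  "pure_A A V W = tens_pure (carrier A) (ract V) (lact W) V W"

text \<open>
  \<open>V \<otimes>\<^sub>A W\<close> as a left \<open>H\<close>-module \<open>A\<close>-bimodule: \<open>k(v \<otimes> w) = kv \<otimes> w\<close>, \<open>\<xi> \<rhd> (v \<otimes> w) = (\<xi>\<^sub>1 \<rhd> v) \<otimes> (\<xi>\<^sub>2 \<rhd> w)\<close>,
  \<open>a(v \<otimes> w) = av \<otimes> w\<close> and \<open>(v \<otimes> w)a = v \<otimes> wa\<close>.  There is no multiplication or unit.
\<close>

definition tensor_A ::
  "('k, 'h, 'p) hopf_scheme \<Rightarrow> ('k, 'h, 'a, 'n) hmod_scheme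
    \<Rightarrow> ('k, 'h, 'a, 'v, 'm) hbimod_scheme \<Rightarrow> ('k, 'h, 'a, 'w, 'q) hbimod_scheme
    \<Rightarrow> ('k, 'h, 'a, ('v, 'w) tens) hbimod" where
  "tensor_A H A V W =
    (let G = tens_group (carrier A) (ract V) (lact W) V W;
         T = \<lparr>carrier = carrier G, monoid.mult = undefined, monoid.one = undefined,
              ring.zero = \<one>\<^bsub>G\<^esub>, add = monoid.mult G\<rparr>
     in \<lparr>carrier = carrier G,
         monoid.mult = undefined,
         monoid.one = undefined,
         ring.zero = \<one>\<^bsub>G\<^esub>,
         add = monoid.mult G,
         smult = (\<lambda>k. tens_lift T (\<lambda>v w. pure_A A V W (k \<odot>\<^bsub>V\<^esub> v) w)),
         hact = (\<lambda>\<xi>. tens_lift T (\<lambda>v w.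
            tens_lift T (\<lambda>\<xi>1 \<xi>2. pure_A A V W (hact V \<xi>1 v) (hact W \<xi>2 w)) (comult H \<xi>))),
         lact = (\<lambda>a. tens_lift T (\<lambda>v w. pure_A A V W (lact V a v) w)),
         ract = (\<lambda>X a. tens_lift T (\<lambda>v w. pure_A A V W v (ract W w a)) X)\<rparr>)"


section \<open>Differential calculi\<close>

text \<open>
  A calculus record carries the algebra \<open>\<Omega>\<^sup>\<bullet>\<close> (with \<open>\<and>\<close> as its multiplication), the components
  \<open>\<Omega>\<^sup>n\<close> as subsets of its carrier, and the maps \<open>d : \<Omega>\<^sup>n \<rightarrow> \<Omega>\<^sup>n\<^sup>+\<^sup>1\<close>, combined into one function
  which is only constrained on homogeneous elements.
\<close>

record ('k, 'h, 'o) dcalc = "('k, 'h, 'o) hmod" +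
  grade :: "nat \<Rightarrow> 'o set"
  diff :: "'o \<Rightarrow> 'o"

abbreviation grade_module :: "('k, 'h, 'o, 'm) dcalc_scheme \<Rightarrow> nat \<Rightarrow> ('k, 'h, 'o, 'm) dcalc_scheme"
  where "grade_module \<Omega> n \<equiv> \<Omega>\<lparr>carrier := grade \<Omega> n\<rparr>"

locale differential_calculus = k_algebra K \<Omega>
  for K and A :: "('k, 'h, 'o, 'n) hmod_scheme" and \<Omega> :: "('k, 'h, 'o, 'm) dcalc_scheme" (structure) +
  assumes grade_submodule: "submodule (grade \<Omega> n) K \<Omega>"
    and grade_decomposition:
      "x \<in> carrier \<Omega> \<Longrightarrow> \<exists>!c. (\<forall>n. c n \<in> grade \<Omega> n) \<and> finite {n. c n \<noteq> \<zero>} \<and>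
         x = (\<Oplus>n \<in> {n. c n \<noteq> \<zero>}. c n)"
    and grade_mult:
      "\<lbrakk>x \<in> grade \<Omega> m; y \<in> grade \<Omega> n\<rbrakk> \<Longrightarrow> x \<otimes> y \<in> grade \<Omega> (m + n)"
    \<comment> \<open>the algebra \<open>A\<close> is \<open>\<Omega>\<^sup>0\<close>, with the operations of \<open>\<Omega>\<^sup>\<bullet>\<close>\<close>
    and grade_zero: "carrier A = grade \<Omega> 0"
    and A_mult: "\<lbrakk>a \<in> carrier A; b \<in> carrier A\<rbrakk> \<Longrightarrow> a \<otimes>\<^bsub>A\<^esub> b = a \<otimes> b"
    and A_one: "\<one>\<^bsub>A\<^esub> = \<one>"
    and A_add: "\<lbrakk>a \<in> carrier A; b \<in> carrier A\<rbrakk> \<Longrightarrow> a \<oplus>\<^bsub>A\<^esub> b = a \<oplus> b"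
    and A_zero: "\<zero>\<^bsub>A\<^esub> = \<zero>"
    and A_smult: "\<lbrakk>k \<in> carrier K; a \<in> carrier A\<rbrakk> \<Longrightarrow> k \<odot>\<^bsub>A\<^esub> a = k \<odot> a"
    and diff_linear: "k_linear K (grade_module \<Omega> n) (grade_module \<Omega> (Suc n)) (diff \<Omega>)"
    and diff_diff: "x \<in> grade \<Omega> n \<Longrightarrow> diff \<Omega> (diff \<Omega> x) = \<zero>"
    and diff_mult:
      "\<lbrakk>x \<in> grade \<Omega> m; y \<in> grade \<Omega> n\<rbrakk>
        \<Longrightarrow> diff \<Omega> (x \<otimes> y) = diff \<Omega> x \<otimes> y \<oplus> [((- 1 :: int) ^ m)] \<cdot>\<^bsub>\<Omega>\<^esub> (x \<otimes> diff \<Omega> y)"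
    and one_forms:
      "x \<in> grade \<Omega> 1 \<Longrightarrow> \<exists>(n::nat) a b. a \<in> {..<n} \<rightarrow> carrier A \<and> b \<in> {..<n} \<rightarrow> carrier A \<and>
         x = (\<Oplus>i\<in>{..<n}. a i \<otimes> diff \<Omega> (b i))"

locale h_covariant_calculus =
  A?: h_module_algebra K H A + \<Omega>?: h_module_algebra K H \<Omega> + differential_calculus K A \<Omega>
  for K and H :: "('k, 'h, 'p) hopf_scheme"
    and A :: "('k, 'h, 'o, 'n) hmod_scheme" and \<Omega> :: "('k, 'h, 'o, 'm) dcalc_scheme" +
  assumes A_hact: "\<lbrakk>\<xi> \<in> carrier H; a \<in> carrier A\<rbrakk> \<Longrightarrow> hact A \<xi> a = hact \<Omega> \<xi> a"
    and hact_grade: "\<lbrakk>\<xi> \<in> carrier H; x \<in> grade \<Omega> n\<rbrakk> \<Longrightarrow> hact \<Omega> \<xi> x \<in> grade \<Omega> n"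
    and hact_diff:
      "\<lbrakk>\<xi> \<in> carrier H; x \<in> grade \<Omega> n\<rbrakk> \<Longrightarrow> hact \<Omega> \<xi> (diff \<Omega> x) = diff \<Omega> (hact \<Omega> \<xi> x)"

definition graded_quasi_commutative ::
  "('k, 'l) ring_scheme \<Rightarrow> ('k, 'h, 'p) hopf_scheme \<Rightarrow> ('h, 'h) tens
    \<Rightarrow> ('k, 'h, 'o, 'm) dcalc_scheme \<Rightarrow> bool" where
  "graded_quasi_commutative K H R \<Omega> \<longleftrightarrow>
     (\<forall>m n. \<forall>x\<in>grade \<Omega> m. \<forall>y\<in>grade \<Omega> n.
        x \<otimes>\<^bsub>\<Omega>\<^esub> y = [((- 1 :: int) ^ (m * n))] \<cdot>\<^bsub>\<Omega>\<^esub>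
          tens_lift \<Omega> (\<lambda>r s. hact \<Omega> r y \<otimes>\<^bsub>\<Omega>\<^esub> hact \<Omega> s x) (inv\<^bsub>tensor2 K H\<^esub> R))"

definition one_form_bimod ::
  "('k, 'h, 'o, 'm) dcalc_scheme \<Rightarrow> ('k, 'h, 'o, 'o) hbimod" where
  "one_form_bimod \<Omega> =
     \<lparr>carrier = grade \<Omega> 1, monoid.mult = undefined, monoid.one = undefined,
      ring.zero = \<zero>\<^bsub>\<Omega>\<^esub>, add = (\<oplus>\<^bsub>\<Omega>\<^esub>), smult = (\<odot>\<^bsub>\<Omega>\<^esub>), hact = hact \<Omega>,
      lact = (\<otimes>\<^bsub>\<Omega>\<^esub>), ract = (\<otimes>\<^bsub>\<Omega>\<^esub>)\<rparr>"


section \<open>Connections\<close>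

text \<open>
  Connections are functions on the carrier of \<open>V\<close>, represented as usual by extensional functions.
\<close>

definition connections ::
  "('k, 'l) ring_scheme \<Rightarrow> ('k, 'h, 'p) hopf_scheme \<Rightarrow> ('k, 'h, 'o, 'n) hmod_scheme
    \<Rightarrow> ('k, 'h, 'o, 'm) dcalc_scheme \<Rightarrow> ('k, 'h, 'o, 'v, 'q) hbimod_scheme
    \<Rightarrow> ('v \<Rightarrow> ('v, 'o) tens) set" where
  "connections K H A \<Omega> V =
     {D \<in> extensional (carrier V).
        k_linear K V (tensor_A H A V (one_form_bimod \<Omega>)) D \<and>
        (\<forall>v\<in>carrier V. \<forall>a\<in>carrier A.
           D (ract V v a) =
             ract (tensor_A H A V (one_form_bimod \<Omega>)) (D v) a
             \<oplus>\<^bsub>tensor_A H A V (one_form_bimod \<Omega>)\<^esub> pure_A A V (one_form_bimod \<Omega>) v (diff \<Omega> a))}"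


section \<open>Sums of connections\<close>

text \<open>\<open>\<xi> \<blacktriangleright> Q = \<xi>\<^sub>1\<rhd> \<circ> Q \<circ> S(\<xi>\<^sub>2)\<rhd>\<close> for \<open>Q : W \<rightarrow> W'\<close>.\<close>

definition hom_act ::
  "('k, 'h, 'p) hopf_scheme \<Rightarrow> ('k, 'h, 'w, 'm) hmod_scheme \<Rightarrow> ('k, 'h, 'w1, 'n) hmod_scheme
    \<Rightarrow> 'h \<Rightarrow> ('w \<Rightarrow> 'w1) \<Rightarrow> 'w \<Rightarrow> 'w1" where
  "hom_act H W W' \<xi> Q w =
     tens_lift W' (\<lambda>\<xi>1 \<xi>2. hact W' \<xi>1 (Q (hact W (antipode H \<xi>2) w))) (comult H \<xi>)"

text \<open>\<open>P \<otimes>\<^sub>\<R> Q\<close> for \<open>P : V \<rightarrow> V'\<close> and \<open>Q : W \<rightarrow> W'\<close>.\<close>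

definition map_tensor_R ::
  "('k, 'l) ring_scheme \<Rightarrow> ('k, 'h, 'p) hopf_scheme \<Rightarrow> ('h, 'h) tens
    \<Rightarrow> ('k, 'h, 'v, 'm1) hmod_scheme \<Rightarrow> ('k, 'h, 'w, 'm2) hmod_scheme
    \<Rightarrow> ('k, 'h, 'v1, 'm3) hmod_scheme \<Rightarrow> ('k, 'h, 'w1, 'm4) hmod_scheme
    \<Rightarrow> ('v \<Rightarrow> 'v1) \<Rightarrow> ('w \<Rightarrow> 'w1) \<Rightarrow> ('v, 'w) tens \<Rightarrow> ('v1, 'w1) tens" where
  "map_tensor_R K H R V W V' W' P Q X =
     tens_lift (tensor_K K V' W')
       (\<lambda>r s. map_tensor K V' W' (\<lambda>v. P (hact V r v)) (hom_act H W W' s Q) X)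
       (inv\<^bsub>tensor2 K H\<^esub> R)"

definition tensor_proj ::
  "('k, 'h, 'p) hopf_scheme \<Rightarrow> ('k, 'h, 'a, 'n) hmod_scheme
    \<Rightarrow> ('k, 'h, 'a, 'v, 'm) hbimod_scheme \<Rightarrow> ('k, 'h, 'a, 'w, 'q) hbimod_scheme
    \<Rightarrow> ('v, 'w) tens \<Rightarrow> ('v, 'w) tens" where
  "tensor_proj H A V W = tens_lift (tensor_A H A V W) (pure_A A V W)"

text \<open>The canonical isomorphism \<open>(U \<otimes>\<^sub>A V) \<otimes>\<^sub>A W \<cong> U \<otimes>\<^sub>A (V \<otimes>\<^sub>A W)\<close> and its inverse.\<close>

definition tensor_assoc ::
  "('k, 'h, 'p) hopf_scheme \<Rightarrow> ('k, 'h, 'a, 'n) hmod_scheme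
    \<Rightarrow> ('k, 'h, 'a, 'u, 'm1) hbimod_scheme \<Rightarrow> ('k, 'h, 'a, 'v, 'm2) hbimod_scheme
    \<Rightarrow> ('k, 'h, 'a, 'w, 'm3) hbimod_scheme
    \<Rightarrow> (('u, 'v) tens, 'w) tens \<Rightarrow> ('u, ('v, 'w) tens) tens" where
  "tensor_assoc H A U V W =
    (let T = tensor_A H A U (tensor_A H A V W)
     in tens_lift T (\<lambda>x w. tens_lift T
          (\<lambda>u v. pure_A A U (tensor_A H A V W) u (pure_A A V W v w)) x))"

definition tensor_assoc_inv ::
  "('k, 'h, 'p) hopf_scheme \<Rightarrow> ('k, 'h, 'a, 'n) hmod_scheme
    \<Rightarrow> ('k, 'h, 'a, 'u, 'm1) hbimod_scheme \<Rightarrow> ('k, 'h, 'a, 'v, 'm2) hbimod_scheme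
    \<Rightarrow> ('k, 'h, 'a, 'w, 'm3) hbimod_scheme
    \<Rightarrow> ('u, ('v, 'w) tens) tens \<Rightarrow> (('u, 'v) tens, 'w) tens" where
  "tensor_assoc_inv H A U V W =
    (let T = tensor_A H A (tensor_A H A U V) W
     in tens_lift T (\<lambda>u y. tens_lift T
          (\<lambda>v w. pure_A A (tensor_A H A U V) W (pure_A A U V u v) w) y))"

text \<open>The inverse braiding \<open>V \<otimes>\<^sub>A W \<rightarrow> W \<otimes>\<^sub>A V\<close>.\<close>

definition inv_braiding ::
  "('k, 'h, 'p) hopf_scheme \<Rightarrow> ('h, 'h) tens \<Rightarrow> ('k, 'h, 'a, 'n) hmod_scheme
    \<Rightarrow> ('k, 'h, 'a, 'v, 'm1) hbimod_scheme \<Rightarrow> ('k, 'h, 'a, 'w, 'm2) hbimod_scheme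
    \<Rightarrow> ('v, 'w) tens \<Rightarrow> ('w, 'v) tens" where
  "inv_braiding H R A V W =
     tens_lift (tensor_A H A W V) (\<lambda>v w. tens_lift (tensor_A H A W V)
       (\<lambda>r s. pure_A A W V (hact W s w) (hact V r v)) R)"

text \<open>
  The inverse braiding on the second and third factor,
  \<open>(U \<otimes>\<^sub>A V) \<otimes>\<^sub>A W \<cong> U \<otimes>\<^sub>A (V \<otimes>\<^sub>A W) \<rightarrow> U \<otimes>\<^sub>A (W \<otimes>\<^sub>A V) \<cong> (U \<otimes>\<^sub>A W) \<otimes>\<^sub>A V\<close>.
\<close>

definition inv_braiding_23 ::
  "('k, 'h, 'p) hopf_scheme \<Rightarrow> ('h, 'h) tens \<Rightarrow> ('k, 'h, 'a, 'n) hmod_scheme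
    \<Rightarrow> ('k, 'h, 'a, 'u, 'm1) hbimod_scheme \<Rightarrow> ('k, 'h, 'a, 'v, 'm2) hbimod_scheme
    \<Rightarrow> ('k, 'h, 'a, 'w, 'm3) hbimod_scheme
    \<Rightarrow> (('u, 'v) tens, 'w) tens \<Rightarrow> (('u, 'w) tens, 'v) tens" where
  "inv_braiding_23 H R A U V W =
     tensor_assoc_inv H A U W V
     \<circ> tens_lift (tensor_A H A U (tensor_A H A W V))
         (\<lambda>u y. pure_A A U (tensor_A H A W V) u (inv_braiding H R A V W y))
     \<circ> tensor_assoc H A U V W"

text \<open>
  The sum of two connections before passing to the quotient, as a map from \<open>V \<otimes> W\<close> (over \<open>K\<close>)
  to \<open>(V \<otimes>\<^sub>A W) \<otimes>\<^sub>A \<Omega>\<close>: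
  \<open>\<tau>\<^sup>-\<^sup>1\<^sub>\<R>\<^sub>2\<^sub>3 \<circ> \<pi> \<circ> (\<nabla>\<^sub>V \<otimes>\<^sub>\<R> id) + \<pi> \<circ> (id \<otimes>\<^sub>\<R> \<nabla>\<^sub>W)\<close>.
  In its second summand the projection \<open>V \<otimes> (W \<otimes>\<^sub>A \<Omega>) \<rightarrow> V \<otimes>\<^sub>A (W \<otimes>\<^sub>A \<Omega>)\<close> is followed by
  rebracketing.
\<close>

definition connection_sum_hat ::
  "('k, 'l) ring_scheme \<Rightarrow> ('k, 'h, 'p) hopf_scheme \<Rightarrow> ('h, 'h) tens
    \<Rightarrow> ('k, 'h, 'o, 'n) hmod_scheme \<Rightarrow> ('k, 'h, 'o, 'm) dcalc_scheme
    \<Rightarrow> ('k, 'h, 'o, 'v, 'm1) hbimod_scheme \<Rightarrow> ('k, 'h, 'o, 'w, 'm2) hbimod_scheme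
    \<Rightarrow> ('v \<Rightarrow> ('v, 'o) tens) \<Rightarrow> ('w \<Rightarrow> ('w, 'o) tens)
    \<Rightarrow> ('v, 'w) tens \<Rightarrow> (('v, 'w) tens, 'o) tens" where
  "connection_sum_hat K H R A \<Omega> V W D\<^sub>V D\<^sub>W X =
    (let \<Omega>1 = one_form_bimod \<Omega>;
         V\<Omega> = tensor_A H A V \<Omega>1;
         W\<Omega> = tensor_A H A W \<Omega>1
     in inv_braiding_23 H R A V \<Omega>1 W
          (tensor_proj H A V\<Omega> W (map_tensor_R K H R V W V\<Omega> W D\<^sub>V id X))
        \<oplus>\<^bsub>tensor_A H A (tensor_A H A V W) \<Omega>1\<^esub>
        tensor_assoc_inv H A V W \<Omega>1
          (tensor_proj H A V W\<Omega> (map_tensor_R K H R V W V W\<Omega> id D\<^sub>W X)))"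

end

theory Submission
  imports Defs
begin

text \<open>
  Neither summand of the sum of connections is balanced over \<open>A\<close>, but the two defects agree up to
  sign.  Both are given by \<open>E\<^sub>a(w) = (R\<^sub>\<alpha> \<rhd> w) \<otimes>\<^sub>A d(R\<^sup>\<alpha> \<rhd> a)\<close>: for the first summand it arises from
  the Leibniz rule of \<open>\<nabla>\<^sub>V\<close> on \<open>v \<cdot> a\<close> followed by the inverse braiding; for the second one from the
  braided left Leibniz rule
  \<open>(\<xi> \<blacktriangleright> \<nabla>\<^sub>W)(a \<cdot> w) = (R'\<^sup>\<alpha> \<rhd> a) \<cdot> (R'\<^sub>\<alpha> \<xi> \<blacktriangleright> \<nabla>\<^sub>W)(w) + \<epsilon>(\<xi>) E\<^sub>a(w)\<close>, where \<open>R'\<close> is the inverse of \<open>R\<close>,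
  together with \<open>(\<Delta> \<otimes> id) R' = R'\<^sub>2\<^sub>3 R'\<^sub>1\<^sub>3\<close>.  For \<open>\<xi> = 1\<close> this rule follows from quasi-commutativity;
  the general case is reduced to it by \<open>\<xi> \<rhd> \<nabla>(w) = (\<xi>\<^sub>1 \<blacktriangleright> \<nabla>)(\<xi>\<^sub>2 \<rhd> w)\<close>, which determines all
  \<open>\<xi> \<blacktriangleright> \<nabla>\<close>.
\<close>

section \<open>Balanced tensor products of abelian groups\<close>

text \<open>Two obstacles shape the argument. A connection need not be H-equivariant, so the second
  summand contains \<xi> \<blacktriangleright> \<nabla> for every \<xi> occurring in a leg of R';
  such a map is in general no connection, its inhomogeneous term being multiplied by
  \<epsilon>(\<xi>). The factor disappears at the end because (id \<otimes> \<epsilon>)(R') = 1.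
  Moreover R need not be triangular, so the two ways of exchanging an algebra element and a one-form
  are different statements. Commuting a form past an element on its right (degrees 1 and 0) makes W
  \<otimes>_A \<Omega> quasi-commutative and gives the left Leibniz rule; commuting an element past
  a form on its right (degrees 0 and 1) lets the inverse braiding descend to \<Omega> \<otimes>_A W.
  Elements of a tensor product are cosets of formal sums. Therefore every Sweedler expression is a
  lift of a multilinear function, an axiom of H is used as an equality of two lifts valid for all
  multilinear functions, and identities are checked on pure tensors.\<close>

definition tens_ring ::
  "'b set \<Rightarrow> ('v \<Rightarrow> 'b \<Rightarrow> 'v) \<Rightarrow> ('b \<Rightarrow> 'w \<Rightarrow> 'w) \<Rightarrow> ('v, 'm) ring_scheme \<Rightarrow> ('w, 'n) ring_scheme
    \<Rightarrow> ('v, 'w) tens ring" where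
  "tens_ring B ra la V W =
    (let G = tens_group B ra la V W
     in \<lparr>carrier = carrier G, monoid.mult = undefined, monoid.one = undefined,
         ring.zero = \<one>\<^bsub>G\<^esub>, add = monoid.mult G\<rparr>)"

definition additive_map :: "('v, 'm) ring_scheme \<Rightarrow> ('w, 'n) ring_scheme \<Rightarrow> ('v \<Rightarrow> 'w) \<Rightarrow> bool" where
  "additive_map V W h \<longleftrightarrow> h \<in> carrier V \<rightarrow> carrier W \<and>
     (\<forall>x\<in>carrier V. \<forall>y\<in>carrier V. h (x \<oplus>\<^bsub>V\<^esub> y) = h x \<oplus>\<^bsub>W\<^esub> h y)"

lemma additive_mapD:
  assumes "additive_map V W h"
  shows "x \<in> carrier V \<Longrightarrow> h x \<in> carrier W"
    "x \<in> carrier V \<Longrightarrow> y \<in> carrier V \<Longrightarrow> h (x \<oplus>\<^bsub>V\<^esub> y) = h x \<oplus>\<^bsub>W\<^esub> h y"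
  using assms by (auto simp: additive_map_def)

lemma additive_map_zero:
  assumes "abelian_group V" "abelian_group W" "additive_map V W h"
  shows "h \<zero>\<^bsub>V\<^esub> = \<zero>\<^bsub>W\<^esub>"
proof -
  interpret V: abelian_group V by fact
  interpret W: abelian_group W by fact
  have "h \<zero>\<^bsub>V\<^esub> \<oplus>\<^bsub>W\<^esub> h \<zero>\<^bsub>V\<^esub> = h \<zero>\<^bsub>V\<^esub>"
    using additive_mapD(2) [OF assms(3), of "\<zero>\<^bsub>V\<^esub>" "\<zero>\<^bsub>V\<^esub>"] by simp
  then show ?thesis using additive_mapD(1) [OF assms(3), of "\<zero>\<^bsub>V\<^esub>"]
    by (metis V.zero_closed W.add.l_cancel_one')
qed

definition balanced_map ::
  "'b set \<Rightarrow> ('v \<Rightarrow> 'b \<Rightarrow> 'v) \<Rightarrow> ('b \<Rightarrow> 'w \<Rightarrow> 'w) \<Rightarrow> ('v, 'm) ring_scheme \<Rightarrow> ('w, 'n) ring_scheme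
    \<Rightarrow> ('t, 'q) ring_scheme \<Rightarrow> ('v \<Rightarrow> 'w \<Rightarrow> 't) \<Rightarrow> bool" where
  "balanced_map B ra la V W T f \<longleftrightarrow>
     (\<forall>v\<in>carrier V. additive_map W T (f v)) \<and> (\<forall>w\<in>carrier W. additive_map V T (\<lambda>v. f v w)) \<and>
     (\<forall>v\<in>carrier V. \<forall>b\<in>B. \<forall>w\<in>carrier W. f (ra v b) w = f v (la b w))"

lemma balanced_mapD:
  assumes "balanced_map B ra la V W T f"
  shows "v \<in> carrier V \<Longrightarrow> w \<in> carrier W \<Longrightarrow> f v w \<in> carrier T"
    "v \<in> carrier V \<Longrightarrow> v' \<in> carrier V \<Longrightarrow> w \<in> carrier W \<Longrightarrow> f (v \<oplus>\<^bsub>V\<^esub> v') w = f v w \<oplus>\<^bsub>T\<^esub> f v' w"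
    "v \<in> carrier V \<Longrightarrow> w \<in> carrier W \<Longrightarrow> w' \<in> carrier W \<Longrightarrow> f v (w \<oplus>\<^bsub>W\<^esub> w') = f v w \<oplus>\<^bsub>T\<^esub> f v w'"
    "v \<in> carrier V \<Longrightarrow> b \<in> B \<Longrightarrow> w \<in> carrier W \<Longrightarrow> f (ra v b) w = f v (la b w)"
  using assms by (auto simp: balanced_map_def additive_map_def)

lemma balanced_mapI:
  assumes "\<And>v w. v \<in> carrier V \<Longrightarrow> w \<in> carrier W \<Longrightarrow> f v w \<in> carrier T"
    "\<And>v v' w. v \<in> carrier V \<Longrightarrow> v' \<in> carrier V \<Longrightarrow> w \<in> carrier W \<Longrightarrow> f (v \<oplus>\<^bsub>V\<^esub> v') w = f v w \<oplus>\<^bsub>T\<^esub> f v' w"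
    "\<And>v w w'. v \<in> carrier V \<Longrightarrow> w \<in> carrier W \<Longrightarrow> w' \<in> carrier W \<Longrightarrow> f v (w \<oplus>\<^bsub>W\<^esub> w') = f v w \<oplus>\<^bsub>T\<^esub> f v w'"
    "\<And>v b w. v \<in> carrier V \<Longrightarrow> b \<in> B \<Longrightarrow> w \<in> carrier W \<Longrightarrow> f (ra v b) w = f v (la b w)"
  shows "balanced_map B ra la V W T f"
  using assms by (auto simp: balanced_map_def additive_map_def)

text \<open>Finite sums and integer multiples see only the additive part of a record. This
  identifies lifts into the auxiliary record inlined in the definitions of \<open>tensor_K\<close>
  and \<open>tensor_A\<close> with lifts into the finished modules.\<close>

lemma frag_eval_ring_cong:
  assumes "carrier T = carrier T'" "ring.add T = ring.add T'" "ring.zero T = ring.zero T'"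
  shows "frag_eval T f = frag_eval T' f"
  using assms unfolding frag_eval_def finsum_def finprod_def add_pow_def int_pow_def nat_pow_def m_inv_def
  by (simp add: Let_def cong: if_cong)

lemma tens_lift_ring_cong:
  assumes "carrier T = carrier T'" "ring.add T = ring.add T'" "ring.zero T = ring.zero T'"
  shows "tens_lift T f = tens_lift T' f"
  unfolding tens_lift_def frag_eval_ring_cong [OF assms] ..

text \<open>\<open>B\<close> is a bare set with two maps into the carriers, so that the same
  quotient serves the ground ring and the algebra \<open>A\<close>.\<close>

locale tens =
  V: abelian_group V + W: abelian_group W
  for B :: "'b set" and ra :: "'v \<Rightarrow> 'b \<Rightarrow> 'v" and la :: "'b \<Rightarrow> 'w \<Rightarrow> 'w"
    and V :: "('v, 'm) ring_scheme" and W :: "('w, 'n) ring_scheme" +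
  assumes ra_closed: "v \<in> carrier V \<Longrightarrow> b \<in> B \<Longrightarrow> ra v b \<in> carrier V"
    and la_closed: "b \<in> B \<Longrightarrow> w \<in> carrier W \<Longrightarrow> la b w \<in> carrier W"
begin

abbreviation "FG \<equiv> free_Abelian_group (carrier V \<times> carrier W)"
abbreviation "N \<equiv> tens_null B ra la V W"
abbreviation "TG \<equiv> tens_group B ra la V W"
abbreviation "TR \<equiv> tens_ring B ra la V W"
abbreviation "pr \<equiv> tens_pure B ra la V W"

lemma keys_minus_sub: "Poly_Mapping.keys c \<subseteq> S \<Longrightarrow> Poly_Mapping.keys d \<subseteq> S \<Longrightarrow> Poly_Mapping.keys (c - d) \<subseteq> S"
  using keys_diff [of c d] by blast

lemma rel_subset: "tens_rel B ra la V W \<subseteq> carrier FG"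
  unfolding tens_rel_def
  by (auto intro!: keys_minus_sub simp: ra_closed la_closed simp del: carrier_free_Abelian_group_iff)
     (auto simp: ra_closed la_closed intro!: keys_minus_sub dest!: subsetD [OF keys_diff])

lemma null_subgroup: "subgroup N FG"
  unfolding tens_null_def by (rule group.generate_is_subgroup [OF _ rel_subset]) simp

lemma null_normal: "N \<lhd> FG"
  by (rule comm_group.normal_iff_subgroup [OF abelian_free_Abelian_group, THEN iffD2, OF null_subgroup])

lemma null_subset: "N \<subseteq> carrier FG"
  by (rule subgroup.subset [OF null_subgroup])

lemma comm_group_TG: "comm_group TG"
  unfolding tens_group_def
  by (rule comm_group.abelian_FactGroup [OF abelian_free_Abelian_group null_subgroup])

lemma TR_sel:
  "carrier TR = carrier TG" "ring.add TR = monoid.mult TG" "ring.zero TR = \<one>\<^bsub>TG\<^esub>"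
  by (simp_all add: tens_ring_def Let_def)

lemma abelian_group_TR: "abelian_group TR"
proof -
  interpret G: comm_group TG by (rule comm_group_TG)
  show ?thesis
    by (rule abelian_groupI; unfold TR_sel)
       (metis G.m_closed G.one_closed G.m_assoc G.m_comm G.l_one G.l_inv G.inv_closed)+
qed

lemma carrier_TR: "carrier TR = (\<lambda>c. N #>\<^bsub>FG\<^esub> c) ` carrier FG"
  by (simp add: TR_sel tens_group_def carrier_FactGroup)

lemma coset_add:
  assumes "c \<in> carrier FG" "d \<in> carrier FG"
  shows "(N #>\<^bsub>FG\<^esub> c) \<oplus>\<^bsub>TR\<^esub> (N #>\<^bsub>FG\<^esub> d) = N #>\<^bsub>FG\<^esub> (c + d)"
  using normal.rcos_sum [OF null_normal assms] by (simp add: TR_sel tens_group_def)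

lemma pure_closed: "v \<in> carrier V \<Longrightarrow> w \<in> carrier W \<Longrightarrow> pr v w \<in> carrier TR"
  by (auto simp: carrier_TR tens_pure_def)

lemma coset_cong:
  assumes "c \<in> carrier FG" "d \<in> carrier FG" "c - d \<in> N"
  shows "N #>\<^bsub>FG\<^esub> c = N #>\<^bsub>FG\<^esub> d"
proof -
  have "c \<in> N #>\<^bsub>FG\<^esub> d"
    using assms by (auto simp: r_coset_def intro!: bexI [OF _ assms(3)])
  then show ?thesis
    by (metis assms(2) group.repr_independence group_free_Abelian_group null_subgroup)
qed

lemma rel_in_null: "c \<in> tens_rel B ra la V W \<Longrightarrow> c \<in> N"
  unfolding tens_null_def by (rule generate.incl)

lemma pure_add_left:
  assumes "v \<in> carrier V" "v' \<in> carrier V" "w \<in> carrier W"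
  shows "pr (v \<oplus>\<^bsub>V\<^esub> v') w = pr v w \<oplus>\<^bsub>TR\<^esub> pr v' w"
proof -
  have "frag_of (v \<oplus>\<^bsub>V\<^esub> v', w) - frag_of (v, w) - frag_of (v', w) \<in> N"
    using assms by (intro rel_in_null) (auto simp: tens_rel_def)
  then have "N #>\<^bsub>FG\<^esub> frag_of (v \<oplus>\<^bsub>V\<^esub> v', w) = N #>\<^bsub>FG\<^esub> (frag_of (v, w) + frag_of (v', w))"
    using assms by (intro coset_cong) (auto simp: diff_diff_add dest!: subsetD [OF keys_add])
  then show ?thesis using assms by (simp add: tens_pure_def coset_add)
qed

lemma pure_add_right:
  assumes "v \<in> carrier V" "w \<in> carrier W" "w' \<in> carrier W"
  shows "pr v (w \<oplus>\<^bsub>W\<^esub> w') = pr v w \<oplus>\<^bsub>TR\<^esub> pr v w'"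
proof -
  have "frag_of (v, w \<oplus>\<^bsub>W\<^esub> w') - frag_of (v, w) - frag_of (v, w') \<in> N"
    using assms by (intro rel_in_null) (auto simp: tens_rel_def)
  then have "N #>\<^bsub>FG\<^esub> frag_of (v, w \<oplus>\<^bsub>W\<^esub> w') = N #>\<^bsub>FG\<^esub> (frag_of (v, w) + frag_of (v, w'))"
    using assms by (intro coset_cong) (auto simp: diff_diff_add dest!: subsetD [OF keys_add])
  then show ?thesis using assms by (simp add: tens_pure_def coset_add)
qed

lemma pure_balanced:
  assumes "v \<in> carrier V" "b \<in> B" "w \<in> carrier W"
  shows "pr (ra v b) w = pr v (la b w)"
proof -
  have "frag_of (ra v b, w) - frag_of (v, la b w) \<in> N"
    using assms by (intro rel_in_null) (auto simp: tens_rel_def)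
  then show ?thesis
    using assms unfolding tens_pure_def by (intro coset_cong) (auto simp: ra_closed la_closed)
qed

text \<open>Since -(v \<otimes> w) = (-v) \<otimes> w and 0 = 0 \<otimes> 0, every element is a
  finite sum of pure tensors, and the induction has no case for negatives.\<close>

lemma tens_induct [consumes 1, case_names pure add]:
  assumes X: "X \<in> carrier TR"
    and P: "\<And>v w. v \<in> carrier V \<Longrightarrow> w \<in> carrier W \<Longrightarrow> P (pr v w)"
    and add: "\<And>X Y. X \<in> carrier TR \<Longrightarrow> Y \<in> carrier TR \<Longrightarrow> P X \<Longrightarrow> P Y \<Longrightarrow> P (X \<oplus>\<^bsub>TR\<^esub> Y)"
  shows "P X"
proof -
  interpret T: abelian_group TR by (rule abelian_group_TR)
  have zer: "pr \<zero>\<^bsub>V\<^esub> w = \<zero>\<^bsub>TR\<^esub>" if "w \<in> carrier W" for w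
    by (rule additive_map_zero [OF V.abelian_group_axioms abelian_group_TR])
       (simp add: additive_map_def pure_closed pure_add_left that)
  obtain c where c: "c \<in> carrier FG" "X = N #>\<^bsub>FG\<^esub> c" using X by (auto simp: carrier_TR)
  have coset0: "N #>\<^bsub>FG\<^esub> 0 = \<zero>\<^bsub>TR\<^esub>"
    by (metis TR_sel(3) group.coset_join2 group_free_Abelian_group monoid.one_closed group_def
        null_subgroup one_FactGroup one_free_Abelian_group subgroup.one_closed tens_group_def)
  \<comment> \<open>Formal sums are built by differences, so the claim is carried for
    \<open>c\<close> and \<open>- c\<close> together; a difference then becomes a sum, to which
    \<open>add\<close> applies.\<close>
  define Q where "Q c \<longleftrightarrow> c \<in> carrier FG \<and> P (N #>\<^bsub>FG\<^esub> c) \<and> P (N #>\<^bsub>FG\<^esub> (- c))" for c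
  have P_add: "P (N #>\<^bsub>FG\<^esub> (c + d))"
    if "c \<in> carrier FG" "d \<in> carrier FG" "P (N #>\<^bsub>FG\<^esub> c)" "P (N #>\<^bsub>FG\<^esub> d)" for c d
    using that coset_add [OF that(1,2)] add [of "N #>\<^bsub>FG\<^esub> c" "N #>\<^bsub>FG\<^esub> d"]
    unfolding carrier_TR by auto
  have "Q c"
    if "Poly_Mapping.keys c \<subseteq> carrier V \<times> carrier W" for c
    using that
  proof (induction c rule: frag_induction)
    case zero
    have "N #>\<^bsub>FG\<^esub> 0 = pr \<zero>\<^bsub>V\<^esub> \<zero>\<^bsub>W\<^esub>"
      by (simp only: coset0 zer [OF W.zero_closed])
    then show ?case using P by (simp add: Q_def)
  next
    case (one x)
    obtain v w where x: "x = (v, w)" "v \<in> carrier V" "w \<in> carrier W" using one by auto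
    have eq: "N #>\<^bsub>FG\<^esub> frag_of x = pr v w" by (simp add: x tens_pure_def)
    have nV: "\<ominus>\<^bsub>V\<^esub> v \<in> carrier V" using x by simp
    \<comment> \<open>Two additive inverses of \<open>pr v w\<close> are exhibited, one as a coset
      and one as a pure tensor; they must coincide.\<close>
    have s1: "pr (\<ominus>\<^bsub>V\<^esub> v) w \<oplus>\<^bsub>TR\<^esub> pr v w = \<zero>\<^bsub>TR\<^esub>"
      using pure_add_left [of "\<ominus>\<^bsub>V\<^esub> v" v w] x nV zer by (simp add: V.l_neg)
    have s2: "(N #>\<^bsub>FG\<^esub> - frag_of x) \<oplus>\<^bsub>TR\<^esub> pr v w = \<zero>\<^bsub>TR\<^esub>"
      using coset_add [of "- frag_of x" "frag_of x"] x eq coset0 by simp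
    have "N #>\<^bsub>FG\<^esub> - frag_of x \<in> carrier TR" using x by (auto simp: carrier_TR)
    then have "N #>\<^bsub>FG\<^esub> - frag_of x = pr (\<ominus>\<^bsub>V\<^esub> v) w"
      using s1 s2 pure_closed [OF x(2,3)] pure_closed [OF nV x(3)] by (metis T.add.right_cancel)
    then show ?case using eq P x nV by (simp add: Q_def)
  next
    case (diff a b)
    then have ab: "a \<in> carrier FG" "b \<in> carrier FG" "- a \<in> carrier FG" "- b \<in> carrier FG"
      by (auto simp: Q_def)
    have "a - b \<in> carrier FG"
      using ab keys_minus_sub [of a "carrier V \<times> carrier W" b] by simp
    moreover have "P (N #>\<^bsub>FG\<^esub> (a + - b))" "P (N #>\<^bsub>FG\<^esub> (b + - a))"
      using P_add diff ab unfolding Q_def by blast+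
    ultimately show ?case by (simp add: Q_def)
  qed
  then have "Q c" using c(1) by simp
  then show ?thesis using c by (simp add: Q_def)
qed


section \<open>The universal property of the quotient\<close>

context
  fixes T :: "('t, 'q) ring_scheme" and f
  assumes T: "abelian_group T" and f: "balanced_map B ra la V W T f"
begin

lemma frag_eval_hom: "group_hom FG (add_monoid T) (frag_eval T f)"
proof -
  interpret T: abelian_group T by (rule T)
  have fS: "\<And>x y. (x, y) \<in> carrier V \<times> carrier W \<Longrightarrow> f x y \<in> carrier T"
    using balanced_mapD(1) [OF f] by auto
  show ?thesis
  proof (intro group_hom.intro group_hom_axioms.intro homI)
    show "group FG" by simp
    show "group (add_monoid T)" by (rule T.add.is_group)
    fix c d assume "c \<in> carrier FG" "d \<in> carrier FG"
    then show "frag_eval T f (c \<otimes>\<^bsub>FG\<^esub> d) = frag_eval T f c \<otimes>\<^bsub>add_monoid T\<^esub> frag_eval T f d"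
      using frag_eval_add [OF T, of "carrier V \<times> carrier W" f c d] fS by simp
  next
    fix c assume "c \<in> carrier FG"
    then have "[k] \<cdot>\<^bsub>T\<^esub> f (fst p) (snd p) \<in> carrier T" if "p \<in> Poly_Mapping.keys c" for p and k :: int
      using fS [of "fst p" "snd p"] that by auto
    then show "frag_eval T f c \<in> carrier (add_monoid T)"
      unfolding frag_eval_def partial_object.simps by (intro T.finsum_closed) auto
  qed
qed

lemma frag_eval_null:
  assumes "n \<in> N"
  shows "frag_eval T f n = \<zero>\<^bsub>T\<^esub>"
proof -
  interpret T: abelian_group T by (rule T)
  interpret h: group_hom FG "add_monoid T" "frag_eval T f" by (rule frag_eval_hom)
  have ev: "frag_eval T f (frag_of (x, y)) = f x y" if "x \<in> carrier V" "y \<in> carrier W" for x y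
    by (rule frag_eval_of [where T = T and f = f, OF T balanced_mapD(1) [OF f that]])
  have ker: "c - d \<in> kernel FG (add_monoid T) (frag_eval T f)"
    if "c \<in> carrier FG" "d \<in> carrier FG" "frag_eval T f c = frag_eval T f d" for c d
  proof -
    have cd: "c - d \<in> carrier FG" using that keys_minus_sub [of c "carrier V \<times> carrier W" d] by simp
    have "frag_eval T f (c - d) \<oplus>\<^bsub>T\<^esub> frag_eval T f d = frag_eval T f d"
      using h.hom_mult [OF cd that(2)] that(3) by simp
    then have "frag_eval T f (c - d) = \<zero>\<^bsub>T\<^esub>"
      using h.hom_closed [OF cd] h.hom_closed [OF that(2)] by (simp add: T.add.r_cancel_one)
    then show ?thesis using cd by (simp add: kernel_def)
  qed
  have add: "frag_eval T f (c + d) = frag_eval T f c \<oplus>\<^bsub>T\<^esub> frag_eval T f d"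
    if "c \<in> carrier FG" "d \<in> carrier FG" for c d
    using h.hom_mult [OF that] by simp
  \<comment> \<open>With \<open>diff_diff_add\<close> every relation takes the form
    \<open>c - d\<close>, where \<open>c\<close> and \<open>d\<close> have the same value, so
    \<open>ker\<close> covers all three families.\<close>
  have "tens_rel B ra la V W \<subseteq> kernel FG (add_monoid T) (frag_eval T f)"
    unfolding tens_rel_def diff_diff_add
    by (auto intro!: ker simp: add ev balanced_mapD [OF f] ra_closed la_closed
        dest!: subsetD [OF keys_add])
  then have "N \<subseteq> kernel FG (add_monoid T) (frag_eval T f)"
    unfolding tens_null_def
    by (rule group.generate_subgroup_incl [OF _ _ h.subgroup_kernel, rotated]) simp
  then show ?thesis using assms by (auto simp: kernel_def)
qed

text \<open>The relations evaluate to zero, so all representatives of a coset have the same value;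
  the image in the definition of \<open>tens_lift\<close> is a singleton and \<open>the_elem\<close>
  picks its member.\<close>

lemma tens_lift_coset:
  assumes c: "c \<in> carrier FG"
  shows "tens_lift T f (N #>\<^bsub>FG\<^esub> c) = frag_eval T f c"
proof -
  interpret T: abelian_group T by (rule T)
  interpret h: group_hom FG "add_monoid T" "frag_eval T f" by (rule frag_eval_hom)
  have "frag_eval T f (n \<otimes>\<^bsub>FG\<^esub> c) = frag_eval T f c" if "n \<in> N" for n
    using h.hom_mult [OF _ c, of n] frag_eval_null [OF that] subsetD [OF null_subset that]
      h.hom_closed [OF c] by simp
  then have "frag_eval T f ` (N #>\<^bsub>FG\<^esub> c) = (\<lambda>n. frag_eval T f c) ` N"
    unfolding r_coset_def by (auto simp: image_iff)
  moreover have "N \<noteq> {}" using subgroup.one_closed [OF null_subgroup] by blast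
  ultimately have "frag_eval T f ` (N #>\<^bsub>FG\<^esub> c) = {frag_eval T f c}" by auto
  then show ?thesis by (simp add: tens_lift_def)
qed

lemma tens_lift_additive: "additive_map TR T (tens_lift T f)"
proof -
  interpret h: group_hom FG "add_monoid T" "frag_eval T f" by (rule frag_eval_hom)
  have "tens_lift T f ((N #>\<^bsub>FG\<^esub> c) \<oplus>\<^bsub>TR\<^esub> (N #>\<^bsub>FG\<^esub> d)) =
      tens_lift T f (N #>\<^bsub>FG\<^esub> c) \<oplus>\<^bsub>T\<^esub> tens_lift T f (N #>\<^bsub>FG\<^esub> d)"
    if "c \<in> carrier FG" "d \<in> carrier FG" for c d
  proof -
    have "c + d \<in> carrier FG" using h.G.m_closed [OF that] by simp
    then show ?thesis
      unfolding coset_add [OF that] using h.hom_mult [OF that] that by (simp add: tens_lift_coset)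
  qed
  then show ?thesis
    using h.hom_closed by (auto simp: additive_map_def carrier_TR tens_lift_coset)
qed

lemma tens_lift_eq:
  "v \<in> carrier V \<Longrightarrow> w \<in> carrier W \<Longrightarrow> tens_lift T f (pr v w) = f v w"
  unfolding tens_pure_def
  by (simp add: tens_lift_coset frag_eval_of [OF T] balanced_mapD(1) [OF f])

end

text \<open>Formal sums are evaluated term by term, so pointwise agreement already makes the two
  images of \<open>X\<close> equal. Terms under a Sweedler sum are rewritten in this way.\<close>

lemma tens_lift_cong:
  assumes "abelian_group T" "X \<in> carrier TR"
    "\<And>v w. v \<in> carrier V \<Longrightarrow> w \<in> carrier W \<Longrightarrow> f v w = g v w"
    "\<And>v w. v \<in> carrier V \<Longrightarrow> w \<in> carrier W \<Longrightarrow> g v w \<in> carrier T"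
  shows "tens_lift T f X = tens_lift T g X"
proof -
  interpret T: abelian_group T by fact
  obtain c where c: "c \<in> carrier FG" "X = N #>\<^bsub>FG\<^esub> c" using assms(2) by (auto simp: carrier_TR)
  have "X \<subseteq> carrier FG"
    unfolding c(2) by (rule monoid.r_coset_subset_G [OF _ null_subset c(1)])
      (rule group.is_monoid, simp)
  moreover have "frag_eval T f d = frag_eval T g d" if d: "d \<in> carrier FG" for d
  proof -
    have "f (fst p) (snd p) = g (fst p) (snd p)" "g (fst p) (snd p) \<in> carrier T"
      if "p \<in> Poly_Mapping.keys d" for p
      using that d assms(3,4) [of "fst p" "snd p"] by auto
    then show ?thesis
      unfolding frag_eval_def by (intro T.finsum_cong') auto
  qed
  ultimately have "frag_eval T f ` X = frag_eval T g ` X" by (intro image_cong) auto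
  then show ?thesis by (simp add: tens_lift_def)
qed

end

section \<open>Linear and bilinear maps\<close>

definition k_bilinear ::
  "('k, 'l) ring_scheme \<Rightarrow> ('k, 'v, 'm) module_scheme \<Rightarrow> ('k, 'w, 'n) module_scheme
    \<Rightarrow> ('k, 't, 'q) module_scheme \<Rightarrow> ('v \<Rightarrow> 'w \<Rightarrow> 't) \<Rightarrow> bool" where
  "k_bilinear K V W T f \<longleftrightarrow>
     (\<forall>v\<in>carrier V. k_linear K W T (f v)) \<and> (\<forall>w\<in>carrier W. k_linear K V T (\<lambda>v. f v w))"

lemma k_linearI:
  assumes "\<And>x. x \<in> carrier V \<Longrightarrow> f x \<in> carrier W"
    "\<And>x y. x \<in> carrier V \<Longrightarrow> y \<in> carrier V \<Longrightarrow> f (x \<oplus>\<^bsub>V\<^esub> y) = f x \<oplus>\<^bsub>W\<^esub> f y"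
    "\<And>k x. k \<in> carrier K \<Longrightarrow> x \<in> carrier V \<Longrightarrow> f (k \<odot>\<^bsub>V\<^esub> x) = k \<odot>\<^bsub>W\<^esub> f x"
  shows "k_linear K V W f"
  using assms by (simp add: k_linear_def)

lemma k_linearD:
  assumes "k_linear K V W f"
  shows "x \<in> carrier V \<Longrightarrow> f x \<in> carrier W"
    "x \<in> carrier V \<Longrightarrow> y \<in> carrier V \<Longrightarrow> f (x \<oplus>\<^bsub>V\<^esub> y) = f x \<oplus>\<^bsub>W\<^esub> f y"
    "k \<in> carrier K \<Longrightarrow> x \<in> carrier V \<Longrightarrow> f (k \<odot>\<^bsub>V\<^esub> x) = k \<odot>\<^bsub>W\<^esub> f x"
  using assms by (auto simp: k_linear_def)

lemma k_linear_additive: "k_linear K V W f \<Longrightarrow> additive_map V W f"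
  by (simp add: k_linear_def additive_map_def)

lemma k_linear_ident: "k_linear K V V (\<lambda>x. x)"
  by (simp add: k_linear_def)

lemma k_linear_comp:
  "k_linear K V W g \<Longrightarrow> k_linear K U V f \<Longrightarrow> k_linear K U W (\<lambda>x. g (f x))"
  by (auto simp: k_linear_def Pi_iff)

lemma k_linear_cong:
  assumes "module K V" "\<And>x. x \<in> carrier V \<Longrightarrow> f x = g x"
  shows "k_linear K V W f \<longleftrightarrow> k_linear K V W g"
proof -
  interpret V: module K V by fact
  show ?thesis using assms(2) by (simp add: k_linear_def Pi_iff)
qed

lemma k_linear_add:
  assumes "module K W" "k_linear K V W f" "k_linear K V W g"
  shows "k_linear K V W (\<lambda>x. f x \<oplus>\<^bsub>W\<^esub> g x)"
proof -
  interpret W: module K W by fact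
  show ?thesis
    by (rule k_linearI)
       (auto simp: k_linearD [OF assms(2)] k_linearD [OF assms(3)] W.smult_r_distr W.a_ac)
qed

lemma k_linear_smult:
  assumes "module K W" "k_linear K V W f" "k \<in> carrier K"
  shows "k_linear K V W (\<lambda>x. k \<odot>\<^bsub>W\<^esub> f x)"
proof -
  interpret W: module K W by fact
  show ?thesis
    by (rule k_linearI)
       (auto simp: k_linearD [OF assms(2)] assms(3) W.smult_r_distr W.R.m_comm simp flip: W.smult_assoc1)
qed

lemma k_bilinearI:
  assumes "\<And>v. v \<in> carrier V \<Longrightarrow> k_linear K W T (f v)"
    and "\<And>w. w \<in> carrier W \<Longrightarrow> k_linear K V T (\<lambda>v. f v w)"
  shows "k_bilinear K V W T f"
  using assms by (simp add: k_bilinear_def)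

lemma k_bilinearD:
  assumes "k_bilinear K V W T f"
  shows "v \<in> carrier V \<Longrightarrow> k_linear K W T (f v)"
    and "w \<in> carrier W \<Longrightarrow> k_linear K V T (\<lambda>v. f v w)"
  using assms by (auto simp: k_bilinear_def)

lemma k_bilinear_closed:
  "k_bilinear K V W T f \<Longrightarrow> v \<in> carrier V \<Longrightarrow> w \<in> carrier W \<Longrightarrow> f v w \<in> carrier T"
  by (blast dest: k_bilinearD(1) k_linearD(1))

lemma k_bilinear_left:
  assumes "k_bilinear K V W T f" "k_linear K U V g" "w \<in> carrier W"
  shows "k_linear K U T (\<lambda>x. f (g x) w)"
  by (rule k_linear_comp [OF k_bilinearD(2) [OF assms(1,3)] assms(2)])

lemma k_bilinear_right:
  assumes "k_bilinear K V W T f" "k_linear K U W g" "v \<in> carrier V"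
  shows "k_linear K U T (\<lambda>x. f v (g x))"
  by (rule k_linear_comp [OF k_bilinearD(1) [OF assms(1,3)] assms(2)])

lemma k_bilinear_balanced:
  assumes "k_bilinear K V W T f"
    and "\<And>v b w. v \<in> carrier V \<Longrightarrow> b \<in> B \<Longrightarrow> w \<in> carrier W \<Longrightarrow> f (ra v b) w = f v (la b w)"
  shows "balanced_map B ra la V W T f"
  using assms by (auto simp: balanced_map_def k_bilinear_def intro: k_linear_additive)

text \<open>Of \<open>T\<close> only the additive part and the scalar multiplication are prescribed,
  so that \<open>tensor_K\<close> and \<open>tensor_A\<close> are both instances. By
  \<open>smult_ra\<close> scalars can act through the left factor; \<open>pure_smult_right\<close>
  says that the right factor gives the same, which is the balancing itself over the ground ring and
  is deduced from the unit of the algebra over \<open>A\<close>.\<close>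

locale tens_module =
  tens B ra la V W + V: module K V + W: module K W
  for K :: "('k, 'l) ring_scheme" and B :: "'b set"
    and ra :: "'v \<Rightarrow> 'b \<Rightarrow> 'v" and la :: "'b \<Rightarrow> 'w \<Rightarrow> 'w"
    and V :: "('k, 'v, 'm) module_scheme" and W :: "('k, 'w, 'n) module_scheme"
    and T :: "('k, ('v, 'w) tens, 't) module_scheme" +
  assumes T_sel: "carrier T = carrier TR" "ring.add T = ring.add TR" "ring.zero T = ring.zero TR"
    and T_smult: "smult T k = tens_lift TR (\<lambda>v w. pr (k \<odot>\<^bsub>V\<^esub> v) w)"
    and smult_ra: "k \<in> carrier K \<Longrightarrow> v \<in> carrier V \<Longrightarrow> b \<in> B \<Longrightarrow> k \<odot>\<^bsub>V\<^esub> ra v b = ra (k \<odot>\<^bsub>V\<^esub> v) b"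
    and pure_smult_right:
      "k \<in> carrier K \<Longrightarrow> v \<in> carrier V \<Longrightarrow> w \<in> carrier W \<Longrightarrow> pr v (k \<odot>\<^bsub>W\<^esub> w) = pr (k \<odot>\<^bsub>V\<^esub> v) w"
begin

lemma abelian_group_T: "abelian_group T"
proof -
  interpret TR: abelian_group TR by (rule abelian_group_TR)
  show ?thesis
    by (rule abelian_groupI; unfold T_sel)
       (metis TR.a_closed TR.zero_closed TR.a_assoc TR.a_comm TR.l_zero TR.l_neg TR.a_inv_closed)+
qed

lemma T_induct [consumes 1, case_names pure add]:
  assumes "X \<in> carrier T"
    and "\<And>v w. v \<in> carrier V \<Longrightarrow> w \<in> carrier W \<Longrightarrow> P (pr v w)"
    and "\<And>X Y. X \<in> carrier T \<Longrightarrow> Y \<in> carrier T \<Longrightarrow> P X \<Longrightarrow> P Y \<Longrightarrow> P (X \<oplus>\<^bsub>T\<^esub> Y)"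
  shows "P X"
  using tens_induct [of X P] assms by (simp add: T_sel)

lemma balanced_smult:
  assumes "k \<in> carrier K"
  shows "balanced_map B ra la V W TR (\<lambda>v w. pr (k \<odot>\<^bsub>V\<^esub> v) w)"
  by (rule balanced_mapI)
     (use assms in \<open>auto simp: pure_closed pure_add_left pure_add_right V.smult_r_distr smult_ra pure_balanced\<close>)

lemma smult_pure:
  assumes "k \<in> carrier K" "v \<in> carrier V" "w \<in> carrier W"
  shows "k \<odot>\<^bsub>T\<^esub> pr v w = pr (k \<odot>\<^bsub>V\<^esub> v) w"
  using tens_lift_eq [OF abelian_group_TR balanced_smult [OF assms(1)] assms(2,3)]
  by (simp add: T_smult)

lemma smult_additive: "k \<in> carrier K \<Longrightarrow> additive_map T T (smult T k)"
  using tens_lift_additive [OF abelian_group_TR balanced_smult]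
  by (simp add: additive_map_def T_sel T_smult)

lemma module_T: "module K T"
proof (rule moduleI)
  interpret T: abelian_group T by (rule abelian_group_T)
  note sm = additive_mapD [OF smult_additive]
  show "cring K" by (rule V.R.is_cring)
  show "abelian_group T" by (rule abelian_group_T)
  show cl: "k \<odot>\<^bsub>T\<^esub> X \<in> carrier T" if "k \<in> carrier K" "X \<in> carrier T" for k X
    by (rule sm(1) [OF that])
  show "k \<odot>\<^bsub>T\<^esub> (X \<oplus>\<^bsub>T\<^esub> Y) = k \<odot>\<^bsub>T\<^esub> X \<oplus>\<^bsub>T\<^esub> k \<odot>\<^bsub>T\<^esub> Y"
    if "k \<in> carrier K" "X \<in> carrier T" "Y \<in> carrier T" for k X Y
    by (rule sm(2) [OF that])
  show "(k \<oplus>\<^bsub>K\<^esub> l) \<odot>\<^bsub>T\<^esub> X = k \<odot>\<^bsub>T\<^esub> X \<oplus>\<^bsub>T\<^esub> l \<odot>\<^bsub>T\<^esub> X"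
    if kl: "k \<in> carrier K" "l \<in> carrier K" and X: "X \<in> carrier T" for k l X
    using X
  proof (induction rule: T_induct)
    case (pure v w)
    then show ?case using kl by (simp add: smult_pure V.smult_l_distr pure_add_left T_sel)
  next
    case (add X Y)
    then show ?case using kl by (simp add: sm cl T.a_ac)
  qed
  show "(k \<otimes>\<^bsub>K\<^esub> l) \<odot>\<^bsub>T\<^esub> X = k \<odot>\<^bsub>T\<^esub> (l \<odot>\<^bsub>T\<^esub> X)"
    if kl: "k \<in> carrier K" "l \<in> carrier K" and X: "X \<in> carrier T" for k l X
    using X
  proof (induction rule: T_induct)
    case (pure v w)
    then show ?case using kl by (simp add: smult_pure V.smult_assoc1)
  next
    case (add X Y)
    then show ?case using kl by (simp add: sm cl)
  qed
  show "\<one>\<^bsub>K\<^esub> \<odot>\<^bsub>T\<^esub> X = X" if X: "X \<in> carrier T" for X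
    using X
  proof (induction rule: T_induct)
    case (pure v w)
    then show ?case by (simp add: smult_pure)
  next
    case (add X Y)
    then show ?case by (simp add: sm)
  qed
qed

lemma pure_bilinear: "k_bilinear K V W T pr"
  by (intro k_bilinearI k_linearI)
     (auto simp: T_sel pure_closed pure_add_left pure_add_right smult_pure pure_smult_right)

lemma lift_linear:
  assumes "module K U" "k_bilinear K V W U f"
    and "\<And>v b w. v \<in> carrier V \<Longrightarrow> b \<in> B \<Longrightarrow> w \<in> carrier W \<Longrightarrow> f (ra v b) w = f v (la b w)"
  shows "k_linear K T U (tens_lift U f)"
    and "v \<in> carrier V \<Longrightarrow> w \<in> carrier W \<Longrightarrow> tens_lift U f (pr v w) = f v w"
proof -
  interpret U: module K U by fact
  interpret T: module K T by (rule module_T)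
  note b = k_bilinear_balanced [of K V W U f B ra la, OF assms(2,3)]
  note l = additive_mapD [OF tens_lift_additive [OF U.abelian_group_axioms b], folded T_sel]
  have p: "tens_lift U f (pr v w) = f v w" if "v \<in> carrier V" "w \<in> carrier W" for v w
    by (rule tens_lift_eq [OF U.abelian_group_axioms b that])
  then show "v \<in> carrier V \<Longrightarrow> w \<in> carrier W \<Longrightarrow> tens_lift U f (pr v w) = f v w" by simp
  show "k_linear K T U (tens_lift U f)"
  proof (rule k_linearI)
    fix k X assume k: "k \<in> carrier K" and X: "X \<in> carrier T"
    from X show "tens_lift U f (k \<odot>\<^bsub>T\<^esub> X) = k \<odot>\<^bsub>U\<^esub> tens_lift U f X"
    proof (induction rule: T_induct)
      case (pure v w)
      then show ?case
        using k k_linearD(3) [OF k_bilinearD(2) [OF assms(2)]] by (simp add: smult_pure p)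
    next
      case (add X Y)
      then show ?case using k by (simp add: T.smult_r_distr U.smult_r_distr l)
    qed
  qed (use l in auto)
qed

text \<open>On a pure tensor the lift is \<open>F u v w\<close>, and linearity in \<open>u\<close>
  survives sums. Nested Sweedler sums are recognised as multilinear in their parameters by
  this.\<close>

lemma lift_param_linear:
  assumes U: "module K U" and Q: "module K Q" and X: "X \<in> carrier T"
    and F: "\<And>u. u \<in> carrier Q \<Longrightarrow> k_bilinear K V W U (F u)"
    and bal: "\<And>u v b w. u \<in> carrier Q \<Longrightarrow> v \<in> carrier V \<Longrightarrow> b \<in> B \<Longrightarrow> w \<in> carrier W \<Longrightarrow>
      F u (ra v b) w = F u v (la b w)"
    and l: "\<And>v w. v \<in> carrier V \<Longrightarrow> w \<in> carrier W \<Longrightarrow> k_linear K Q U (\<lambda>u. F u v w)"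
  shows "k_linear K Q U (\<lambda>u. tens_lift U (F u) X)"
  using X
proof (induction rule: T_induct)
  case (pure v w)
  then show ?case
    using l by (subst k_linear_cong [OF Q, where g = "\<lambda>u. F u v w"]) (auto intro: lift_linear(2) [OF U F bal])
next
  case (add X Y)
  then show ?case
    by (subst k_linear_cong [OF Q, where g = "\<lambda>u. tens_lift U (F u) X \<oplus>\<^bsub>U\<^esub> tens_lift U (F u) Y"])
       (auto intro: k_linear_add [OF U] k_linearD(2) [OF lift_linear(1) [OF U F bal]])
qed

lemma linear_eqI:
  assumes "k_linear K T U g" "k_linear K T U h" "X \<in> carrier T"
    and "\<And>v w. v \<in> carrier V \<Longrightarrow> w \<in> carrier W \<Longrightarrow> g (pr v w) = h (pr v w)"
  shows "g X = h X"
  using assms(3) by (induction rule: T_induct) (use assms in \<open>auto simp: k_linearD(2)\<close>)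

lemma lift_cong:
  assumes "module K U" "X \<in> carrier T"
    "\<And>v w. v \<in> carrier V \<Longrightarrow> w \<in> carrier W \<Longrightarrow> f v w = g v w"
    "\<And>v w. v \<in> carrier V \<Longrightarrow> w \<in> carrier W \<Longrightarrow> g v w \<in> carrier U"
  shows "tens_lift U f X = tens_lift U g X"
  using tens_lift_cong [of U X f g] assms module.axioms(2) by (metis T_sel(1))

end

section \<open>Tensor products over the ground ring\<close>

lemma tens_module_K:
  assumes "module K V" "module K W"
  shows "tens_module K (carrier K) (\<lambda>v k. k \<odot>\<^bsub>V\<^esub> v) (\<lambda>k w. k \<odot>\<^bsub>W\<^esub> w) V W (tensor_K K V W)"
proof -
  interpret V: module K V by fact
  interpret W: module K W by fact
  interpret tens "carrier K" "\<lambda>v k. k \<odot>\<^bsub>V\<^esub> v" "\<lambda>k w. k \<odot>\<^bsub>W\<^esub> w" V W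
    by unfold_locales auto
  show ?thesis
    apply unfold_locales
         apply (simp_all add: tensor_K_def tens_ring_def Let_def pure_K_def)
    apply (metis V.R.m_comm V.smult_assoc1)
    apply (simp add: pure_balanced)
    done
qed

context
  fixes K :: "('k, 'l) ring_scheme"
    and V :: "('k, 'v, 'm) module_scheme" and W :: "('k, 'w, 'n) module_scheme"
  assumes V: "module K V" and W: "module K W"
begin

interpretation tens_module K "carrier K" "\<lambda>v k. k \<odot>\<^bsub>V\<^esub> v" "\<lambda>k w. k \<odot>\<^bsub>W\<^esub> w" V W "tensor_K K V W"
  rewrites "tens_pure (carrier K) (\<lambda>v k. k \<odot>\<^bsub>V\<^esub> v) (\<lambda>k w. k \<odot>\<^bsub>W\<^esub> w) V W = pure_K K V W"
  by (rule tens_module_K [OF V W]) (simp add: pure_K_def)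

lemma module_tensor_K: "module K (tensor_K K V W)"
  by (rule module_T)

lemma pure_K_bilinear: "k_bilinear K V W (tensor_K K V W) (pure_K K V W)"
  by (rule pure_bilinear)

lemma pure_K_closed: "v \<in> carrier V \<Longrightarrow> w \<in> carrier W \<Longrightarrow> pure_K K V W v w \<in> carrier (tensor_K K V W)"
  by (rule k_bilinear_closed [OF pure_bilinear])

lemmas tensor_K_induct [consumes 1, case_names pure add] = T_induct

lemmas tensor_K_eqI = linear_eqI

lemmas tens_lift_K_cong = lift_cong

lemma k_bilinear_K_balanced:
  assumes "k_bilinear K V W T f" "v \<in> carrier V" "k \<in> carrier K" "w \<in> carrier W"
  shows "f (k \<odot>\<^bsub>V\<^esub> v) w = f v (k \<odot>\<^bsub>W\<^esub> w)"
  using assms by (simp add: k_linearD(3) [OF k_bilinearD(1) [OF assms(1)]] k_linearD(3) [OF k_bilinearD(2) [OF assms(1)]])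

lemma tens_lift_K_linear:
  assumes "module K T" "k_bilinear K V W T f"
  shows "k_linear K (tensor_K K V W) T (tens_lift T f)"
  by (rule lift_linear(1) [OF assms k_bilinear_K_balanced [OF assms(2)]])

lemma tens_lift_K_pure:
  assumes "module K T" "k_bilinear K V W T f" "v \<in> carrier V" "w \<in> carrier W"
  shows "tens_lift T f (pure_K K V W v w) = f v w"
  by (rule lift_linear(2) [OF assms(1,2) k_bilinear_K_balanced [OF assms(2)] assms(3,4)])

lemma tens_lift_K_closed:
  assumes "module K T" "k_bilinear K V W T f" "X \<in> carrier (tensor_K K V W)"
  shows "tens_lift T f X \<in> carrier T"
  by (rule k_linearD(1) [OF tens_lift_K_linear [OF assms(1,2)] assms(3)])

text \<open>Both sides are linear in \<open>X\<close> and agree on pure tensors. This is how a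
  linear map is moved into or out of a Sweedler sum.\<close>

lemma tens_lift_K_apply:
  assumes "module K T" "module K U" "k_bilinear K V W T f" "k_linear K T U h"
    "X \<in> carrier (tensor_K K V W)"
  shows "h (tens_lift T f X) = tens_lift U (\<lambda>v w. h (f v w)) X"
proof (rule linear_eqI [OF _ _ assms(5), where g = "\<lambda>X. h (tens_lift T f X)"])
  have b: "k_bilinear K V W U (\<lambda>v w. h (f v w))"
    by (intro k_bilinearI k_linear_comp [OF assms(4)] k_bilinearD [OF assms(3)])
  show "k_linear K (tensor_K K V W) U (\<lambda>X. h (tens_lift T f X))"
    by (rule k_linear_comp [OF assms(4) tens_lift_K_linear [OF assms(1,3)]])
  show "k_linear K (tensor_K K V W) U (tens_lift U (\<lambda>v w. h (f v w)))"
    by (rule tens_lift_K_linear [OF assms(2) b])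
  show "h (tens_lift T f (pure_K K V W v w)) = tens_lift U (\<lambda>v w. h (f v w)) (pure_K K V W v w)"
    if "v \<in> carrier V" "w \<in> carrier W" for v w
    using that by (simp add: tens_lift_K_pure [OF assms(1,3)] tens_lift_K_pure [OF assms(2) b])
qed

lemma tens_lift_K_add:
  assumes T: "module K T" and f: "k_bilinear K V W T f" and g: "k_bilinear K V W T g"
    and X: "X \<in> carrier (tensor_K K V W)"
  shows "tens_lift T (\<lambda>v w. f v w \<oplus>\<^bsub>T\<^esub> g v w) X = tens_lift T f X \<oplus>\<^bsub>T\<^esub> tens_lift T g X"
proof -
  have b: "k_bilinear K V W T (\<lambda>v w. f v w \<oplus>\<^bsub>T\<^esub> g v w)"
    using f g by (auto intro!: k_bilinearI k_linear_add [OF T] dest: k_bilinearD)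
  show ?thesis
    by (rule linear_eqI [OF tens_lift_K_linear [OF T b] k_linear_add [OF T] X])
       (simp_all add: tens_lift_K_linear T f g b tens_lift_K_pure)
qed

lemma tens_lift_K_smult:
  assumes T: "module K T" and f: "k_bilinear K V W T f" and k: "k \<in> carrier K"
    and X: "X \<in> carrier (tensor_K K V W)"
  shows "tens_lift T (\<lambda>v w. k \<odot>\<^bsub>T\<^esub> f v w) X = k \<odot>\<^bsub>T\<^esub> tens_lift T f X"
  by (rule tens_lift_K_apply [OF T T f k_linear_smult [OF T k_linear_ident k] X, symmetric])

lemma k_linear_tens_lift_K:
  assumes T: "module K T" and X: "X \<in> carrier (tensor_K K V W)"
    and U: "module K U"
    and F: "\<And>u. u \<in> carrier U \<Longrightarrow> k_bilinear K V W T (F u)"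
    and l: "\<And>v w. v \<in> carrier V \<Longrightarrow> w \<in> carrier W \<Longrightarrow> k_linear K U T (\<lambda>u. F u v w)"
  shows "k_linear K U T (\<lambda>u. tens_lift T (F u) X)"
  by (rule lift_param_linear [OF T U X F k_bilinear_K_balanced [OF F] l])

end

text \<open>Fubini for two independent Sweedler sums: linearity in \<open>X\<close> reduces the
  claim to a pure tensor, for which the sum over \<open>X\<close> disappears on both sides.\<close>

lemma tens_lift_K_swap:
  assumes V: "module K V" and W: "module K W" and V': "module K V'" and W': "module K W'"
    and T: "module K T"
    and X: "X \<in> carrier (tensor_K K V W)" and Y: "Y \<in> carrier (tensor_K K V' W')"
    and f: "\<And>v w. v \<in> carrier V \<Longrightarrow> w \<in> carrier W \<Longrightarrow> k_bilinear K V' W' T (f v w)"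
    and g: "\<And>v' w'. v' \<in> carrier V' \<Longrightarrow> w' \<in> carrier W' \<Longrightarrow> k_bilinear K V W T (\<lambda>v w. f v w v' w')"
  shows "tens_lift T (\<lambda>v w. tens_lift T (f v w) Y) X =
    tens_lift T (\<lambda>v' w'. tens_lift T (\<lambda>v w. f v w v' w') X) Y"
proof (rule tensor_K_eqI [OF V W _ _ X])
  note fl = k_bilinearD [OF f] and gl = k_bilinearD [OF g]
  have b: "k_bilinear K V W T (\<lambda>v w. tens_lift T (f v w) Y)"
    by (intro k_bilinearI k_linear_tens_lift_K [OF V' W' T Y] V W f gl)
  show "k_linear K (tensor_K K V W) T (tens_lift T (\<lambda>v w. tens_lift T (f v w) Y))"
    by (rule tens_lift_K_linear [OF V W T b])
  show "k_linear K (tensor_K K V W) T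
     (\<lambda>X. tens_lift T (\<lambda>v' w'. tens_lift T (\<lambda>v w. f v w v' w') X) Y)"
  proof (rule k_linear_tens_lift_K [OF V' W' T Y module_tensor_K [OF V W]])
    show "k_bilinear K V' W' T (\<lambda>v' w'. tens_lift T (\<lambda>v w. f v w v' w') X)"
      if "X \<in> carrier (tensor_K K V W)" for X
      by (intro k_bilinearI k_linear_tens_lift_K [OF V W T that] V' W' g fl)
    show "k_linear K (tensor_K K V W) T (tens_lift T (\<lambda>v w. f v w v' w'))"
      if "v' \<in> carrier V'" "w' \<in> carrier W'" for v' w'
      by (rule tens_lift_K_linear [OF V W T g [OF that]])
  qed
  show "tens_lift T (\<lambda>v w. tens_lift T (f v w) Y) (pure_K K V W v w) =
    tens_lift T (\<lambda>v' w'. tens_lift T (\<lambda>v w. f v w v' w') (pure_K K V W v w)) Y"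
    if vw: "v \<in> carrier V" "w \<in> carrier W" for v w
    unfolding tens_lift_K_pure [OF V W T b vw]
    by (rule tens_lift_K_cong [OF V' W' T Y, symmetric])
       (simp_all add: tens_lift_K_pure V W T g vw k_bilinear_closed [OF f])
qed

definition k_trilinear ::
  "('k, 'l) ring_scheme \<Rightarrow> ('k, 'u, 'p) module_scheme \<Rightarrow> ('k, 'v, 'm) module_scheme
    \<Rightarrow> ('k, 'w, 'n) module_scheme \<Rightarrow> ('k, 't, 'q) module_scheme \<Rightarrow> ('u \<Rightarrow> 'v \<Rightarrow> 'w \<Rightarrow> 't) \<Rightarrow> bool" where
  "k_trilinear K U V W T f \<longleftrightarrow>
     (\<forall>u\<in>carrier U. k_bilinear K V W T (f u)) \<and>
     (\<forall>v\<in>carrier V. \<forall>w\<in>carrier W. k_linear K U T (\<lambda>u. f u v w))"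

lemma k_trilinearI:
  assumes "\<And>u v. u \<in> carrier U \<Longrightarrow> v \<in> carrier V \<Longrightarrow> k_linear K W T (f u v)"
    and "\<And>u w. u \<in> carrier U \<Longrightarrow> w \<in> carrier W \<Longrightarrow> k_linear K V T (\<lambda>v. f u v w)"
    and "\<And>v w. v \<in> carrier V \<Longrightarrow> w \<in> carrier W \<Longrightarrow> k_linear K U T (\<lambda>u. f u v w)"
  shows "k_trilinear K U V W T f"
  using assms by (simp add: k_trilinear_def k_bilinear_def)

lemma k_trilinearD:
  assumes "k_trilinear K U V W T f"
  shows "u \<in> carrier U \<Longrightarrow> v \<in> carrier V \<Longrightarrow> k_linear K W T (f u v)"
    and "u \<in> carrier U \<Longrightarrow> w \<in> carrier W \<Longrightarrow> k_linear K V T (\<lambda>v. f u v w)"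
    and "v \<in> carrier V \<Longrightarrow> w \<in> carrier W \<Longrightarrow> k_linear K U T (\<lambda>u. f u v w)"
  using assms by (auto simp: k_trilinear_def k_bilinear_def)

lemma k_trilinear_closed:
  "k_trilinear K U V W T f \<Longrightarrow> u \<in> carrier U \<Longrightarrow> v \<in> carrier V \<Longrightarrow> w \<in> carrier W \<Longrightarrow> f u v w \<in> carrier T"
  by (blast dest: k_trilinearD(1) k_linearD(1))

section \<open>Tensor products of algebras\<close>

lemma k_algebra_mult_bilinear:
  assumes "k_algebra K A" shows "k_bilinear K A A A (\<otimes>\<^bsub>A\<^esub>)"
proof -
  interpret A: k_algebra K A by fact
  show ?thesis
    by (intro k_bilinearI k_linearI) (auto simp: A.l_distr A.r_distr A.smult_mult_left A.smult_mult_right)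
qed

context
  fixes K :: "('k, 'l) ring_scheme"
    and V :: "('k, 'v, 'm) module_scheme" and W :: "('k, 'w, 'n) module_scheme"
  assumes VA: "k_algebra K V" and WA: "k_algebra K W"
begin

interpretation V: k_algebra K V by (rule VA)
interpretation W: k_algebra K W by (rule WA)

interpretation VW: module K "tensor_K K V W" by (rule module_tensor_K [OF V.module_axioms W.module_axioms])

lemma tensor_K_mult_eq:
  "X \<otimes>\<^bsub>tensor_K K V W\<^esub> Y = tens_lift (tensor_K K V W) (\<lambda>v w. tens_lift (tensor_K K V W) (\<lambda>v' w'. pure_K K V W (v \<otimes>\<^bsub>V\<^esub> v') (w \<otimes>\<^bsub>W\<^esub> w')) Y) X"
proof -
  let ?G = "tens_group (carrier K) (\<lambda>v k. k \<odot>\<^bsub>V\<^esub> v) (\<lambda>k w. k \<odot>\<^bsub>W\<^esub> w) V W"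
  let ?T = "\<lparr>carrier = carrier ?G, monoid.mult = undefined, monoid.one = undefined,
              ring.zero = \<one>\<^bsub>?G\<^esub>, add = monoid.mult ?G\<rparr>"
  have eq: "tens_lift ?T f = tens_lift (tensor_K K V W) f" for f :: "'c \<Rightarrow> 'd \<Rightarrow> ('v, 'w) tens"
    by (rule tens_lift_ring_cong) (simp_all add: tensor_K_def Let_def)
  show ?thesis
    by (subst tensor_K_def) (simp add: Let_def eq)
qed

lemma tensor_K_one: "\<one>\<^bsub>tensor_K K V W\<^esub> = pure_K K V W \<one>\<^bsub>V\<^esub> \<one>\<^bsub>W\<^esub>"
  by (simp add: tensor_K_def Let_def)

lemma mult_inner_bilinear:
  assumes "v \<in> carrier V" "w \<in> carrier W"
  shows "k_bilinear K V W (tensor_K K V W) (\<lambda>v' w'. pure_K K V W (v \<otimes>\<^bsub>V\<^esub> v') (w \<otimes>\<^bsub>W\<^esub> w'))"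
  using assms
  by (intro k_bilinearI k_bilinear_right [OF pure_K_bilinear] k_bilinear_left [OF pure_K_bilinear]
      k_bilinearD(1) [OF k_algebra_mult_bilinear] V.module_axioms W.module_axioms VA WA)
     auto

lemma mult_outer_bilinear:
  assumes "Y \<in> carrier (tensor_K K V W)"
  shows "k_bilinear K V W (tensor_K K V W)
    (\<lambda>v w. tens_lift (tensor_K K V W) (\<lambda>v' w'. pure_K K V W (v \<otimes>\<^bsub>V\<^esub> v') (w \<otimes>\<^bsub>W\<^esub> w')) Y)"
  using assms
  by (intro k_bilinearI k_linear_tens_lift_K mult_inner_bilinear k_bilinear_right [OF pure_K_bilinear]
      k_bilinear_left [OF pure_K_bilinear] V.module_axioms W.module_axioms VW.module_axioms
      k_bilinearD(2) [OF k_algebra_mult_bilinear] VA WA)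
     (auto intro: V.module_axioms W.module_axioms k_bilinearD(1) [OF k_algebra_mult_bilinear] VA WA)

lemma tensor_K_mult_pure:
  assumes "v \<in> carrier V" "w \<in> carrier W" "v' \<in> carrier V" "w' \<in> carrier W"
  shows "pure_K K V W v w \<otimes>\<^bsub>tensor_K K V W\<^esub> pure_K K V W v' w' = pure_K K V W (v \<otimes>\<^bsub>V\<^esub> v') (w \<otimes>\<^bsub>W\<^esub> w')"
  unfolding tensor_K_mult_eq
  by (subst tens_lift_K_pure [OF V.module_axioms W.module_axioms VW.module_axioms mult_outer_bilinear])
     (simp_all add: assms pure_K_closed V.module_axioms W.module_axioms
       tens_lift_K_pure [OF V.module_axioms W.module_axioms VW.module_axioms mult_inner_bilinear])

lemma tensor_K_mult_bilinear: "k_bilinear K (tensor_K K V W) (tensor_K K V W) (tensor_K K V W) (\<otimes>\<^bsub>tensor_K K V W\<^esub>)"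
proof (rule k_bilinearI)
  fix X assume X: "X \<in> carrier (tensor_K K V W)"
  show "k_linear K (tensor_K K V W) (tensor_K K V W) (\<lambda>Y. X \<otimes>\<^bsub>tensor_K K V W\<^esub> Y)"
    unfolding tensor_K_mult_eq
    by (rule k_linear_tens_lift_K [OF V.module_axioms W.module_axioms VW.module_axioms X VW.module_axioms])
       (auto intro: mult_outer_bilinear tens_lift_K_linear [OF V.module_axioms W.module_axioms VW.module_axioms]
          mult_inner_bilinear)
next
  fix Y assume Y: "Y \<in> carrier (tensor_K K V W)"
  show "k_linear K (tensor_K K V W) (tensor_K K V W) (\<lambda>X. X \<otimes>\<^bsub>tensor_K K V W\<^esub> Y)"
    unfolding tensor_K_mult_eq
    by (rule tens_lift_K_linear [OF V.module_axioms W.module_axioms VW.module_axioms mult_outer_bilinear [OF Y]])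
qed

text \<open>Associativity is additive in each of its three arguments, so nested inductions reduce it
  to pure tensors, where it holds factor by factor.\<close>

lemma k_algebra_tensor_K: "k_algebra K (tensor_K K V W)"
proof -
  note mods = V.module_axioms W.module_axioms
  note lin = k_linearD [OF k_bilinearD(1) [OF tensor_K_mult_bilinear]]
    k_linearD [OF k_bilinearD(2) [OF tensor_K_mult_bilinear]]
  note ind = tensor_K_induct [OF mods]
  have cl: "pure_K K V W v w \<in> carrier (tensor_K K V W)" if "v \<in> carrier V" "w \<in> carrier W" for v w
    by (rule pure_K_closed [OF mods that])
  have mcl: "X \<otimes>\<^bsub>tensor_K K V W\<^esub> Y \<in> carrier (tensor_K K V W)" if "X \<in> carrier (tensor_K K V W)" "Y \<in> carrier (tensor_K K V W)" for X Y
    by (rule lin(1) [OF that])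
  have assoc: "X \<otimes>\<^bsub>tensor_K K V W\<^esub> Y \<otimes>\<^bsub>tensor_K K V W\<^esub> Z = X \<otimes>\<^bsub>tensor_K K V W\<^esub> (Y \<otimes>\<^bsub>tensor_K K V W\<^esub> Z)"
    if X: "X \<in> carrier (tensor_K K V W)" and Y: "Y \<in> carrier (tensor_K K V W)" and Z: "Z \<in> carrier (tensor_K K V W)" for X Y Z
    using X
  proof (rule ind)
    fix v w assume vw: "v \<in> carrier V" "w \<in> carrier W"
    show "pure_K K V W v w \<otimes>\<^bsub>tensor_K K V W\<^esub> Y \<otimes>\<^bsub>tensor_K K V W\<^esub> Z = pure_K K V W v w \<otimes>\<^bsub>tensor_K K V W\<^esub> (Y \<otimes>\<^bsub>tensor_K K V W\<^esub> Z)"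
      using Y
    proof (rule ind)
      fix v' w' assume vw': "v' \<in> carrier V" "w' \<in> carrier W"
      show "pure_K K V W v w \<otimes>\<^bsub>tensor_K K V W\<^esub> pure_K K V W v' w' \<otimes>\<^bsub>tensor_K K V W\<^esub> Z =
          pure_K K V W v w \<otimes>\<^bsub>tensor_K K V W\<^esub> (pure_K K V W v' w' \<otimes>\<^bsub>tensor_K K V W\<^esub> Z)"
        using Z
        by (rule ind) (simp_all add: vw vw' tensor_K_mult_pure V.m_assoc W.m_assoc lin cl mcl)
    qed (simp_all add: vw lin cl mcl Z)
  qed (simp_all add: lin cl mcl Y Z)
  have one: "\<one>\<^bsub>tensor_K K V W\<^esub> \<in> carrier (tensor_K K V W)" by (simp add: tensor_K_one cl)
  have "\<one>\<^bsub>tensor_K K V W\<^esub> \<otimes>\<^bsub>tensor_K K V W\<^esub> X = X" "X \<otimes>\<^bsub>tensor_K K V W\<^esub> \<one>\<^bsub>tensor_K K V W\<^esub> = X" if X: "X \<in> carrier (tensor_K K V W)" for X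
    by (rule ind [OF X]; simp add: tensor_K_one tensor_K_mult_pure lin cl)+
  then have "ring (tensor_K K V W)"
    using assoc one mcl
    by (intro ringI VW.abelian_group_axioms monoidI) (simp_all add: lin)
  then show ?thesis
    by (intro k_algebra.intro VW.module_axioms k_algebra_axioms.intro) (simp_all add: lin)
qed

text \<open>The product is itself a double lift, through which the linear extension of
  \<open>f\<close> can be pushed. An identity between products in H \<otimes> H thereby becomes one
  between double Sweedler sums.\<close>

lemma tens_lift_K_mult:
  assumes T: "module K T" and f: "k_bilinear K V W T f"
    and X: "X \<in> carrier (tensor_K K V W)" and Y: "Y \<in> carrier (tensor_K K V W)"
  shows "tens_lift T f (X \<otimes>\<^bsub>tensor_K K V W\<^esub> Y) =
    tens_lift T (\<lambda>v w. tens_lift T (\<lambda>v' w'. f (v \<otimes>\<^bsub>V\<^esub> v') (w \<otimes>\<^bsub>W\<^esub> w')) Y) X"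
proof -
  note mods = V.module_axioms W.module_axioms
  have lin: "k_linear K (tensor_K K V W) T (tens_lift T f)" by (rule tens_lift_K_linear [OF mods T f])
  have "tens_lift T f (tens_lift (tensor_K K V W) (\<lambda>v' w'. pure_K K V W (v \<otimes>\<^bsub>V\<^esub> v') (w \<otimes>\<^bsub>W\<^esub> w')) Y) =
      tens_lift T (\<lambda>v' w'. f (v \<otimes>\<^bsub>V\<^esub> v') (w \<otimes>\<^bsub>W\<^esub> w')) Y"
    if vw: "v \<in> carrier V" "w \<in> carrier W" for v w
    by (subst tens_lift_K_apply [OF mods VW.module_axioms T mult_inner_bilinear [OF vw] lin Y],
        rule tens_lift_K_cong [OF mods T Y])
       (simp_all add: vw tens_lift_K_pure [OF mods T f] k_bilinear_closed [OF f])
  moreover have "k_bilinear K V W T (\<lambda>v' w'. f (v \<otimes>\<^bsub>V\<^esub> v') (w \<otimes>\<^bsub>W\<^esub> w'))"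
    if vw: "v \<in> carrier V" "w \<in> carrier W" for v w
    using vw by (intro k_bilinearI k_bilinear_right [OF f] k_bilinear_left [OF f]
        k_bilinearD(1) [OF k_algebra_mult_bilinear] VA WA) auto
  ultimately show ?thesis
    unfolding tensor_K_mult_eq
    by (subst tens_lift_K_apply [OF mods VW.module_axioms T mult_outer_bilinear [OF Y] lin X],
        intro tens_lift_K_cong [OF mods T X])
       (simp_all add: tens_lift_K_closed [OF mods T _ Y])
qed

end

section \<open>Sweedler calculus\<close>

lemma (in k_algebra) k_module: "module K A" ..

context hopf_algebra
begin

lemma k_algebra_H: "k_algebra K H" ..

lemma module_H: "module K H" ..

abbreviation (input) "H2 \<equiv> tensor2 K H"
abbreviation (input) "H3 \<equiv> tensor3 K H"

lemma k_algebra_H2: "k_algebra K H2"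
  by (rule k_algebra_tensor_K [OF k_algebra_H k_algebra_H])

lemma module_H2: "module K H2"
  by (rule k_algebra.k_module [OF k_algebra_H2])

lemma module_H3: "module K H3"
  by (rule module_tensor_K [OF module_H2 module_H])

lemma comult_closed: "x \<in> carrier H \<Longrightarrow> comult H x \<in> carrier H2"
  by (rule k_linearD(1) [OF comult_linear])

lemmas lift_linear = tens_lift_K_linear [OF module_H module_H]
lemmas lift_pure = tens_lift_K_pure [OF module_H module_H]
lemmas lift_closed = tens_lift_K_closed [OF module_H module_H]
lemmas lift_cong = tens_lift_K_cong [OF module_H module_H]
lemmas lift_apply = tens_lift_K_apply [OF module_H module_H]
lemmas lift_add = tens_lift_K_add [OF module_H module_H]
lemmas lift_smult = tens_lift_K_smult [OF module_H module_H]
lemmas lift_swap = tens_lift_K_swap [OF module_H module_H module_H module_H]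
lemmas lift_fun_linear = k_linear_tens_lift_K [OF module_H module_H]
lemmas lift_mult = tens_lift_K_mult [OF k_algebra_H k_algebra_H]

lemma comult_fun_linear: "k_linear K U H g \<Longrightarrow> k_linear K U H2 (\<lambda>x. comult H (g x))"
  by (rule k_linear_comp [OF comult_linear])

lemma lift_arg_linear:
  "module K T \<Longrightarrow> k_bilinear K H H T f \<Longrightarrow> k_linear K U H2 g \<Longrightarrow>
     k_linear K U T (\<lambda>x. tens_lift T f (g x))"
  by (rule k_linear_comp [OF lift_linear])

context
  fixes T :: "('a, 't, 'q) module_scheme" and f :: "'c \<Rightarrow> 'c \<Rightarrow> 'c \<Rightarrow> 't"
  assumes T: "module K T" and f: "k_trilinear K H H H T f"
begin

text \<open>A trilinear \<open>f\<close> extends to the left-bracketed (H \<otimes> H) \<otimes> H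
  in two stages: its first two arguments are lifted for a fixed third one, and the result is lifted
  again. The composite is the extension used in all threefold identities below.\<close>

lemma lift3_bilinear: "k_bilinear K H2 H T (\<lambda>X z. tens_lift T (\<lambda>u v. f u v z) X)"
  by (intro k_bilinearI lift_fun_linear [OF T] lift_linear [OF T] module_H k_trilinearD [OF f])

lemma lift3_pure:
  assumes "X \<in> carrier H2" "z \<in> carrier H"
  shows "tens_lift T (\<lambda>X z. tens_lift T (\<lambda>u v. f u v z) X) (pure_K K H2 H X z) =
    tens_lift T (\<lambda>u v. f u v z) X"
  by (rule tens_lift_K_pure [OF module_H2 module_H T lift3_bilinear assms])

lemma lift3_pure3:
  assumes "x \<in> carrier H" "y \<in> carrier H" "z \<in> carrier H"
  shows "tens_lift T (\<lambda>X z. tens_lift T (\<lambda>u v. f u v z) X) (pure3 K H x y z) = f x y z"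
  unfolding pure3_def
  by (subst lift3_pure) (auto simp: assms pure_K_closed [OF module_H module_H]
      intro!: lift_pure [OF T] k_bilinearI k_trilinearD [OF f])

end

lemma comult_id_apply:
  assumes T: "module K T" and f: "k_trilinear K H H H T f" and X: "X \<in> carrier H2"
  shows "tens_lift T (\<lambda>X z. tens_lift T (\<lambda>u v. f u v z) X) (comult_id K H X) =
    tens_lift T (\<lambda>x z. tens_lift T (\<lambda>u v. f u v z) (comult H x)) X"
  unfolding comult_id_def
  by (subst lift_apply [OF module_H3 T _ tens_lift_K_linear [OF module_H2 module_H T lift3_bilinear [OF T f]] X],
      intro k_bilinearI k_bilinear_left [OF pure_K_bilinear] k_bilinear_right [OF pure_K_bilinear]
        module_H2 module_H comult_linear k_linear_ident comult_closed, assumption+,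
      rule lift_cong [OF T X], subst lift3_pure [OF T f])
     (auto intro!: comult_closed lift_closed [OF T] k_bilinearI k_trilinearD [OF f])

lemma id_comult_bilinear:
  assumes T: "module K T" and f: "k_trilinear K H H H T f"
  shows "k_bilinear K H H T (\<lambda>x z. tens_lift T (f x) (comult H z))"
  by (intro k_bilinearI lift_arg_linear [OF T] lift_fun_linear [OF T] k_trilinearD [OF f]
      comult_linear comult_closed module_H | assumption)+

lemma pure3_trilinear: "k_trilinear K H H H H3 (pure3 K H)"
  unfolding pure3_def
  by (intro k_trilinearI k_bilinear_left [OF pure_K_bilinear] k_bilinear_right [OF pure_K_bilinear]
      k_linear_ident module_H module_H2 pure_K_closed | assumption)+

lemma pure3_closed:
  "x \<in> carrier H \<Longrightarrow> y \<in> carrier H \<Longrightarrow> z \<in> carrier H \<Longrightarrow> pure3 K H x y z \<in> carrier H3"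
  by (rule k_trilinear_closed [OF pure3_trilinear])

lemma id_comult_apply:
  assumes T: "module K T" and f: "k_trilinear K H H H T f" and X: "X \<in> carrier H2"
  shows "tens_lift T (\<lambda>X z. tens_lift T (\<lambda>u v. f u v z) X) (id_comult K H X) =
    tens_lift T (\<lambda>x z. tens_lift T (f x) (comult H z)) X"
proof -
  let ?\<phi> = "tens_lift T (\<lambda>X z. tens_lift T (\<lambda>u v. f u v z) X)"
  have \<phi>: "k_linear K H3 T ?\<phi>"
    by (rule tens_lift_K_linear [OF module_H2 module_H T lift3_bilinear [OF T f]])
  have "?\<phi> (tens_lift H3 (pure3 K H x) (comult H z)) = tens_lift T (f x) (comult H z)"
    if xz: "x \<in> carrier H" "z \<in> carrier H" for x z
    by (subst lift_apply [OF module_H3 T _ \<phi> comult_closed [OF xz(2)]],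
        intro k_bilinearI k_trilinearD [OF pure3_trilinear] xz, assumption+,
        rule lift_cong [OF T comult_closed [OF xz(2)]])
       (auto intro: lift3_pure3 [OF T f] xz k_trilinear_closed [OF f])
  then show ?thesis
    unfolding id_comult_def
    by (subst lift_apply [OF module_H3 T id_comult_bilinear [OF module_H3 pure3_trilinear] \<phi> X],
        intro lift_cong [OF T X])
       (auto intro: k_bilinear_closed [OF id_comult_bilinear [OF T f]])
qed

text \<open>The extension of \<open>f\<close> to the threefold tensor power is applied to both sides
  of the axiom \<open>coassoc\<close>. Later uses of coassociativity all have this form, with
  \<open>f\<close> chosen to contain the rest of the expression.\<close>

lemma coassoc_lift:
  assumes T: "module K T" and f: "k_trilinear K H H H T f" and x: "x \<in> carrier H"
  shows "tens_lift T (\<lambda>x z. tens_lift T (\<lambda>u v. f u v z) (comult H x)) (comult H x) =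
    tens_lift T (\<lambda>x z. tens_lift T (f x) (comult H z)) (comult H x)"
  using comult_id_apply [OF T f comult_closed [OF x]] id_comult_apply [OF T f comult_closed [OF x]]
  by (simp add: coassoc [OF x])

lemma antipode_closed: "x \<in> carrier H \<Longrightarrow> antipode H x \<in> carrier H"
  by (rule k_linearD(1) [OF antipode_linear])

lemma mult_linear_left: "k_linear K U H g \<Longrightarrow> y \<in> carrier H \<Longrightarrow> k_linear K U H (\<lambda>x. g x \<otimes> y)"
  by (rule k_bilinear_left [OF k_algebra_mult_bilinear [OF k_algebra_H]])

lemma mult_linear_right: "k_linear K U H g \<Longrightarrow> y \<in> carrier H \<Longrightarrow> k_linear K U H (\<lambda>x. y \<otimes> g x)"
  by (rule k_bilinear_right [OF k_algebra_mult_bilinear [OF k_algebra_H]])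

lemma antipode_fun_linear: "k_linear K U H g \<Longrightarrow> k_linear K U H (\<lambda>x. antipode H (g x))"
  by (rule k_linear_comp [OF antipode_linear])

lemma counit_fun_linear:
  assumes "module K T" "k_linear K U H g" "t \<in> carrier T"
  shows "k_linear K U T (\<lambda>x. counit H (g x) \<odot>\<^bsub>T\<^esub> t)"
proof -
  interpret T: module K T by fact
  show ?thesis
    by (rule k_linearI)
       (auto simp: k_linearD [OF assms(2)] counit_add counit_smult counit_closed assms(3)
          T.smult_l_distr T.smult_assoc1)
qed

text \<open>An axiom with values in \<open>H\<close> is transported along a linear map
  \<open>f\<close>, so that it can be used at one spot inside a larger expression; the next three
  lemmas follow the same pattern.\<close>

lemma counit_left_lift:
  assumes T: "module K T" and f: "k_linear K H T f" and x: "x \<in> carrier H"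
  shows "tens_lift T (\<lambda>y z. counit H y \<odot>\<^bsub>T\<^esub> f z) (comult H x) = f x"
proof -
  have "f x = f (tens_lift H (\<lambda>y z. counit H y \<odot> z) (comult H x))" using counit_left [OF x] by simp
  also have "\<dots> = tens_lift T (\<lambda>y z. f (counit H y \<odot> z)) (comult H x)"
    by (rule lift_apply [OF module_H T _ f comult_closed [OF x]])
       (intro k_bilinearI counit_fun_linear k_linear_smult module_H k_linear_ident counit_closed)
  also have "\<dots> = tens_lift T (\<lambda>y z. counit H y \<odot>\<^bsub>T\<^esub> f z) (comult H x)"
    by (rule lift_cong [OF T comult_closed [OF x]])
       (auto simp: k_linearD [OF f] counit_closed intro!: module.smult_closed [OF T])
  finally show ?thesis by simp
qed

lemma counit_right_lift:
  assumes T: "module K T" and f: "k_linear K H T f" and x: "x \<in> carrier H"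
  shows "tens_lift T (\<lambda>y z. counit H z \<odot>\<^bsub>T\<^esub> f y) (comult H x) = f x"
proof -
  have "f x = f (tens_lift H (\<lambda>y z. counit H z \<odot> y) (comult H x))" using counit_right [OF x] by simp
  also have "\<dots> = tens_lift T (\<lambda>y z. f (counit H z \<odot> y)) (comult H x)"
    by (rule lift_apply [OF module_H T _ f comult_closed [OF x]])
       (intro k_bilinearI counit_fun_linear k_linear_smult module_H k_linear_ident counit_closed)
  also have "\<dots> = tens_lift T (\<lambda>y z. counit H z \<odot>\<^bsub>T\<^esub> f y) (comult H x)"
    by (rule lift_cong [OF T comult_closed [OF x]])
       (auto simp: k_linearD [OF f] counit_closed intro!: module.smult_closed [OF T])
  finally show ?thesis by simp
qed

lemma antipode_left_lift:
  assumes T: "module K T" and f: "k_linear K H T f" and x: "x \<in> carrier H"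
  shows "tens_lift T (\<lambda>y z. f (antipode H y \<otimes> z)) (comult H x) = counit H x \<odot>\<^bsub>T\<^esub> f \<one>"
proof -
  have "counit H x \<odot>\<^bsub>T\<^esub> f \<one> = f (tens_lift H (\<lambda>y z. antipode H y \<otimes> z) (comult H x))"
    by (simp add: antipode_left [OF x] k_linearD [OF f] counit_closed x)
  also have "\<dots> = tens_lift T (\<lambda>y z. f (antipode H y \<otimes> z)) (comult H x)"
    by (rule lift_apply [OF module_H T _ f comult_closed [OF x]])
       (intro k_bilinearI mult_linear_left mult_linear_right antipode_linear k_linear_ident antipode_closed)
  finally show ?thesis by simp
qed

lemma antipode_right_lift:
  assumes T: "module K T" and f: "k_linear K H T f" and x: "x \<in> carrier H"
  shows "tens_lift T (\<lambda>y z. f (y \<otimes> antipode H z)) (comult H x) = counit H x \<odot>\<^bsub>T\<^esub> f \<one>"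
proof -
  have "counit H x \<odot>\<^bsub>T\<^esub> f \<one> = f (tens_lift H (\<lambda>y z. y \<otimes> antipode H z) (comult H x))"
    by (simp add: antipode_right [OF x] k_linearD [OF f] counit_closed x)
  also have "\<dots> = tens_lift T (\<lambda>y z. f (y \<otimes> antipode H z)) (comult H x)"
    by (rule lift_apply [OF module_H T _ f comult_closed [OF x]])
       (intro k_bilinearI mult_linear_left mult_linear_right antipode_linear k_linear_ident antipode_closed)
  finally show ?thesis by simp
qed

lemma comult_mult_lift:
  assumes T: "module K T" and f: "k_bilinear K H H T f" and x: "x \<in> carrier H" "y \<in> carrier H"
  shows "tens_lift T f (comult H (x \<otimes> y)) =
    tens_lift T (\<lambda>u v. tens_lift T (\<lambda>u' v'. f (u \<otimes> u') (v \<otimes> v')) (comult H y)) (comult H x)"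
  by (simp add: comult_mult x lift_mult [OF T f comult_closed comult_closed])

lemma comult_one_lift:
  assumes T: "module K T" and f: "k_bilinear K H H T f"
  shows "tens_lift T f (comult H \<one>) = f \<one> \<one>"
  by (simp add: comult_one tensor_K_one [OF k_algebra_H k_algebra_H] lift_pure [OF T f])

lemma pure3_mult:
  assumes "x \<in> carrier H" "y \<in> carrier H" "z \<in> carrier H" "x' \<in> carrier H" "y' \<in> carrier H" "z' \<in> carrier H"
  shows "pure3 K H x y z \<otimes>\<^bsub>H3\<^esub> pure3 K H x' y' z' = pure3 K H (x \<otimes> x') (y \<otimes> y') (z \<otimes> z')"
  using assms unfolding pure3_def
  by (simp add: tensor_K_mult_pure [OF k_algebra_H2 k_algebra_H] pure_K_closed [OF module_H module_H]
      tensor_K_mult_pure [OF k_algebra_H k_algebra_H])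

lemma one3: "\<one>\<^bsub>H3\<^esub> = pure3 K H \<one> \<one> \<one>"
  by (simp add: pure3_def tensor_K_one [OF k_algebra_H2 k_algebra_H] tensor_K_one [OF k_algebra_H k_algebra_H])

lemma k_algebra_H3: "k_algebra K H3"
  by (rule k_algebra_tensor_K [OF k_algebra_H2 k_algebra_H])

text \<open>Multiplicativity on pairs passes to all of H \<otimes> H by using linearity once for
  each factor. Instances are \<Delta> \<otimes> id, id \<otimes> \<Delta>, the three leg embeddings
  and id \<otimes> \<epsilon>.\<close>

lemma lift_multiplicative:
  assumes A: "k_algebra K A" and g: "k_bilinear K H H A g"
    and m: "\<And>x y x' y'. x \<in> carrier H \<Longrightarrow> y \<in> carrier H \<Longrightarrow> x' \<in> carrier H \<Longrightarrow> y' \<in> carrier H \<Longrightarrow>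
      g (x \<otimes> x') (y \<otimes> y') = g x y \<otimes>\<^bsub>A\<^esub> g x' y'"
    and X: "X \<in> carrier H2" and Y: "Y \<in> carrier H2"
  shows "tens_lift A g (X \<otimes>\<^bsub>H2\<^esub> Y) = tens_lift A g X \<otimes>\<^bsub>A\<^esub> tens_lift A g Y"
proof -
  interpret A: k_algebra K A by fact
  note bil = k_algebra_mult_bilinear [OF A]
  note mA = A.k_module
  have "tens_lift A g (X \<otimes>\<^bsub>H2\<^esub> Y) =
     tens_lift A (\<lambda>x y. tens_lift A (\<lambda>x' y'. g (x \<otimes> x') (y \<otimes> y')) Y) X"
    by (rule lift_mult [OF mA g X Y])
  also have "\<dots> = tens_lift A (\<lambda>x y. g x y \<otimes>\<^bsub>A\<^esub> tens_lift A g Y) X"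
  proof (rule lift_cong [OF mA X])
    fix x y assume xy: "x \<in> carrier H" "y \<in> carrier H"
    have "tens_lift A (\<lambda>x' y'. g (x \<otimes> x') (y \<otimes> y')) Y = tens_lift A (\<lambda>x' y'. g x y \<otimes>\<^bsub>A\<^esub> g x' y') Y"
      by (rule lift_cong [OF mA Y]) (simp_all add: m xy k_bilinear_closed [OF g])
    then show "tens_lift A (\<lambda>x' y'. g (x \<otimes> x') (y \<otimes> y')) Y = g x y \<otimes>\<^bsub>A\<^esub> tens_lift A g Y"
      using lift_apply [OF mA mA g k_bilinearD(1) [OF bil k_bilinear_closed [OF g xy]] Y] by simp
  qed (simp add: k_bilinear_closed [OF g] lift_closed [OF mA g Y])
  also have "\<dots> = tens_lift A g X \<otimes>\<^bsub>A\<^esub> tens_lift A g Y"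
    by (rule lift_apply [OF mA mA g k_bilinearD(2) [OF bil lift_closed [OF mA g Y]] X, symmetric])
  finally show ?thesis .
qed


section \<open>Algebra maps from H \<otimes> H to the threefold tensor power\<close>

lemma comult_id_mult:
  assumes "X \<in> carrier H2" "Y \<in> carrier H2"
  shows "comult_id K H (X \<otimes>\<^bsub>H2\<^esub> Y) = comult_id K H X \<otimes>\<^bsub>H3\<^esub> comult_id K H Y"
  unfolding comult_id_def
  by (rule lift_multiplicative [OF k_algebra_H3 _ _ assms])
     (auto intro!: k_bilinearI k_bilinear_left [OF pure_K_bilinear] k_bilinear_right [OF pure_K_bilinear]
        module_H2 module_H comult_linear k_linear_ident comult_closed
      simp: comult_mult tensor_K_mult_pure [OF k_algebra_H2 k_algebra_H] comult_closed)

text \<open>Because the threefold power is bracketed to the left, id \<otimes> \<Delta> is a nested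
  lift. Multiplicativity of \<Delta> splits the sum over the coproduct of a product into two, which
  are then factored out one after the other.\<close>

lemma id_comult_mult:
  assumes "X \<in> carrier H2" "Y \<in> carrier H2"
  shows "id_comult K H (X \<otimes>\<^bsub>H2\<^esub> Y) = id_comult K H X \<otimes>\<^bsub>H3\<^esub> id_comult K H Y"
  unfolding id_comult_def
proof (rule lift_multiplicative [OF k_algebra_H3 id_comult_bilinear [OF module_H3 pure3_trilinear] _ assms])
  fix x y x' y'
  assume xy: "x \<in> carrier H" "y \<in> carrier H" "x' \<in> carrier H" "y' \<in> carrier H"
  let ?T = H3
  interpret T: k_algebra K ?T by (rule k_algebra_H3)
  have g: "k_bilinear K H H ?T (pure3 K H x)" if "x \<in> carrier H" for x
    using that by (intro k_bilinearI k_trilinearD [OF pure3_trilinear])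
  have "tens_lift ?T (pure3 K H (x \<otimes> x')) (comult H (y \<otimes> y')) =
     tens_lift ?T (\<lambda>u v. tens_lift ?T (\<lambda>u' v'. pure3 K H (x \<otimes> x') (u \<otimes> u') (v \<otimes> v')) (comult H y')) (comult H y)"
    using xy by (intro comult_mult_lift module_H3 g) auto
  also have "\<dots> = tens_lift ?T (\<lambda>u v. pure3 K H x u v \<otimes>\<^bsub>?T\<^esub> tens_lift ?T (pure3 K H x') (comult H y')) (comult H y)"
  proof (rule lift_cong [OF module_H3 comult_closed [OF xy(2)]])
    fix u v assume uv: "u \<in> carrier H" "v \<in> carrier H"
    note p = pure3_closed [OF xy(1) uv]
    have "tens_lift ?T (\<lambda>u' v'. pure3 K H (x \<otimes> x') (u \<otimes> u') (v \<otimes> v')) (comult H y') =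
       tens_lift ?T (\<lambda>u' v'. pure3 K H x u v \<otimes>\<^bsub>?T\<^esub> pure3 K H x' u' v') (comult H y')"
      using xy uv by (intro lift_cong [OF module_H3 comult_closed]) (simp_all add: pure3_mult pure3_closed)
    also have "\<dots> = pure3 K H x u v \<otimes>\<^bsub>?T\<^esub> tens_lift ?T (pure3 K H x') (comult H y')"
      by (rule lift_apply [OF module_H3 module_H3 g [OF xy(3)]
            k_bilinearD(1) [OF k_algebra_mult_bilinear [OF k_algebra_H3] p] comult_closed [OF xy(4)], symmetric])
    finally show "tens_lift ?T (\<lambda>u' v'. pure3 K H (x \<otimes> x') (u \<otimes> u') (v \<otimes> v')) (comult H y') = \<dots>" .
  qed (simp add: pure3_closed xy lift_closed [OF module_H3 g] comult_closed)
  also have "\<dots> = tens_lift ?T (pure3 K H x) (comult H y) \<otimes>\<^bsub>?T\<^esub> tens_lift ?T (pure3 K H x') (comult H y')"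
    using xy by (intro lift_apply [OF module_H3 module_H3 g, symmetric]
      k_bilinearD(2) [OF k_algebra_mult_bilinear [OF k_algebra_H3]] lift_closed [OF module_H3 g] comult_closed)
  finally show "tens_lift ?T (pure3 K H (x \<otimes> x')) (comult H (y \<otimes> y')) = \<dots>" .
qed

text \<open>The embeddings X \<mapsto> X_12, X_13, X_23. They are unital and multiplicative, hence
  carry R' to the inverses of the legs of R.\<close>

definition "leg12 = tens_lift H3 (\<lambda>r s. pure3 K H r s \<one>)"
definition "leg13 = tens_lift H3 (\<lambda>r s. pure3 K H r \<one> s)"
definition "leg23 = tens_lift H3 (\<lambda>r s. pure3 K H \<one> r s)"

lemma leg_bilinear:
  "k_bilinear K H H H3 (\<lambda>r s. pure3 K H r s \<one>)"
  "k_bilinear K H H H3 (\<lambda>r s. pure3 K H r \<one> s)"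
  "k_bilinear K H H H3 (\<lambda>r s. pure3 K H \<one> r s)"
  by (intro k_bilinearI k_trilinearD [OF pure3_trilinear] one_closed | assumption)+

lemma leg_mult:
  assumes "X \<in> carrier H2" "Y \<in> carrier H2"
  shows "leg12 (X \<otimes>\<^bsub>H2\<^esub> Y) = leg12 X \<otimes>\<^bsub>H3\<^esub> leg12 Y"
    "leg13 (X \<otimes>\<^bsub>H2\<^esub> Y) = leg13 X \<otimes>\<^bsub>H3\<^esub> leg13 Y"
    "leg23 (X \<otimes>\<^bsub>H2\<^esub> Y) = leg23 X \<otimes>\<^bsub>H3\<^esub> leg23 Y"
  unfolding leg12_def leg13_def leg23_def
  by (rule lift_multiplicative [OF k_algebra_H3 _ _ assms]; simp add: leg_bilinear pure3_mult)+

lemma leg_one: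
  "leg12 \<one>\<^bsub>H2\<^esub> = \<one>\<^bsub>H3\<^esub>" "leg13 \<one>\<^bsub>H2\<^esub> = \<one>\<^bsub>H3\<^esub>"
  "leg23 \<one>\<^bsub>H2\<^esub> = \<one>\<^bsub>H3\<^esub>"
  by (simp_all add: leg12_def leg13_def leg23_def tensor_K_one [OF k_algebra_H k_algebra_H]
      lift_pure [OF module_H3] leg_bilinear one3)

lemma leg_closed:
  assumes "X \<in> carrier H2"
  shows "leg12 X \<in> carrier H3" "leg13 X \<in> carrier H3" "leg23 X \<in> carrier H3"
  using assms by (simp_all add: leg12_def leg13_def leg23_def lift_closed [OF module_H3] leg_bilinear)

lemma comult_id_one: "comult_id K H \<one>\<^bsub>H2\<^esub> = \<one>\<^bsub>H3\<^esub>"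
proof -
  have "k_bilinear K H H H3 (\<lambda>x z. pure_K K H2 H (comult H x) z)"
    by (auto intro!: k_bilinearI k_bilinear_left [OF pure_K_bilinear] k_bilinear_right [OF pure_K_bilinear]
        module_H2 module_H comult_linear k_linear_ident comult_closed)
  then show ?thesis
    by (simp add: comult_id_def tensor_K_one [OF k_algebra_H k_algebra_H] lift_pure [OF module_H3] one3
        pure3_def comult_one)
qed

lemma id_comult_one: "id_comult K H \<one>\<^bsub>H2\<^esub> = \<one>\<^bsub>H3\<^esub>"
proof -
  have "k_bilinear K H H H3 (pure3 K H \<one>)"
    by (intro k_bilinearI k_trilinearD [OF pure3_trilinear] one_closed)
  then show ?thesis
    by (simp add: id_comult_def tensor_K_one [OF k_algebra_H k_algebra_H] lift_pure [OF module_H3] one3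
        comult_one id_comult_bilinear [OF module_H3 pure3_trilinear])
qed

lemma comult_id_closed: "X \<in> carrier H2 \<Longrightarrow> comult_id K H X \<in> carrier H3"
  unfolding comult_id_def
  by (rule lift_closed [OF module_H3])
     (auto intro!: k_bilinearI k_bilinear_left [OF pure_K_bilinear] k_bilinear_right [OF pure_K_bilinear]
        module_H2 module_H comult_linear k_linear_ident comult_closed)

lemma id_comult_closed: "X \<in> carrier H2 \<Longrightarrow> id_comult K H X \<in> carrier H3"
  unfolding id_comult_def
  by (rule lift_closed [OF module_H3 id_comult_bilinear [OF module_H3 pure3_trilinear]])

text \<open>Bilinearity of the product pulls both factors out as Sweedler sums. With leg embeddings
  for \<open>g\<close> and \<open>h\<close> this unfolds the right-hand sides of the hexagon
  identities.\<close>

lemma lift3_mult: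
  assumes T: "module K T" and f: "k_trilinear K H H H T f"
    and g: "k_bilinear K H H H3 g" and h: "k_bilinear K H H H3 h"
    and X: "X \<in> carrier H2" and Y: "Y \<in> carrier H2"
  shows "tens_lift T (\<lambda>X z. tens_lift T (\<lambda>u v. f u v z) X)
      (tens_lift H3 g X \<otimes>\<^bsub>H3\<^esub> tens_lift H3 h Y) =
    tens_lift T (\<lambda>r s. tens_lift T (\<lambda>r' s'.
      tens_lift T (\<lambda>X z. tens_lift T (\<lambda>u v. f u v z) X) (g r s \<otimes>\<^bsub>H3\<^esub> h r' s')) Y) X"
proof -
  let ?\<phi> = "tens_lift T (\<lambda>X z. tens_lift T (\<lambda>u v. f u v z) X)"
  have \<phi>: "k_linear K H3 T ?\<phi>"
    by (rule tens_lift_K_linear [OF module_H2 module_H T lift3_bilinear [OF T f]])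
  note bil = k_algebra_mult_bilinear [OF k_algebra_H3]
  note hY = lift_closed [OF module_H3 h Y]
  have "?\<phi> (tens_lift H3 g X \<otimes>\<^bsub>H3\<^esub> tens_lift H3 h Y) =
     tens_lift T (\<lambda>r s. ?\<phi> (g r s \<otimes>\<^bsub>H3\<^esub> tens_lift H3 h Y)) X"
    by (rule lift_apply [OF module_H3 T g k_linear_comp [OF \<phi> k_bilinearD(2) [OF bil hY]] X])
  also have "\<dots> = tens_lift T (\<lambda>r s. tens_lift T (\<lambda>r' s'. ?\<phi> (g r s \<otimes>\<^bsub>H3\<^esub> h r' s')) Y) X"
  proof (rule lift_cong [OF T X])
    fix r s assume "r \<in> carrier H" "s \<in> carrier H"
    note c = k_bilinear_closed [OF g this]
    note l = k_linear_comp [OF \<phi> k_bilinearD(1) [OF bil c]]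
    show "?\<phi> (g r s \<otimes>\<^bsub>H3\<^esub> tens_lift H3 h Y) =
        tens_lift T (\<lambda>r' s'. ?\<phi> (g r s \<otimes>\<^bsub>H3\<^esub> h r' s')) Y"
      by (rule lift_apply [OF module_H3 T h l Y])
    show "tens_lift T (\<lambda>r' s'. ?\<phi> (g r s \<otimes>\<^bsub>H3\<^esub> h r' s')) Y \<in> carrier T"
      by (intro lift_closed [OF T _ Y] k_bilinearI k_linear_comp [OF l] k_bilinearD [OF h])
  qed
  finally show ?thesis .
qed

end

section \<open>Universal R-matrices\<close>

context quasitriangular
begin

abbreviation R' where "R' \<equiv> inv\<^bsub>H2\<^esub> R"

lemma R_closed: "R \<in> carrier H2"
  using R_invertible by (simp add: Units_def)

lemma R'_facts:
  "R' \<in> carrier H2" "R \<otimes>\<^bsub>H2\<^esub> R' = \<one>\<^bsub>H2\<^esub>"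
  "R' \<otimes>\<^bsub>H2\<^esub> R = \<one>\<^bsub>H2\<^esub>"
proof -
  interpret H2: k_algebra K "tensor2 K H" by (rule k_algebra_H2)
  show "R' \<in> carrier H2" "R \<otimes>\<^bsub>H2\<^esub> R' = \<one>\<^bsub>H2\<^esub>"
    "R' \<otimes>\<^bsub>H2\<^esub> R = \<one>\<^bsub>H2\<^esub>"
    using R_invertible by auto
qed

lemmas R'_closed = R'_facts(1)

lemma R_R'_lift:
  assumes T: "module K T" and f: "k_bilinear K H H T f"
  shows "tens_lift T (\<lambda>r s. tens_lift T (\<lambda>r' s'. f (r \<otimes> r') (s \<otimes> s')) R') R = f \<one> \<one>"
    and "tens_lift T (\<lambda>r s. tens_lift T (\<lambda>r' s'. f (r \<otimes> r') (s \<otimes> s')) R) R' = f \<one> \<one>"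
  using lift_mult [OF T f R_closed R'_closed] lift_mult [OF T f R'_closed R_closed]
  by (simp_all add: R'_facts tensor_K_one [OF k_algebra_H k_algebra_H] lift_pure [OF T f])

text \<open>The product R_13 R_23 read through \<open>f\<close>: (r \<otimes> 1 \<otimes> s)(1
  \<otimes> r' \<otimes> s') = r \<otimes> r' \<otimes> ss'.\<close>

lemma hex1_lift:
  assumes T: "module K T" and f: "k_trilinear K H H H T f"
  shows "tens_lift T (\<lambda>r s. tens_lift T (\<lambda>u v. f u v s) (comult H r)) R =
    tens_lift T (\<lambda>r s. tens_lift T (\<lambda>r' s'. f r r' (s \<otimes> s')) R) R"
  unfolding comult_id_apply [OF T f R_closed, symmetric] comult_id_R
    lift3_mult [OF T f leg_bilinear(2,3) R_closed R_closed]
  by (intro lift_cong [OF T R_closed] lift_closed [OF T _ R_closed])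
     (auto simp: pure3_mult lift3_pure3 [OF T f] k_trilinear_closed [OF f]
       intro!: k_bilinearI k_trilinearD [OF f] k_linear_comp [OF k_trilinearD(1) [OF f]]
         k_bilinearD(1) [OF k_algebra_mult_bilinear [OF k_algebra_H]])

text \<open>Here (r \<otimes> 1 \<otimes> s)(r' \<otimes> s' \<otimes> 1) = rr' \<otimes> s'
  \<otimes> s, so the outer sum supplies the last slot and the inner one the middle slot.\<close>

lemma hex2_lift:
  assumes T: "module K T" and f: "k_trilinear K H H H T f"
  shows "tens_lift T (\<lambda>r s. tens_lift T (f r) (comult H s)) R =
    tens_lift T (\<lambda>r s. tens_lift T (\<lambda>r' s'. f (r \<otimes> r') s' s) R) R"
  unfolding id_comult_apply [OF T f R_closed, symmetric] id_comult_R
    lift3_mult [OF T f leg_bilinear(2,1) R_closed R_closed]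
  by (intro lift_cong [OF T R_closed] lift_closed [OF T _ R_closed])
     (auto simp: pure3_mult lift3_pure3 [OF T f] k_trilinear_closed [OF f]
       intro!: k_bilinearI k_trilinearD [OF f] k_linear_comp [OF k_trilinearD(3) [OF f]]
         k_bilinearD(1) [OF k_algebra_mult_bilinear [OF k_algebra_H]])

text \<open>\<open>c'\<close> is a left inverse of the product of \<open>a\<close> and
  \<open>b\<close>, and \<open>b'\<close> times \<open>a'\<close> is a right inverse, so the two
  agree. It inverts the hexagon identities, whose factors come back in the opposite order.\<close>

lemma H3_inverse_product:
  assumes "c' \<otimes>\<^bsub>H3\<^esub> (a \<otimes>\<^bsub>H3\<^esub> b) = \<one>\<^bsub>H3\<^esub>" "a \<otimes>\<^bsub>H3\<^esub> a' = \<one>\<^bsub>H3\<^esub>" "b \<otimes>\<^bsub>H3\<^esub> b' = \<one>\<^bsub>H3\<^esub>"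
    and cl: "a \<in> carrier H3" "b \<in> carrier H3" "a' \<in> carrier H3" "b' \<in> carrier H3" "c' \<in> carrier H3"
  shows "c' = b' \<otimes>\<^bsub>H3\<^esub> a'"
proof -
  interpret H3: k_algebra K "tensor3 K H" by (rule k_algebra_H3)
  have "a \<otimes>\<^bsub>H3\<^esub> b \<otimes>\<^bsub>H3\<^esub> (b' \<otimes>\<^bsub>H3\<^esub> a') = a \<otimes>\<^bsub>H3\<^esub> (b \<otimes>\<^bsub>H3\<^esub> b' \<otimes>\<^bsub>H3\<^esub> a')"
    using cl by (simp add: H3.m_assoc)
  then have "a \<otimes>\<^bsub>H3\<^esub> b \<otimes>\<^bsub>H3\<^esub> (b' \<otimes>\<^bsub>H3\<^esub> a') = \<one>\<^bsub>H3\<^esub>"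
    using assms by simp
  then show ?thesis
    using H3.inv_unique [OF assms(1)] cl by simp
qed

lemma comult_id_R': "comult_id K H R' = leg23 R' \<otimes>\<^bsub>H3\<^esub> leg13 R'"
  by (rule H3_inverse_product [of _ "leg13 R" "leg23 R"], fold comult_id_R [folded leg13_def leg23_def])
     (simp_all add: comult_id_mult [symmetric] leg_mult [symmetric] R_closed R'_facts comult_id_one leg_one
       leg_closed comult_id_closed)

lemma id_comult_R': "id_comult K H R' = leg12 R' \<otimes>\<^bsub>H3\<^esub> leg13 R'"
  by (rule H3_inverse_product [of _ "leg13 R" "leg12 R"], fold id_comult_R [folded leg13_def leg12_def])
     (simp_all add: id_comult_mult [symmetric] leg_mult [symmetric] R_closed R'_facts id_comult_one leg_one
       leg_closed id_comult_closed)

text \<open>From (1 \<otimes> r \<otimes> s)(r' \<otimes> 1 \<otimes> s') = r' \<otimes> r \<otimes>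
  ss'. The outer sum now feeds the second slot, which decides the order in which two sums over R'
  must stand before this is applied.\<close>

lemma hex1'_lift:
  assumes T: "module K T" and f: "k_trilinear K H H H T f"
  shows "tens_lift T (\<lambda>r s. tens_lift T (\<lambda>u v. f u v s) (comult H r)) R' =
    tens_lift T (\<lambda>r s. tens_lift T (\<lambda>r' s'. f r' r (s \<otimes> s')) R') R'"
  unfolding comult_id_apply [OF T f R'_closed, symmetric] comult_id_R' leg23_def leg13_def
    lift3_mult [OF T f leg_bilinear(3,2) R'_closed R'_closed]
  by (intro lift_cong [OF T R'_closed] lift_closed [OF T _ R'_closed])
     (auto simp: pure3_mult lift3_pure3 [OF T f] k_trilinear_closed [OF f]
       intro!: k_bilinearI k_trilinearD [OF f] k_linear_comp [OF k_trilinearD(1) [OF f]]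
         k_bilinearD(1) [OF k_algebra_mult_bilinear [OF k_algebra_H]])

lemma hex2'_lift:
  assumes T: "module K T" and f: "k_trilinear K H H H T f"
  shows "tens_lift T (\<lambda>r s. tens_lift T (f r) (comult H s)) R' =
    tens_lift T (\<lambda>r s. tens_lift T (\<lambda>r' s'. f (r \<otimes> r') s s') R') R'"
  unfolding id_comult_apply [OF T f R'_closed, symmetric] id_comult_R' leg12_def leg13_def
    lift3_mult [OF T f leg_bilinear(1,2) R'_closed R'_closed]
  by (intro lift_cong [OF T R'_closed] lift_closed [OF T _ R'_closed])
     (auto simp: pure3_mult lift3_pure3 [OF T f] k_trilinear_closed [OF f]
       intro!: k_bilinearI k_trilinearD [OF f] k_linear_comp [OF k_trilinearD(3) [OF f]]
         k_bilinearD(1) [OF k_algebra_mult_bilinear [OF k_algebra_H]])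

text \<open>The opposite coproduct, equal to R \<Delta> R' by the axiom
  \<open>R_comult\<close>.\<close>

definition "cop x = tens_lift H2 (\<lambda>y z. pure_K K H H z y) (comult H x)"

lemma flip_bilinear: "k_bilinear K H H H2 (\<lambda>y z. pure_K K H H z y)"
  by (intro k_bilinearI k_bilinearD [OF pure_K_bilinear] module_H)

lemma cop_closed: "x \<in> carrier H \<Longrightarrow> cop x \<in> carrier H2"
  unfolding cop_def by (rule lift_closed [OF module_H2 flip_bilinear comult_closed])

lemma cop_lift:
  assumes T: "module K T" and f: "k_bilinear K H H T f" and x: "x \<in> carrier H"
  shows "tens_lift T f (cop x) = tens_lift T (\<lambda>y z. f z y) (comult H x)"
  unfolding cop_def
  by (subst lift_apply [OF module_H2 T flip_bilinear lift_linear [OF T f] comult_closed [OF x]],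
      rule lift_cong [OF T comult_closed [OF x]])
     (simp_all add: lift_pure [OF T f] k_bilinear_closed [OF f])

lemma k_bilinear_mult_left:
  assumes f: "k_bilinear K H H T f" and "y \<in> carrier H" "z \<in> carrier H"
  shows "k_bilinear K H H T (\<lambda>r s. f (y \<otimes> r) (z \<otimes> s))"
  using assms(2,3)
  by (intro k_bilinearI k_bilinear_left [OF f] k_bilinear_right [OF f] mult_linear_right k_linear_ident) auto

text \<open>Cancelling R' on the right or R on the left of the conjugation formula gives
  \<Delta>^cop R = R \<Delta> and R' \<Delta>^cop = \<Delta> R'. The first yields the equivariance
  of \<open>correction\<close>, the second moves a coproduct past R' in the left Leibniz
  rule.\<close>

lemma R_comult_lift:
  assumes T: "module K T" and f: "k_bilinear K H H T f" and x: "x \<in> carrier H"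
  shows "tens_lift T (\<lambda>y z. tens_lift T (\<lambda>r s. f (z \<otimes> r) (y \<otimes> s)) R) (comult H x) =
      tens_lift T (\<lambda>r s. tens_lift T (\<lambda>y z. f (r \<otimes> y) (s \<otimes> z)) (comult H x)) R"
    and "tens_lift T (\<lambda>y z. tens_lift T (\<lambda>r s. f (y \<otimes> r) (z \<otimes> s)) R') (comult H x) =
      tens_lift T (\<lambda>r s. tens_lift T (\<lambda>y z. f (r \<otimes> z) (s \<otimes> y)) (comult H x)) R'"
proof -
  interpret H2: k_algebra K "tensor2 K H" by (rule k_algebra_H2)
  note cl = R_closed R'_closed comult_closed [OF x] cop_closed [OF x]
  have c: "cop x = R \<otimes>\<^bsub>H2\<^esub> comult H x \<otimes>\<^bsub>H2\<^esub> R'"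
    unfolding cop_def by (rule R_comult [OF x])
  have 1: "cop x \<otimes>\<^bsub>H2\<^esub> R = R \<otimes>\<^bsub>H2\<^esub> comult H x"
    unfolding c using cl by (simp add: H2.m_assoc R'_facts)
  have 2: "R' \<otimes>\<^bsub>H2\<^esub> cop x = comult H x \<otimes>\<^bsub>H2\<^esub> R'"
    unfolding c using cl by (simp add: H2.m_assoc [symmetric] R'_facts)
  have b: "k_bilinear K H H T (\<lambda>y z. tens_lift T (\<lambda>r s. f (y \<otimes> r) (z \<otimes> s)) R)"
    by (intro k_bilinearI lift_fun_linear [OF T R_closed module_H] k_bilinear_mult_left [OF f]
        k_bilinear_left [OF f] k_bilinear_right [OF f] mult_linear_left k_linear_ident) auto
  have "tens_lift T f (cop x \<otimes>\<^bsub>H2\<^esub> R) =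
      tens_lift T (\<lambda>y z. tens_lift T (\<lambda>r s. f (z \<otimes> r) (y \<otimes> s)) R) (comult H x)"
    unfolding lift_mult [OF T f cl(4,1)] by (rule cop_lift [OF T b x])
  then show "tens_lift T (\<lambda>y z. tens_lift T (\<lambda>r s. f (z \<otimes> r) (y \<otimes> s)) R) (comult H x) =
      tens_lift T (\<lambda>r s. tens_lift T (\<lambda>y z. f (r \<otimes> y) (s \<otimes> z)) (comult H x)) R"
    unfolding 1 lift_mult [OF T f cl(1,3)] by simp
  have "tens_lift T (\<lambda>y z. tens_lift T (\<lambda>r s. f (y \<otimes> r) (z \<otimes> s)) R') (comult H x) =
      tens_lift T (\<lambda>r s. tens_lift T (\<lambda>y z. f (r \<otimes> y) (s \<otimes> z)) (cop x)) R'"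
    unfolding lift_mult [OF T f cl(3,2), symmetric] lift_mult [OF T f cl(2,4), symmetric] 2 ..
  also have "\<dots> = tens_lift T (\<lambda>r s. tens_lift T (\<lambda>y z. f (r \<otimes> z) (s \<otimes> y)) (comult H x)) R'"
    by (rule lift_cong [OF T R'_closed])
       (simp_all add: cop_lift [OF T k_bilinear_mult_left [OF f] x, symmetric]
         lift_closed [OF T k_bilinear_mult_left [OF f] cl(4)])
  finally show "tens_lift T (\<lambda>y z. tens_lift T (\<lambda>r s. f (y \<otimes> r) (z \<otimes> s)) R') (comult H x) = \<dots>" .
qed

text \<open>Put e = (id \<otimes> \<epsilon>)(R). Applying id \<otimes> \<epsilon> \<otimes>
  \<epsilon> to (id \<otimes> \<Delta>)(R) = R_13 R_12 gives e = ee, and e is invertible because id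
  \<otimes> \<epsilon> is an algebra map. So e = 1, and its inverse (id \<otimes> \<epsilon>)(R') is
  1 as well.\<close>

lemma counit_right_R':
  assumes T: "module K T" and f: "k_linear K H T f"
  shows "tens_lift T (\<lambda>r s. counit H s \<odot>\<^bsub>T\<^esub> f r) R' = f \<one>"
proof -
  let ?g = "\<lambda>r s. counit H s \<odot> r"
  have g: "k_bilinear K H H H ?g"
    by (intro k_bilinearI counit_fun_linear k_linear_smult module_H k_linear_ident counit_closed)
  have m: "?g (x \<otimes> x') (y \<otimes> y') = ?g x y \<otimes> ?g x' y'"
    if "x \<in> carrier H" "y \<in> carrier H" "x' \<in> carrier H" "y' \<in> carrier H" for x y x' y'
    using that by (simp add: counit_mult smult_mult_left smult_mult_right counit_closed R.m_comm
        flip: smult_assoc1)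
  define e where "e = tens_lift H ?g R"
  define e' where "e' = tens_lift H ?g R'"
  have cl: "e \<in> carrier H" "e' \<in> carrier H"
    unfolding e_def e'_def by (intro lift_closed [OF module_H g] R_closed R'_closed)+
  have one: "tens_lift H ?g \<one>\<^bsub>H2\<^esub> = \<one>"
    by (simp add: tensor_K_one [OF k_algebra_H k_algebra_H] lift_pure [OF module_H g] counit_one)
  have ee': "e \<otimes> e' = \<one>"
  proof -
    have "tens_lift H ?g (R \<otimes>\<^bsub>H2\<^esub> R') = e \<otimes> e'"
      unfolding e_def e'_def by (rule lift_multiplicative [OF k_algebra_H g _ R_closed R'_closed]) (rule m)
    then show ?thesis by (simp only: R'_facts one)
  qed
  \<comment> \<open>The trilinear function of id \<otimes> \<epsilon> \<otimes> \<epsilon>. On the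
    side of the hexagon with \<Delta> one counit undoes the coproduct; on the side with the product
    both counits remain, one for each copy of R.\<close>
  let ?f = "\<lambda>r y z. counit H y \<odot> (counit H z \<odot> r)"
  have f3: "k_trilinear K H H H H ?f"
    by (intro k_trilinearI counit_fun_linear k_linear_smult module_H k_linear_ident counit_closed
        smult_closed | assumption)+
  have "e = tens_lift H (\<lambda>r s. tens_lift H (?f r) (comult H s)) R"
    unfolding e_def
    by (rule lift_cong [OF module_H R_closed], rule counit_left_lift [OF module_H, symmetric])
       (auto intro!: counit_fun_linear lift_closed [OF module_H] k_bilinearI k_trilinearD [OF f3]
         comult_closed k_linear_ident module_H)
  also have "\<dots> = tens_lift H (\<lambda>r s. tens_lift H (\<lambda>r' s'. ?f (r \<otimes> r') s' s) R) R"
    by (rule hex2_lift [OF module_H f3])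
  also have "\<dots> = e \<otimes> e"
  proof -
    have "e \<otimes> e = tens_lift H (\<lambda>r s. ?g r s \<otimes> e) R"
      unfolding e_def
      by (intro lift_apply [OF module_H module_H g] k_bilinearD [OF k_algebra_mult_bilinear [OF k_algebra_H]]
          R_closed lift_closed [OF module_H g])
    also have "\<dots> = tens_lift H (\<lambda>r s. tens_lift H (\<lambda>r' s'. ?f (r \<otimes> r') s' s) R) R"
    proof (rule lift_cong [OF module_H R_closed])
      fix r s assume rs: "r \<in> carrier H" "s \<in> carrier H"
      have "?g r s \<otimes> e = tens_lift H (\<lambda>r' s'. ?g r s \<otimes> ?g r' s') R"
        unfolding e_def
        by (intro lift_apply [OF module_H module_H g] k_bilinearD [OF k_algebra_mult_bilinear [OF k_algebra_H]]
          R_closed k_bilinear_closed [OF g] rs)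
      also have "\<dots> = tens_lift H (\<lambda>r' s'. ?f (r \<otimes> r') s' s) R"
        by (rule lift_cong [OF module_H R_closed])
           (use rs in \<open>simp_all add: counit_closed smult_mult_left smult_mult_right R.m_comm flip: smult_assoc1\<close>)
      finally show "?g r s \<otimes> e = tens_lift H (\<lambda>r' s'. ?f (r \<otimes> r') s' s) R" .
      then show "tens_lift H (\<lambda>r' s'. ?f (r \<otimes> r') s' s) R \<in> carrier H"
        using rs cl by (metis counit_closed m_closed smult_closed)
    qed
    finally show ?thesis by simp
  qed
  finally have "e \<otimes> e = e" by simp
  then have "e = \<one>" using cl ee' by (metis m_assoc r_one)
  then have "e' = \<one>" using ee' cl by simp
  then have "f \<one> = f (tens_lift H ?g R')" by (simp add: e'_def)
  also have "\<dots> = tens_lift T (\<lambda>r s. f (?g r s)) R'"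
    by (rule lift_apply [OF module_H T g f R'_closed])
  also have "\<dots> = tens_lift T (\<lambda>r s. counit H s \<odot>\<^bsub>T\<^esub> f r) R'"
    by (rule lift_cong [OF T R'_closed])
       (auto simp: k_linearD [OF f] counit_closed intro!: module.smult_closed [OF T])
  finally show ?thesis by simp
qed

end

section \<open>Tensor products of bimodules\<close>

lemma h_module_imp_module: "h_module K H V \<Longrightarrow> module K V"
  by (simp add: h_module_def)

lemma h_bimodule_imp_h_module: "h_bimodule K H A V \<Longrightarrow> h_module K H V"
  by (simp add: h_bimodule_def)

lemma h_bimodule_imp_module: "h_bimodule K H A V \<Longrightarrow> module K V"
  by (simp add: h_bimodule_def h_module_def)

lemma h_module_algebra_imp_h_module: "h_module_algebra K H A \<Longrightarrow> h_module K H A"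
  by (simp add: h_module_algebra_def)

lemma hact_bilinear: "h_module K H V \<Longrightarrow> k_bilinear K H V V (hact V)"
  by (intro k_bilinearI) (auto intro: h_module.hact_linear intro!: k_linearI
      simp: h_module.hact_add h_module.hact_smult k_linearD [OF h_module.hact_linear])

lemma lact_bilinear: "h_bimodule K H A V \<Longrightarrow> k_bilinear K A V V (lact V)"
  by (intro k_bilinearI) (auto intro: h_bimodule.lact_linear intro!: k_linearI
      simp: h_bimodule.lact_add h_bimodule.lact_smult k_linearD [OF h_bimodule.lact_linear])

lemma ract_bilinear: "h_bimodule K H A V \<Longrightarrow> k_bilinear K V A V (ract V)"
  by (intro k_bilinearI) (auto intro: h_bimodule.ract_linear intro!: k_linearI
      simp: h_bimodule.ract_add h_bimodule.ract_smult k_linearD [OF h_bimodule.ract_linear])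

lemma hact_closed: "h_module K H V \<Longrightarrow> \<xi> \<in> carrier H \<Longrightarrow> v \<in> carrier V \<Longrightarrow> hact V \<xi> v \<in> carrier V"
  by (rule k_bilinear_closed [OF hact_bilinear])

lemma lact_closed: "h_bimodule K H A V \<Longrightarrow> a \<in> carrier A \<Longrightarrow> v \<in> carrier V \<Longrightarrow> lact V a v \<in> carrier V"
  by (rule k_bilinear_closed [OF lact_bilinear])

lemma ract_closed: "h_bimodule K H A V \<Longrightarrow> v \<in> carrier V \<Longrightarrow> a \<in> carrier A \<Longrightarrow> ract V v a \<in> carrier V"
  by (rule k_bilinear_closed [OF ract_bilinear])

lemmas k_linear_hact = k_bilinear_left [OF hact_bilinear] k_bilinear_right [OF hact_bilinear]
lemmas k_linear_lact = k_bilinear_left [OF lact_bilinear] k_bilinear_right [OF lact_bilinear]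
lemmas k_linear_ract = k_bilinear_left [OF ract_bilinear] k_bilinear_right [OF ract_bilinear]

text \<open>A scalar k acts as multiplication by k1 in \<open>A\<close>, from the right on V and
  from the left on W, so balancing over \<open>A\<close> contains balancing over the ground
  ring.\<close>

lemma tens_module_A:
  assumes A: "k_algebra K A" and V: "h_bimodule K H A V" and W: "h_bimodule K H A W"
  shows "tens_module K (carrier A) (ract V) (lact W) V W (tensor_A H A V W)"
proof -
  interpret A: k_algebra K A by fact
  interpret V: module K V by (rule h_bimodule_imp_module [OF V])
  interpret W: module K W by (rule h_bimodule_imp_module [OF W])
  interpret tens "carrier A" "ract V" "lact W" V W
    by unfold_locales (auto intro: lact_closed [OF W] ract_closed [OF V])
  have r: "k \<odot>\<^bsub>V\<^esub> v = ract V v (k \<odot>\<^bsub>A\<^esub> \<one>\<^bsub>A\<^esub>)" if "k \<in> carrier K" "v \<in> carrier V" for k v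
    using that by (simp add: h_bimodule.ract_smult [OF V] h_bimodule.ract_one [OF V])
  have l: "k \<odot>\<^bsub>W\<^esub> w = lact W (k \<odot>\<^bsub>A\<^esub> \<one>\<^bsub>A\<^esub>) w" if "k \<in> carrier K" "w \<in> carrier W" for k w
    using that by (simp add: h_bimodule.lact_smult [OF W] h_bimodule.lact_one [OF W])
  have p: "pr v (k \<odot>\<^bsub>W\<^esub> w) = pr (k \<odot>\<^bsub>V\<^esub> v) w"
    if "k \<in> carrier K" "v \<in> carrier V" "w \<in> carrier W" for k v w
    using that by (simp add: r l pure_balanced)
  show ?thesis
    by unfold_locales
       (simp_all add: tensor_A_def tens_ring_def Let_def pure_A_def p
          k_linearD(3) [OF h_bimodule.ract_linear [OF V]])
qed

context
  fixes K :: "('k, 'l) ring_scheme" and H :: "('k, 'h, 'p) hopf_scheme"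
    and A :: "('k, 'h, 'a, 'n) hmod_scheme"
    and V :: "('k, 'h, 'a, 'v, 'm1) hbimod_scheme" and W :: "('k, 'h, 'a, 'w, 'm2) hbimod_scheme"
  assumes A: "k_algebra K A" and V: "h_bimodule K H A V" and W: "h_bimodule K H A W"
begin

interpretation tens_module K "carrier A" "ract V" "lact W" V W "tensor_A H A V W"
  rewrites "tens_pure (carrier A) (ract V) (lact W) V W = pure_A A V W"
  by (rule tens_module_A [OF A V W]) (simp add: pure_A_def)

lemmas module_tensor_A = module_T
lemmas pure_A_bilinear = pure_bilinear
lemmas pure_A_balanced = pure_balanced
lemmas tensor_A_eqI = linear_eqI
lemmas tens_lift_A_linear = lift_linear(1)
lemmas tens_lift_A_pure = lift_linear(2)
lemmas tens_lift_A_param = lift_param_linear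

lemma pure_A_closed: "v \<in> carrier V \<Longrightarrow> w \<in> carrier W \<Longrightarrow> pure_A A V W v w \<in> carrier (tensor_A H A V W)"
  by (rule k_bilinear_closed [OF pure_A_bilinear])

lemmas k_linear_pure_A = k_bilinear_left [OF pure_A_bilinear] k_bilinear_right [OF pure_A_bilinear]

lemma tensor_A_ops:
  "hact (tensor_A H A V W) \<xi> = tens_lift (tensor_A H A V W) (\<lambda>v w. tens_lift (tensor_A H A V W)
     (\<lambda>\<xi>1 \<xi>2. pure_A A V W (hact V \<xi>1 v) (hact W \<xi>2 w)) (comult H \<xi>))"
  "lact (tensor_A H A V W) a = tens_lift (tensor_A H A V W) (\<lambda>v w. pure_A A V W (lact V a v) w)"
  "ract (tensor_A H A V W) X a = tens_lift (tensor_A H A V W) (\<lambda>v w. pure_A A V W v (ract W w a)) X"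
proof -
  let ?G = "tens_group (carrier A) (ract V) (lact W) V W"
  let ?T = "\<lparr>carrier = carrier ?G, monoid.mult = undefined, monoid.one = undefined,
             ring.zero = \<one>\<^bsub>?G\<^esub>, add = monoid.mult ?G\<rparr>"
  have eq: "tens_lift ?T f = tens_lift (tensor_A H A V W) f" for f :: "'c \<Rightarrow> 'd \<Rightarrow> ('v, 'w) tens"
    by (rule tens_lift_ring_cong) (simp_all add: tensor_A_def Let_def)
  show
    "hact (tensor_A H A V W) \<xi> = tens_lift (tensor_A H A V W) (\<lambda>v w. tens_lift (tensor_A H A V W)
       (\<lambda>\<xi>1 \<xi>2. pure_A A V W (hact V \<xi>1 v) (hact W \<xi>2 w)) (comult H \<xi>))"
    "lact (tensor_A H A V W) a = tens_lift (tensor_A H A V W) (\<lambda>v w. pure_A A V W (lact V a v) w)"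
    "ract (tensor_A H A V W) X a = tens_lift (tensor_A H A V W) (\<lambda>v w. pure_A A V W v (ract W w a)) X"
    by (subst tensor_A_def, simp add: Let_def eq)+
qed

end

locale hopf_module_algebra = hopf_algebra K H + A: h_module_algebra K H A
  for K and H :: "('k, 'h, 'p) hopf_scheme" (structure) and A :: "('k, 'h, 'a, 'n) hmod_scheme"
begin

lemma k_algebra_A: "k_algebra K A" ..
lemma h_module_A: "h_module K H A" ..
lemma module_A: "module K A" ..

lemmas module_rules = h_bimodule_imp_h_module [of K H A] h_bimodule_imp_module [of K H A]
  h_module_imp_module [of K H]
  k_algebra_A h_module_A module_A module_H module_H2 module_tensor_A [of K A H]

lemmas closed_rules = hact_closed [of K H] lact_closed [of K H A] ract_closed [of K H A]
  pure_A_closed [of K A H] comult_closed lift_closed antipode_closed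

lemmas linear_rules = k_linear_ident k_linear_hact [of K H] k_linear_lact [of K H A] k_linear_ract [of K H A]
  k_linear_pure_A [of K A H]
  mult_linear_left mult_linear_right comult_fun_linear antipode_fun_linear lift_fun_linear
  lift_arg_linear k_bilinearI k_trilinearI

text \<open>
  Meant as conditional rewrite rules: in a multilinear expression every variable occurs exactly once,
  so the simplifier discharges linearity and closure side conditions by descending to it.
\<close>

lemmas lin = linear_rules closed_rules module_rules

lemma hact_lact_apply:
  assumes V: "h_bimodule K H A V" and T: "module K T" and h: "k_linear K V T h"
    and a: "\<xi> \<in> carrier H" "a \<in> carrier A" "v \<in> carrier V"
  shows "h (hact V \<xi> (lact V a v)) =
    tens_lift T (\<lambda>\<xi>1 \<xi>2. h (lact V (hact A \<xi>1 a) (hact V \<xi>2 v))) (comult H \<xi>)"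
  unfolding h_bimodule.hact_lact [OF V a]
  by (rule lift_apply [OF _ T _ h]) (simp_all add: lin V a)

lemma hact_ract_apply:
  assumes V: "h_bimodule K H A V" and T: "module K T" and h: "k_linear K V T h"
    and a: "\<xi> \<in> carrier H" "a \<in> carrier A" "v \<in> carrier V"
  shows "h (hact V \<xi> (ract V v a)) =
    tens_lift T (\<lambda>\<xi>1 \<xi>2. h (ract V (hact V \<xi>1 v) (hact A \<xi>2 a))) (comult H \<xi>)"
  unfolding h_bimodule.hact_ract [OF V a]
  by (rule lift_apply [OF _ T _ h]) (simp_all add: lin V a)

section \<open>The left H-module A-bimodule V \<otimes>_A W\<close>

context
  fixes V :: "('k, 'h, 'a, 'v, 'm1) hbimod_scheme" and W :: "('k, 'h, 'a, 'w, 'm2) hbimod_scheme"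
    and T :: "('k, 'h, 'a, ('v, 'w) tens) hbimod"
  assumes V: "h_bimodule K H A V" and W: "h_bimodule K H A W" and T_def: "T = tensor_A H A V W"
begin

abbreviation (input) vw_tensor (infixl "\<otimes>\<otimes>" 70) where "v \<otimes>\<otimes> w \<equiv> pure_A A V W v w"

lemma tensor_A_linear: "v \<in> carrier V \<Longrightarrow> k_linear K U W g \<Longrightarrow> k_linear K U T (\<lambda>x. v \<otimes>\<otimes> g x)"
    "w \<in> carrier W \<Longrightarrow> k_linear K U V g' \<Longrightarrow> k_linear K U T (\<lambda>x. g' x \<otimes>\<otimes> w)"
  and tensor_A_closed: "v \<in> carrier V \<Longrightarrow> w \<in> carrier W \<Longrightarrow> v \<otimes>\<otimes> w \<in> carrier T"
  and tensor_A_module: "module K T"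
  by (simp_all add: T_def lin V W)

lemmas tensor_A_rules = tensor_A_linear tensor_A_closed tensor_A_module lin V W
lemmas tensor_A_bal = pure_A_balanced [OF k_algebra_A V W]
lemmas tensor_A_ext = tensor_A_eqI [OF k_algebra_A V W, folded T_def]
lemmas tensor_A_ops_eq = tensor_A_ops [OF k_algebra_A V W, folded T_def]
lemmas tensor_A_lift_linear = tens_lift_A_linear [OF k_algebra_A V W, folded T_def]
lemmas tensor_A_lift_pure = tens_lift_A_pure [OF k_algebra_A V W]

text \<open>Both sides equal (\<xi>1 v)(\<xi>2 b) \<otimes> \<xi>3 w: the action rule on V or on W
  splits one leg further, and coassociativity with balancing over \<open>A\<close> matches the
  results. Hence the H-action descends to V \<otimes>_A W.\<close>

lemma hact_balanced:
  assumes x: "\<xi> \<in> carrier H" and vbw: "v \<in> carrier V" "b \<in> carrier A" "w \<in> carrier W"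
  shows "tens_lift T (\<lambda>\<xi>1 \<xi>2. hact V \<xi>1 (ract V v b) \<otimes>\<otimes> hact W \<xi>2 w) (comult H \<xi>) =
       tens_lift T (\<lambda>\<xi>1 \<xi>2. hact V \<xi>1 v \<otimes>\<otimes> hact W \<xi>2 (lact W b w)) (comult H \<xi>)"
proof -
  let ?f = "\<lambda>x y z. ract V (hact V x v) (hact A y b) \<otimes>\<otimes> hact W z w"
  have f: "k_trilinear K H H H T ?f"
    using vbw by (simp add: tensor_A_rules)
  have "tens_lift T (\<lambda>\<xi>1 \<xi>2. hact V \<xi>1 (ract V v b) \<otimes>\<otimes> hact W \<xi>2 w) (comult H \<xi>) =
    tens_lift T (\<lambda>x z. tens_lift T (\<lambda>u v'. ?f u v' z) (comult H x)) (comult H \<xi>)"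
    using vbw x
    by (intro lift_cong hact_ract_apply [OF V, where h = "\<lambda>t. t \<otimes>\<otimes> hact W _ w"])
       (simp_all add: tensor_A_rules)
  also have "\<dots> = tens_lift T (\<lambda>x z. tens_lift T (?f x) (comult H z)) (comult H \<xi>)"
    by (rule coassoc_lift [OF tensor_A_module f x])
  also have "\<dots> = tens_lift T (\<lambda>x z. tens_lift T
      (\<lambda>y z. hact V x v \<otimes>\<otimes> lact W (hact A y b) (hact W z w)) (comult H z)) (comult H \<xi>)"
    using vbw x by (intro lift_cong) (simp_all add: tensor_A_rules tensor_A_bal)
  also have "\<dots> = tens_lift T (\<lambda>\<xi>1 \<xi>2. hact V \<xi>1 v \<otimes>\<otimes> hact W \<xi>2 (lact W b w)) (comult H \<xi>)"
    using vbw x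
    by (intro lift_cong hact_lact_apply [OF W, where h = "\<lambda>t. hact V _ v \<otimes>\<otimes> t", symmetric])
       (simp_all add: tensor_A_rules)
  finally show ?thesis .
qed

lemma hact_tensor_A:
  assumes x: "\<xi> \<in> carrier H"
  shows "k_linear K T T (hact T \<xi>)"
    and "v \<in> carrier V \<Longrightarrow> w \<in> carrier W \<Longrightarrow>
      hact T \<xi> (v \<otimes>\<otimes> w) = tens_lift T (\<lambda>\<xi>1 \<xi>2. hact V \<xi>1 v \<otimes>\<otimes> hact W \<xi>2 w) (comult H \<xi>)"
proof -
  have b: "k_bilinear K V W T (\<lambda>v w. tens_lift T (\<lambda>\<xi>1 \<xi>2. hact V \<xi>1 v \<otimes>\<otimes> hact W \<xi>2 w) (comult H \<xi>))"
    using x by (simp add: tensor_A_rules)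
  show "k_linear K T T (hact T \<xi>)"
    unfolding tensor_A_ops_eq by (rule tensor_A_lift_linear [OF tensor_A_module b]) (rule hact_balanced [OF x])
  show "v \<in> carrier V \<Longrightarrow> w \<in> carrier W \<Longrightarrow>
      hact T \<xi> (v \<otimes>\<otimes> w) = tens_lift T (\<lambda>\<xi>1 \<xi>2. hact V \<xi>1 v \<otimes>\<otimes> hact W \<xi>2 w) (comult H \<xi>)"
    unfolding tensor_A_ops_eq by (rule tensor_A_lift_pure [OF tensor_A_module b]) (rule hact_balanced [OF x])
qed

lemma lact_tensor_A:
  assumes a: "a \<in> carrier A"
  shows "k_linear K T T (lact T a)"
    and "v \<in> carrier V \<Longrightarrow> w \<in> carrier W \<Longrightarrow> lact T a (v \<otimes>\<otimes> w) = lact V a v \<otimes>\<otimes> w"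
proof -
  have b: "k_bilinear K V W T (\<lambda>v w. lact V a v \<otimes>\<otimes> w)" using a by (simp add: tensor_A_rules)
  have c: "lact V a (ract V v b) \<otimes>\<otimes> w = lact V a v \<otimes>\<otimes> lact W b w"
    if "v \<in> carrier V" "b \<in> carrier A" "w \<in> carrier W" for v b w
    using that a by (simp add: tensor_A_rules tensor_A_bal [symmetric] h_bimodule.lact_ract [OF V])
  show "k_linear K T T (lact T a)"
    unfolding tensor_A_ops_eq by (rule tensor_A_lift_linear [OF tensor_A_module b]) (rule c)
  show "v \<in> carrier V \<Longrightarrow> w \<in> carrier W \<Longrightarrow> lact T a (v \<otimes>\<otimes> w) = lact V a v \<otimes>\<otimes> w"
    unfolding tensor_A_ops_eq by (rule tensor_A_lift_pure [OF tensor_A_module b]) (rule c)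
qed

lemma ract_tensor_A:
  assumes a: "a \<in> carrier A"
  shows "k_linear K T T (\<lambda>X. ract T X a)"
    and "v \<in> carrier V \<Longrightarrow> w \<in> carrier W \<Longrightarrow> ract T (v \<otimes>\<otimes> w) a = v \<otimes>\<otimes> ract W w a"
proof -
  have b: "k_bilinear K V W T (\<lambda>v w. v \<otimes>\<otimes> ract W w a)" using a by (simp add: tensor_A_rules)
  have c: "ract V v b \<otimes>\<otimes> ract W w a = v \<otimes>\<otimes> ract W (lact W b w) a"
    if "v \<in> carrier V" "b \<in> carrier A" "w \<in> carrier W" for v b w
    using that a by (simp add: tensor_A_rules tensor_A_bal h_bimodule.lact_ract [OF W])
  show "k_linear K T T (\<lambda>X. ract T X a)"
    unfolding tensor_A_ops_eq by (rule tensor_A_lift_linear [OF tensor_A_module b]) (rule c)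
  show "v \<in> carrier V \<Longrightarrow> w \<in> carrier W \<Longrightarrow> ract T (v \<otimes>\<otimes> w) a = v \<otimes>\<otimes> ract W w a"
    unfolding tensor_A_ops_eq by (rule tensor_A_lift_pure [OF tensor_A_module b]) (rule c)
qed

lemmas act_tensor_A_pure = hact_tensor_A(2) lact_tensor_A(2) ract_tensor_A(2)

lemma hact_tensor_A_apply:
  assumes "module K U" "k_linear K T U h" "\<xi> \<in> carrier H" "v \<in> carrier V" "w \<in> carrier W"
  shows "h (hact T \<xi> (v \<otimes>\<otimes> w)) = tens_lift U (\<lambda>\<xi>1 \<xi>2. h (hact V \<xi>1 v \<otimes>\<otimes> hact W \<xi>2 w)) (comult H \<xi>)"
  unfolding hact_tensor_A(2) [OF assms(3-5)]
  by (rule lift_apply [OF tensor_A_module assms(1) _ assms(2)]) (simp_all add: tensor_A_rules assms)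

lemma hact_tensor_A_linear: "v \<in> carrier V \<Longrightarrow> w \<in> carrier W \<Longrightarrow> k_linear K H T (\<lambda>\<xi>. hact T \<xi> (v \<otimes>\<otimes> w))"
  by (subst k_linear_cong [OF module_H hact_tensor_A(2)]) (simp_all add: tensor_A_rules comult_linear)

lemmas act_rules = hact_tensor_A(1) lact_tensor_A(1) ract_tensor_A(1) hact_tensor_A(1) [THEN k_linear_comp] lact_tensor_A(1) [THEN k_linear_comp]
  ract_tensor_A(1) [THEN k_linear_comp]
  hact_tensor_A(1) [THEN k_linearD(1)] lact_tensor_A(1) [THEN k_linearD(1)] ract_tensor_A(1) [THEN k_linearD(1)]
  k_linear_add [OF tensor_A_module] k_linear_smult [OF tensor_A_module]

text \<open>Multiplicativity of \<Delta> gives two independent sums. They are exchanged so that the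
  sum over \<xi> is the inner one and can be read as an action on a pure tensor.\<close>

lemma hact_tensor_A_mult:
  assumes x: "\<xi> \<in> carrier H" "\<eta> \<in> carrier H" and vw: "v \<in> carrier V" "w \<in> carrier W"
  shows "hact T (\<xi> \<otimes> \<eta>) (v \<otimes>\<otimes> w) = hact T \<xi> (hact T \<eta> (v \<otimes>\<otimes> w))"
proof -
  have "hact T (\<xi> \<otimes> \<eta>) (v \<otimes>\<otimes> w) = tens_lift T (\<lambda>x y. tens_lift T (\<lambda>x' y'.
      hact V (x \<otimes> x') v \<otimes>\<otimes> hact W (y \<otimes> y') w) (comult H \<eta>)) (comult H \<xi>)"
    unfolding hact_tensor_A(2) [OF m_closed [OF x] vw]
    by (rule comult_mult_lift [OF tensor_A_module _ x]) (simp add: tensor_A_rules vw)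
  also have "\<dots> = tens_lift T (\<lambda>x y. tens_lift T (\<lambda>x' y'.
      hact V x (hact V x' v) \<otimes>\<otimes> hact W y (hact W y' w)) (comult H \<eta>)) (comult H \<xi>)"
    using x vw by (intro lift_cong)
      (simp_all add: tensor_A_rules h_module.hact_mult [of K H V] h_module.hact_mult [of K H W])
  also have "\<dots> = tens_lift T (\<lambda>x' y'. tens_lift T (\<lambda>x y.
      hact V x (hact V x' v) \<otimes>\<otimes> hact W y (hact W y' w)) (comult H \<xi>)) (comult H \<eta>)"
    using x vw by (intro lift_swap) (simp_all add: tensor_A_rules)
  also have "\<dots> = tens_lift T (\<lambda>x' y'. hact T \<xi> (hact V x' v \<otimes>\<otimes> hact W y' w)) (comult H \<eta>)"
    using x vw by (intro lift_cong) (simp_all add: tensor_A_rules act_tensor_A_pure)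
  also have "\<dots> = hact T \<xi> (hact T \<eta> (v \<otimes>\<otimes> w))"
    using x vw by (intro hact_tensor_A_apply [symmetric]) (simp_all add: tensor_A_rules hact_tensor_A)
  finally show ?thesis .
qed

text \<open>Both sides are (\<xi>1 a)(\<xi>2 v) \<otimes> \<xi>3 w, with the coproduct iterated on
  different legs; coassociativity connects them.\<close>

lemma hact_lact_tensor_A:
  assumes x: "\<xi> \<in> carrier H" and a: "a \<in> carrier A" and vw: "v \<in> carrier V" "w \<in> carrier W"
  shows "hact T \<xi> (lact T a (v \<otimes>\<otimes> w)) =
    tens_lift T (\<lambda>\<xi>1 \<xi>2. lact T (hact A \<xi>1 a) (hact T \<xi>2 (v \<otimes>\<otimes> w))) (comult H \<xi>)"
proof -
  let ?f = "\<lambda>x y z. lact V (hact A x a) (hact V y v) \<otimes>\<otimes> hact W z w"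
  have f: "k_trilinear K H H H T ?f"
    using vw a by (simp add: tensor_A_rules)
  have "hact T \<xi> (lact T a (v \<otimes>\<otimes> w)) = tens_lift T (\<lambda>x z. hact V x (lact V a v) \<otimes>\<otimes> hact W z w) (comult H \<xi>)"
    using x a vw by (simp add: act_tensor_A_pure tensor_A_rules)
  also have "\<dots> = tens_lift T (\<lambda>x z. tens_lift T (\<lambda>u v'. ?f u v' z) (comult H x)) (comult H \<xi>)"
    using vw x a
    by (intro lift_cong hact_lact_apply [OF V, where h = "\<lambda>t. t \<otimes>\<otimes> hact W _ w"])
       (simp_all add: tensor_A_rules)
  also have "\<dots> = tens_lift T (\<lambda>x z. tens_lift T (?f x) (comult H z)) (comult H \<xi>)"
    by (rule coassoc_lift [OF tensor_A_module f x])
  also have "\<dots> = tens_lift T (\<lambda>\<xi>1 \<xi>2. lact T (hact A \<xi>1 a) (hact T \<xi>2 (v \<otimes>\<otimes> w))) (comult H \<xi>)"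
  proof (rule lift_cong [OF tensor_A_module comult_closed [OF x]])
    fix x z assume xz: "x \<in> carrier H" "z \<in> carrier H"
    have "lact T (hact A x a) (hact T z (v \<otimes>\<otimes> w)) =
        tens_lift T (\<lambda>y z. lact T (hact A x a) (hact V y v \<otimes>\<otimes> hact W z w)) (comult H z)"
      using xz vw a by (intro hact_tensor_A_apply) (simp_all add: tensor_A_rules act_rules)
    also have "\<dots> = tens_lift T (?f x) (comult H z)"
      using xz vw a by (intro lift_cong) (simp_all add: tensor_A_rules lact_tensor_A)
    finally show "tens_lift T (?f x) (comult H z) = lact T (hact A x a) (hact T z (v \<otimes>\<otimes> w))" by simp
  qed (use a vw in \<open>simp add: tensor_A_rules act_rules\<close>)
  finally show ?thesis .
qed

lemma hact_ract_tensor_A: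
  assumes x: "\<xi> \<in> carrier H" and a: "a \<in> carrier A" and vw: "v \<in> carrier V" "w \<in> carrier W"
  shows "hact T \<xi> (ract T (v \<otimes>\<otimes> w) a) =
    tens_lift T (\<lambda>\<xi>1 \<xi>2. ract T (hact T \<xi>1 (v \<otimes>\<otimes> w)) (hact A \<xi>2 a)) (comult H \<xi>)"
proof -
  let ?f = "\<lambda>x y z. hact V x v \<otimes>\<otimes> ract W (hact W y w) (hact A z a)"
  have f: "k_trilinear K H H H T ?f"
    using vw a by (simp add: tensor_A_rules)
  have "hact T \<xi> (ract T (v \<otimes>\<otimes> w) a) = tens_lift T (\<lambda>x z. hact V x v \<otimes>\<otimes> hact W z (ract W w a)) (comult H \<xi>)"
    using x a vw by (simp add: act_tensor_A_pure tensor_A_rules)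
  also have "\<dots> = tens_lift T (\<lambda>x z. tens_lift T (?f x) (comult H z)) (comult H \<xi>)"
    using vw x a
    by (intro lift_cong hact_ract_apply [OF W, where h = "\<lambda>t. hact V _ v \<otimes>\<otimes> t"])
       (simp_all add: tensor_A_rules)
  also have "\<dots> = tens_lift T (\<lambda>x z. tens_lift T (\<lambda>u v'. ?f u v' z) (comult H x)) (comult H \<xi>)"
    by (rule coassoc_lift [OF tensor_A_module f x, symmetric])
  also have "\<dots> = tens_lift T (\<lambda>\<xi>1 \<xi>2. ract T (hact T \<xi>1 (v \<otimes>\<otimes> w)) (hact A \<xi>2 a)) (comult H \<xi>)"
  proof (rule lift_cong [OF tensor_A_module comult_closed [OF x]])
    fix x z assume xz: "x \<in> carrier H" "z \<in> carrier H"
    have "ract T (hact T x (v \<otimes>\<otimes> w)) (hact A z a) =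
        tens_lift T (\<lambda>u y. ract T (hact V u v \<otimes>\<otimes> hact W y w) (hact A z a)) (comult H x)"
      using xz vw a by (intro hact_tensor_A_apply [where h = "\<lambda>X. ract T X _"]) (simp_all add: tensor_A_rules act_rules)
    also have "\<dots> = tens_lift T (\<lambda>u y. ?f u y z) (comult H x)"
      using xz vw a by (intro lift_cong) (simp_all add: tensor_A_rules ract_tensor_A)
    finally show "tens_lift T (\<lambda>u y. ?f u y z) (comult H x) = ract T (hact T x (v \<otimes>\<otimes> w)) (hact A z a)" by simp
  qed (use a vw in \<open>simp add: tensor_A_rules act_rules\<close>)
  finally show ?thesis .
qed

lemma h_module_tensor_A: "h_module K H T"
proof (intro h_module.intro tensor_A_module h_module_axioms.intro)
  show "k_linear K T T (hact T \<xi>)" if "\<xi> \<in> carrier H" for \<xi> by (rule hact_tensor_A(1) [OF that])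
  show "hact T (\<xi> \<oplus> \<eta>) X = hact T \<xi> X \<oplus>\<^bsub>T\<^esub> hact T \<eta> X"
    if "\<xi> \<in> carrier H" "\<eta> \<in> carrier H" and X: "X \<in> carrier T" for \<xi> \<eta> X
    by (rule tensor_A_ext [where U = T, OF _ _ X])
       (use that in \<open>simp_all add: act_rules k_linearD(2) [OF hact_tensor_A_linear]\<close>)
  show "hact T (k \<odot> \<xi>) X = k \<odot>\<^bsub>T\<^esub> hact T \<xi> X"
    if "k \<in> carrier K" "\<xi> \<in> carrier H" and X: "X \<in> carrier T" for k \<xi> X
    by (rule tensor_A_ext [where U = T, OF _ _ X])
       (use that in \<open>simp_all add: act_rules k_linearD(3) [OF hact_tensor_A_linear]\<close>)
  show "hact T (\<xi> \<otimes> \<eta>) X = hact T \<xi> (hact T \<eta> X)"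
    if "\<xi> \<in> carrier H" "\<eta> \<in> carrier H" and X: "X \<in> carrier T" for \<xi> \<eta> X
    by (rule tensor_A_ext [where U = T, OF _ _ X]) (use that in \<open>simp_all add: act_rules hact_tensor_A_mult\<close>)
  show "hact T \<one> X = X" if X: "X \<in> carrier T" for X
  proof (rule tensor_A_ext [where U = T, OF _ _ X])
    fix v w assume vw: "v \<in> carrier V" "w \<in> carrier W"
    have "hact T \<one> (v \<otimes>\<otimes> w) = hact V \<one> v \<otimes>\<otimes> hact W \<one> w"
      unfolding hact_tensor_A(2) [OF one_closed vw]
      by (rule comult_one_lift [OF tensor_A_module]) (simp add: tensor_A_rules vw)
    then show "hact T \<one> (v \<otimes>\<otimes> w) = v \<otimes>\<otimes> w"
      using vw by (simp add: tensor_A_rules h_module.hact_one [of K H V] h_module.hact_one [of K H W])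
  qed (simp_all add: act_rules k_linear_ident)
qed

lemma lact_tensor_A_bilinear: "k_bilinear K A T T (lact T)"
proof (intro k_bilinearI k_linearI)
  fix a b X
  assume X: "X \<in> carrier T" and a: "a \<in> carrier A"
  show "lact T a X \<in> carrier T" using a X by (simp add: act_rules)
  note eq = tensor_A_ext [where U = T, OF _ _ X]
  note l = k_linear_lact(1) [OF V k_linear_ident] tensor_A_linear(2) [OF _ k_linear_ident]
  show "lact T (k \<odot>\<^bsub>A\<^esub> a) X = k \<odot>\<^bsub>T\<^esub> lact T a X" if "k \<in> carrier K" for k
    by (rule eq) (use that a in \<open>simp_all add: act_rules tensor_A_rules act_tensor_A_pure l [THEN k_linearD(3)]\<close>)
  show "lact T (a \<oplus>\<^bsub>A\<^esub> b) X = lact T a X \<oplus>\<^bsub>T\<^esub> lact T b X" if "b \<in> carrier A"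
    by (rule eq) (use that a in \<open>simp_all add: act_rules tensor_A_rules act_tensor_A_pure l [THEN k_linearD(2)]\<close>)
qed (simp_all add: act_rules lact_tensor_A(1) [THEN k_linearD(2)] lact_tensor_A(1) [THEN k_linearD(3)])

lemma ract_tensor_A_bilinear: "k_bilinear K T A T (ract T)"
proof (intro k_bilinearI k_linearI)
  fix a b X
  assume X: "X \<in> carrier T" and a: "a \<in> carrier A"
  show "ract T X a \<in> carrier T" using a X by (simp add: act_rules)
  note eq = tensor_A_ext [where U = T, OF _ _ X]
  note l = k_linear_ract(2) [OF W k_linear_ident] tensor_A_linear(1) [OF _ k_linear_ident]
  show "ract T X (k \<odot>\<^bsub>A\<^esub> a) = k \<odot>\<^bsub>T\<^esub> ract T X a" if "k \<in> carrier K" for k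
    by (rule eq) (use that a in \<open>simp_all add: act_rules tensor_A_rules act_tensor_A_pure l [THEN k_linearD(3)]\<close>)
  show "ract T X (a \<oplus>\<^bsub>A\<^esub> b) = ract T X a \<oplus>\<^bsub>T\<^esub> ract T X b" if "b \<in> carrier A"
    by (rule eq) (use that a in \<open>simp_all add: act_rules tensor_A_rules act_tensor_A_pure l [THEN k_linearD(2)]\<close>)
qed (simp_all add: act_rules ract_tensor_A(1) [THEN k_linearD(2)] ract_tensor_A(1) [THEN k_linearD(3)])

lemmas act_rules2 = k_bilinear_left [OF lact_tensor_A_bilinear] k_bilinear_left [OF hact_bilinear [OF h_module_tensor_A]]
  k_bilinear_right [OF ract_tensor_A_bilinear] act_rules

text \<open>All laws are additive in \<open>X\<close> and hold on pure tensors. Keeping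
  \<open>T\<close> opaque behind \<open>T_def\<close> lets iterated tensor products be treated as
  atomic bimodules afterwards.\<close>

lemma h_bimodule_tensor_A_eq: "h_bimodule K H A T"
proof (intro h_bimodule.intro h_module_tensor_A h_bimodule_axioms.intro)
  fix a b \<xi> X
  assume a: "a \<in> carrier A"
  show "k_linear K T T (lact T a)" by (rule lact_tensor_A(1) [OF a])
  show "k_linear K T T (\<lambda>X. ract T X a)" by (rule ract_tensor_A(1) [OF a])
  assume X: "X \<in> carrier T"
  note eq = tensor_A_ext [where U = T, OF _ _ X]
  show "lact T (k \<odot>\<^bsub>A\<^esub> a) X = k \<odot>\<^bsub>T\<^esub> lact T a X" if "k \<in> carrier K" for k
    by (rule k_linearD(3) [OF k_bilinearD(2) [OF lact_tensor_A_bilinear X] that a])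
  show "ract T X (k \<odot>\<^bsub>A\<^esub> a) = k \<odot>\<^bsub>T\<^esub> ract T X a" if "k \<in> carrier K" for k
    by (rule k_linearD(3) [OF k_bilinearD(1) [OF ract_tensor_A_bilinear X] that a])
  show "hact T \<xi> (lact T a X) = tens_lift T (\<lambda>\<xi>1 \<xi>2. lact T (hact A \<xi>1 a) (hact T \<xi>2 X)) (comult H \<xi>)"
    if "\<xi> \<in> carrier H"
    by (rule eq) (use that a in \<open>simp_all add: hact_lact_tensor_A act_rules2 tensor_A_rules\<close>)
  show "hact T \<xi> (ract T X a) = tens_lift T (\<lambda>\<xi>1 \<xi>2. ract T (hact T \<xi>1 X) (hact A \<xi>2 a)) (comult H \<xi>)"
    if "\<xi> \<in> carrier H"
    by (rule eq) (use that a in \<open>simp_all add: hact_ract_tensor_A act_rules2 tensor_A_rules\<close>)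
  assume b: "b \<in> carrier A"
  show "lact T (a \<oplus>\<^bsub>A\<^esub> b) X = lact T a X \<oplus>\<^bsub>T\<^esub> lact T b X"
    by (rule k_linearD(2) [OF k_bilinearD(2) [OF lact_tensor_A_bilinear X] a b])
  show "ract T X (a \<oplus>\<^bsub>A\<^esub> b) = ract T X a \<oplus>\<^bsub>T\<^esub> ract T X b"
    by (rule k_linearD(2) [OF k_bilinearD(1) [OF ract_tensor_A_bilinear X] a b])
  show "lact T (a \<otimes>\<^bsub>A\<^esub> b) X = lact T a (lact T b X)"
    by (rule eq) (use a b in \<open>simp_all add: act_rules tensor_A_rules act_tensor_A_pure h_bimodule.lact_mult [OF V]\<close>)
  show "ract T X (a \<otimes>\<^bsub>A\<^esub> b) = ract T (ract T X a) b"
    by (rule eq) (use a b in \<open>simp_all add: act_rules tensor_A_rules act_tensor_A_pure h_bimodule.ract_mult [OF W]\<close>)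
  show "ract T (lact T a X) b = lact T a (ract T X b)"
    by (rule eq) (use a b in \<open>simp_all add: act_rules tensor_A_rules act_tensor_A_pure\<close>)
next
  fix X assume X: "X \<in> carrier T"
  note eq = tensor_A_ext [where U = T, OF _ _ X]
  show "lact T \<one>\<^bsub>A\<^esub> X = X"
    by (rule eq) (simp_all add: act_rules tensor_A_rules act_tensor_A_pure h_bimodule.lact_one [OF V])
  show "ract T X \<one>\<^bsub>A\<^esub> = X"
    by (rule eq) (simp_all add: act_rules tensor_A_rules act_tensor_A_pure h_bimodule.ract_one [OF W])
qed

end

end

section \<open>The R-matrix on modules and quasi-commutativity\<close>

locale quasitriangular_module_algebra = quasitriangular K H R + hopf_module_algebra K H A
  for K and H :: "('k, 'h, 'p) hopf_scheme" (structure) and R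
    and A :: "('k, 'h, 'a, 'n) hmod_scheme"
begin

lemmas linR = lin R_closed R'_closed

text \<open>Acting on M \<otimes> N with R and then with R' is acting with R'R = 1, and likewise in
  the other order. The outer sum acts first, so the sums are swapped before the product is
  formed.\<close>

lemma act_R_R':
  assumes M: "h_module K H M" and N: "h_module K H N" and T: "module K T"
    and f: "k_bilinear K M N T f" and mn: "m \<in> carrier M" "n \<in> carrier N"
  shows "tens_lift T (\<lambda>r s. tens_lift T (\<lambda>r' s'. f (hact M r' (hact M r m)) (hact N s' (hact N s n))) R') R = f m n"
    and "tens_lift T (\<lambda>r s. tens_lift T (\<lambda>r' s'. f (hact M r' (hact M r m)) (hact N s' (hact N s n))) R) R' = f m n"
proof -
  let ?g = "\<lambda>x y. f (hact M x m) (hact N y n)"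
  note rules = linR M N T mn k_bilinear_left [OF f] k_bilinear_right [OF f] k_bilinear_closed [OF f]
  have g: "k_bilinear K H H T ?g" by (simp add: rules)
  have *: "tens_lift T (\<lambda>r s. tens_lift T (\<lambda>r' s'. f (hact M r' (hact M r m)) (hact N s' (hact N s n))) X) Y = f m n"
    if XY: "X \<in> carrier (tensor2 K H)" "Y \<in> carrier (tensor2 K H)"
      and eq: "tens_lift T (\<lambda>r s. tens_lift T (\<lambda>r' s'. ?g (r \<otimes> r') (s \<otimes> s')) Y) X = ?g \<one> \<one>" for X Y
  proof -
    have "tens_lift T (\<lambda>r s. tens_lift T (\<lambda>r' s'. f (hact M r' (hact M r m)) (hact N s' (hact N s n))) X) Y =
      tens_lift T (\<lambda>r' s'. tens_lift T (\<lambda>r s. f (hact M r' (hact M r m)) (hact N s' (hact N s n))) Y) X"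
      by (rule lift_swap [OF T XY(2,1)]) (simp_all add: rules)
    also have "\<dots> = tens_lift T (\<lambda>r s. tens_lift T (\<lambda>r' s'. ?g (r \<otimes> r') (s \<otimes> s')) Y) X"
      by (intro lift_cong) (simp_all add: rules XY h_module.hact_mult [OF M] h_module.hact_mult [OF N])
    finally show ?thesis
      unfolding eq using mn by (simp add: h_module.hact_one [OF M] h_module.hact_one [OF N])
  qed
  show "tens_lift T (\<lambda>r s. tens_lift T (\<lambda>r' s'. f (hact M r' (hact M r m)) (hact N s' (hact N s n))) R') R = f m n"
    by (rule * [OF R'_closed R_closed R_R'_lift(2) [OF T g]])
  show "tens_lift T (\<lambda>r s. tens_lift T (\<lambda>r' s'. f (hact M r' (hact M r m)) (hact N s' (hact N s n))) R) R' = f m n"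
    by (rule * [OF R_closed R'_closed R_R'_lift(1) [OF T g]])
qed

lemma ract_quasi_commutative:
  assumes "quasi_commutative K H R A V" "v \<in> carrier V" "a \<in> carrier A"
  shows "ract V v a = tens_lift V (\<lambda>r s. lact V (hact A r a) (hact V s v)) R'"
  using assms by (simp add: quasi_commutative_def)

text \<open>Expanding each right action by quasi-commutativity leaves R' acting after R, and the two
  cancel. The element is thus moved to the right with R, whose legs are distributed as in the
  inverse braiding.\<close>

lemma lact_quasi_commutative:
  assumes V: "h_bimodule K H A V" and q: "quasi_commutative K H R A V" and va: "v \<in> carrier V" "a \<in> carrier A"
  shows "lact V a v = tens_lift V (\<lambda>r s. ract V (hact V s v) (hact A r a)) R"
proof -
  have "lact V a v = tens_lift V (\<lambda>r s. tens_lift V (\<lambda>r' s'.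
      lact V (hact A r' (hact A r a)) (hact V s' (hact V s v))) R') R"
    by (rule act_R_R'(1) [symmetric]) (simp_all add: lin V va lact_bilinear [OF V])
  also have "\<dots> = tens_lift V (\<lambda>r s. ract V (hact V s v) (hact A r a)) R"
    by (intro lift_cong) (simp_all add: linR V va ract_quasi_commutative [OF q])
  finally show ?thesis .
qed

text \<open>The element a is moved to the left of w by one copy of R', across the tensor sign by
  balancing, and to the left of v by a second copy. The copies combine to R'_12 R'_13 = (id
  \<otimes> \<Delta>)(R'), which is R' acting on a and on v \<otimes> w.\<close>

lemma quasi_commutative_tensor_A:
  assumes V: "h_bimodule K H A V" and W: "h_bimodule K H A W"
    and qV: "quasi_commutative K H R A V" and qW: "quasi_commutative K H R A W"
  shows "quasi_commutative K H R A (tensor_A H A V W)"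
proof -
  define T where "T = tensor_A H A V W"
  note T = h_bimodule_tensor_A_eq [OF V W T_def]
  note rules = tensor_A_linear [OF V W T_def] tensor_A_closed [OF V W T_def] linR V W T
  note vw = ract_tensor_A [OF V W T_def] lact_tensor_A [OF V W T_def] hact_tensor_A [OF V W T_def]
  have "ract T X a = tens_lift T (\<lambda>r s. lact T (hact A r a) (hact T s X)) R'"
    if a: "a \<in> carrier A" and X: "X \<in> carrier T" for a X
  proof (rule tensor_A_ext [OF V W T_def _ _ X])
    show "k_linear K T T (\<lambda>X. ract T X a)" "k_linear K T T (\<lambda>X. tens_lift T (\<lambda>r s. lact T (hact A r a) (hact T s X)) R')"
      by (simp_all add: rules a)
    fix v w assume v: "v \<in> carrier V" and w: "w \<in> carrier W"
    let ?p = "pure_A A V W"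
    let ?f = "\<lambda>x y z. ?p (lact V (hact A x a) (hact V y v)) (hact W z w)"
    have f: "k_trilinear K H H H T ?f" by (simp add: rules v w a)
    have "ract T (?p v w) a = ?p v (tens_lift W (\<lambda>r s. lact W (hact A r a) (hact W s w)) R')"
      by (simp add: vw v w a ract_quasi_commutative [OF qW])
    also have "\<dots> = tens_lift T (\<lambda>r s. ?p v (lact W (hact A r a) (hact W s w))) R'"
      by (rule lift_apply [where h = "?p v"]) (simp_all add: rules v w a)
    also have "\<dots> = tens_lift T (\<lambda>r s. ?p (ract V v (hact A r a)) (hact W s w)) R'"
      by (intro lift_cong) (simp_all add: rules v w a pure_A_balanced [OF k_algebra_A V W])
    also have "\<dots> = tens_lift T (\<lambda>r s. tens_lift T (\<lambda>r' s'. ?f (r' \<otimes> r) s' s) R') R'"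
    proof (rule lift_cong)
      fix r s assume rs: "r \<in> carrier H" "s \<in> carrier H"
      have "?p (ract V v (hact A r a)) (hact W s w) =
        ?p (tens_lift V (\<lambda>r' s'. lact V (hact A r' (hact A r a)) (hact V s' v)) R') (hact W s w)"
        using rs by (simp add: rules v w a ract_quasi_commutative [OF qV])
      also have "\<dots> = tens_lift T (\<lambda>r' s'. ?p (lact V (hact A r' (hact A r a)) (hact V s' v)) (hact W s w)) R'"
        by (rule lift_apply [where h = "\<lambda>t. ?p t _"]) (simp_all add: rules rs v w a)
      also have "\<dots> = tens_lift T (\<lambda>r' s'. ?f (r' \<otimes> r) s' s) R'"
        by (intro lift_cong) (simp_all add: rules rs v w a A.hact_mult)
      finally show "?p (ract V v (hact A r a)) (hact W s w) = tens_lift T (\<lambda>r' s'. ?f (r' \<otimes> r) s' s) R'" .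
    qed (simp_all add: rules v w a)
    also have "\<dots> = tens_lift T (\<lambda>r s. tens_lift T (\<lambda>r' s'. ?f (r \<otimes> r') s s') R') R'"
      by (rule lift_swap) (simp_all add: rules v w a)
    also have "\<dots> = tens_lift T (\<lambda>r s. tens_lift T (?f r) (comult H s)) R'"
      by (rule hex2'_lift [OF _ f, symmetric]) (simp add: rules)
    also have "\<dots> = tens_lift T (\<lambda>r s. lact T (hact A r a) (hact T s (?p v w))) R'"
    proof (rule lift_cong)
      fix r s assume rs: "r \<in> carrier H" "s \<in> carrier H"
      have "lact T (hact A r a) (hact T s (?p v w)) =
        tens_lift T (\<lambda>x y. lact T (hact A r a) (?p (hact V x v) (hact W y w))) (comult H s)"
        by (rule hact_tensor_A_apply [OF V W T_def]) (simp_all add: rules rs v w a)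
      also have "\<dots> = tens_lift T (?f r) (comult H s)"
        by (intro lift_cong) (simp_all add: rules rs v w a vw)
      finally show "tens_lift T (?f r) (comult H s) = lact T (hact A r a) (hact T s (?p v w))" by simp
    qed (simp_all add: rules v w a)
    finally show "ract T (?p v w) a = tens_lift T (\<lambda>r s. lact T (hact A r a) (hact T s (?p v w))) R'" .
  qed
  then show ?thesis by (simp add: quasi_commutative_def T_def)
qed

end

section \<open>Identities for the antipode\<close>

context hopf_algebra
begin

text \<open>Insert \<eta> = \<eta>1 \<epsilon>(\<eta>2) and then \<epsilon>(\<eta>2) = \<eta>2
  S(\<eta>3). In S(\<xi>1 \<eta>1) \<xi>2 \<eta>2 S(\<eta>3) the first three factors are the
  antipode axiom for a product of \<xi> with a leg of \<eta>, and \<epsilon>(\<xi>) S(\<eta>) is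
  left.\<close>

lemma antipode_mult_left_lift:
  assumes T: "module K T" and f: "k_linear K H T f" and x: "\<xi> \<in> carrier H" "\<eta> \<in> carrier H"
  shows "tens_lift T (\<lambda>x y. f (antipode H (x \<otimes> \<eta>) \<otimes> y)) (comult H \<xi>) = counit H \<xi> \<odot>\<^bsub>T\<^esub> f (antipode H \<eta>)"
proof -
  note rules = k_linear_ident mult_linear_left mult_linear_right comult_fun_linear antipode_fun_linear lift_fun_linear
    lift_arg_linear k_bilinearI k_trilinearI module_H T lift_closed comult_closed antipode_closed k_linearD(1) [OF f]
    k_linear_comp [OF f] x
  interpret T: module K T by (rule T)
  \<comment> \<open>The arguments stand for \<eta>1, \<eta>2, \<eta>3. The bracketing S(\<xi>1
    \<eta>1)(\<xi>2 (\<eta>2 S(\<eta>3))) keeps \<eta>2 S(\<eta>3) together, where it replaces a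
    counit.\<close>
  let ?f = "\<lambda>p q1 q2. tens_lift T (\<lambda>x y. f (antipode H (x \<otimes> p) \<otimes> (y \<otimes> (q1 \<otimes> antipode H q2)))) (comult H \<xi>)"
  let ?g = "\<lambda>p. tens_lift T (\<lambda>x y. f (antipode H (x \<otimes> p) \<otimes> y)) (comult H \<xi>)"
  have t: "k_trilinear K H H H T ?f" by (simp add: rules)
  have g: "k_linear K H T ?g" by (simp add: rules)
  have gc: "?g p \<in> carrier T" if "p \<in> carrier H" for p using that by (simp add: rules)
  have "?g \<eta> = tens_lift T (\<lambda>p q. counit H q \<odot>\<^bsub>T\<^esub> ?g p) (comult H \<eta>)"
    by (rule counit_right_lift [OF T g x(2), symmetric])
  also have "\<dots> = tens_lift T (\<lambda>p q. tens_lift T (?f p) (comult H q)) (comult H \<eta>)"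
  proof (rule lift_cong)
    fix p q assume pq: "p \<in> carrier H" "q \<in> carrier H"
    let ?h = "\<lambda>z. tens_lift T (\<lambda>x y. f (antipode H (x \<otimes> p) \<otimes> (y \<otimes> z))) (comult H \<xi>)"
    have "tens_lift T (?f p) (comult H q) = counit H q \<odot>\<^bsub>T\<^esub> ?h \<one>"
      by (rule antipode_right_lift [OF T, where f = ?h]) (simp_all add: rules pq)
    also have "?h \<one> = ?g p" by (intro lift_cong) (simp_all add: rules pq)
    finally show "counit H q \<odot>\<^bsub>T\<^esub> ?g p = tens_lift T (?f p) (comult H q)" by simp
  qed (simp_all add: rules)
  also have "\<dots> = tens_lift T (\<lambda>p q. tens_lift T (\<lambda>u v. ?f u v q) (comult H p)) (comult H \<eta>)"
    by (rule coassoc_lift [OF T t x(2), symmetric])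
  also have "\<dots> = tens_lift T (\<lambda>p q. counit H p \<odot>\<^bsub>T\<^esub> (counit H \<xi> \<odot>\<^bsub>T\<^esub> f (antipode H q))) (comult H \<eta>)"
  proof (rule lift_cong)
    fix p q assume pq: "p \<in> carrier H" "q \<in> carrier H"
    let ?h = "\<lambda>y z. f (antipode H y \<otimes> z \<otimes> antipode H q)"
    have "tens_lift T (\<lambda>u v. ?f u v q) (comult H p) =
      tens_lift T (\<lambda>x y. tens_lift T (\<lambda>u v. ?h (x \<otimes> u) (y \<otimes> v)) (comult H p)) (comult H \<xi>)"
      by (subst lift_swap) (auto intro!: lift_cong simp: rules pq m_assoc)
    also have "\<dots> = tens_lift T ?h (comult H (\<xi> \<otimes> p))"
      by (rule comult_mult_lift [OF T _ x(1) pq(1), symmetric]) (simp add: rules pq)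
    also have "\<dots> = counit H (\<xi> \<otimes> p) \<odot>\<^bsub>T\<^esub> f (\<one> \<otimes> antipode H q)"
      by (rule antipode_left_lift [OF T, where f = "\<lambda>z. f (z \<otimes> antipode H q)"]) (simp_all add: rules pq)
    also have "\<dots> = counit H p \<odot>\<^bsub>T\<^esub> (counit H \<xi> \<odot>\<^bsub>T\<^esub> f (antipode H q))"
      by (simp add: rules pq counit_mult counit_closed R.m_comm flip: T.smult_assoc1)
    finally show "tens_lift T (\<lambda>u v. ?f u v q) (comult H p) = \<dots>" .
  qed (simp_all add: rules counit_closed)
  also have "\<dots> = counit H \<xi> \<odot>\<^bsub>T\<^esub> f (antipode H \<eta>)"
    by (rule counit_left_lift [OF T, where f = "\<lambda>q. counit H \<xi> \<odot>\<^bsub>T\<^esub> f (antipode H q)"])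
       (simp_all add: rules counit_closed k_linear_smult)
  finally show ?thesis .
qed

lemma antipode_one: "antipode H \<one> = \<one>"
proof -
  have "tens_lift H (\<lambda>y z. antipode H y \<otimes> z) (comult H \<one>) = antipode H \<one> \<otimes> \<one>"
    by (rule comult_one_lift [OF module_H])
       (simp add: k_bilinearI mult_linear_left mult_linear_right antipode_linear k_linear_ident antipode_closed)
  then show ?thesis by (simp add: antipode_left counit_one antipode_closed)
qed

end

context hopf_module_algebra
begin

text \<open>
  A trilinear \<open>F\<close> is determined by \<open>F(\<xi>\<^sub>1; \<xi>\<^sub>2 m, \<xi>\<^sub>3 n)\<close>: replace \<open>\<xi> \<otimes> m \<otimes> n\<close> by
  \<open>\<xi>\<^sub>1 \<otimes> S(\<xi>\<^sub>2)(m \<otimes> n)\<close>.  This makes compatibility of the antipode with the coproduct unnecessary.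
\<close>

lemma trilinear_recover:
  assumes M: "h_module K H M" and N: "h_module K H N" and T: "module K T"
    and F: "k_trilinear K H M N T F" and x: "\<xi> \<in> carrier H" and mn: "m \<in> carrier M" "n \<in> carrier N"
  shows "tens_lift T (\<lambda>x z. tens_lift T (\<lambda>s1 s2.
      tens_lift T (\<lambda>p q. tens_lift T (\<lambda>q1 q2. F p (hact M q1 (hact M s1 m)) (hact N q2 (hact N s2 n)))
      (comult H q)) (comult H x)) (comult H (antipode H z))) (comult H \<xi>) = F \<xi> m n"
proof -
  interpret T: module K T by (rule T)
  note Fl = k_trilinearD(1) [OF F, THEN k_linear_comp] k_trilinearD(2) [OF F, THEN k_linear_comp]
    k_trilinearD(3) [OF F, THEN k_linear_comp] k_trilinear_closed [OF F] k_trilinearD(3) [OF F]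
  note rules = lin Fl M N T x mn
  \<comment> \<open>\<open>?\<phi> p y\<close> is F at p, with y acting diagonally on the pair of m
    and n. The whole sum is \<open>?\<phi>\<close> at \<xi>1 and \<xi>2 S(\<xi>3), and \<xi>2
    S(\<xi>3) reduces to a counit.\<close>
  let ?\<phi> = "\<lambda>p y. tens_lift T (\<lambda>u v. F p (hact M u m) (hact N v n)) (comult H y)"
  have "tens_lift T (\<lambda>x z. tens_lift T (\<lambda>s1 s2.
      tens_lift T (\<lambda>p q. tens_lift T (\<lambda>q1 q2. F p (hact M q1 (hact M s1 m)) (hact N q2 (hact N s2 n)))
      (comult H q)) (comult H x)) (comult H (antipode H z))) (comult H \<xi>) =
    tens_lift T (\<lambda>x z. tens_lift T (\<lambda>p q. ?\<phi> p (q \<otimes> antipode H z)) (comult H x)) (comult H \<xi>)"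
  proof (rule lift_cong)
    fix y z assume yz: "y \<in> carrier H" "z \<in> carrier H"
    have "tens_lift T (\<lambda>s1 s2.
      tens_lift T (\<lambda>p q. tens_lift T (\<lambda>q1 q2. F p (hact M q1 (hact M s1 m)) (hact N q2 (hact N s2 n)))
      (comult H q)) (comult H y)) (comult H (antipode H z)) =
      tens_lift T (\<lambda>p q. tens_lift T (\<lambda>s1 s2.
        tens_lift T (\<lambda>q1 q2. F p (hact M q1 (hact M s1 m)) (hact N q2 (hact N s2 n)))
      (comult H q)) (comult H (antipode H z))) (comult H y)"
      by (rule lift_swap) (simp_all add: rules yz)
    also have "\<dots> = tens_lift T (\<lambda>p q. ?\<phi> p (q \<otimes> antipode H z)) (comult H y)"
    proof (rule lift_cong)
      fix p q assume pq: "p \<in> carrier H" "q \<in> carrier H"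
      have "?\<phi> p (q \<otimes> antipode H z) = tens_lift T (\<lambda>u v. tens_lift T (\<lambda>u' v'.
          F p (hact M (u \<otimes> u') m) (hact N (v \<otimes> v') n)) (comult H (antipode H z))) (comult H q)"
        by (rule comult_mult_lift) (simp_all add: rules pq yz)
      also have "\<dots> = tens_lift T (\<lambda>u v. tens_lift T (\<lambda>u' v'.
          F p (hact M u (hact M u' m)) (hact N v (hact N v' n))) (comult H (antipode H z))) (comult H q)"
        by (intro lift_cong) (simp_all add: rules pq yz h_module.hact_mult [OF M] h_module.hact_mult [OF N])
      also have "\<dots> = tens_lift T (\<lambda>s1 s2. tens_lift T (\<lambda>q1 q2.
          F p (hact M q1 (hact M s1 m)) (hact N q2 (hact N s2 n))) (comult H q)) (comult H (antipode H z))"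
        by (rule lift_swap) (simp_all add: rules pq yz)
      finally show "tens_lift T (\<lambda>s1 s2. tens_lift T (\<lambda>q1 q2.
          F p (hact M q1 (hact M s1 m)) (hact N q2 (hact N s2 n))) (comult H q)) (comult H (antipode H z)) =
        ?\<phi> p (q \<otimes> antipode H z)" by simp
    qed (simp_all add: rules yz)
    finally show "tens_lift T (\<lambda>s1 s2.
      tens_lift T (\<lambda>p q. tens_lift T (\<lambda>q1 q2. F p (hact M q1 (hact M s1 m)) (hact N q2 (hact N s2 n)))
      (comult H q)) (comult H y)) (comult H (antipode H z)) = \<dots>" .
  qed (simp_all add: rules)
  also have "\<dots> = tens_lift T (\<lambda>p t. tens_lift T (\<lambda>q z. ?\<phi> p (q \<otimes> antipode H z)) (comult H t)) (comult H \<xi>)"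
    by (rule coassoc_lift) (simp_all add: rules)
  also have "\<dots> = tens_lift T (\<lambda>p t. counit H t \<odot>\<^bsub>T\<^esub> F p m n) (comult H \<xi>)"
  proof (rule lift_cong)
    fix p t assume pt: "p \<in> carrier H" "t \<in> carrier H"
    have "tens_lift T (\<lambda>q z. ?\<phi> p (q \<otimes> antipode H z)) (comult H t) = counit H t \<odot>\<^bsub>T\<^esub> ?\<phi> p \<one>"
      by (rule antipode_right_lift [where f = "?\<phi> p"]) (simp_all add: rules pt)
    also have "?\<phi> p \<one> = F p (hact M \<one> m) (hact N \<one> n)"
      by (rule comult_one_lift) (simp_all add: rules pt)
    finally show "tens_lift T (\<lambda>q z. ?\<phi> p (q \<otimes> antipode H z)) (comult H t) = counit H t \<odot>\<^bsub>T\<^esub> F p m n"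
      using mn by (simp add: h_module.hact_one [OF M] h_module.hact_one [OF N])
  qed (simp_all add: rules counit_closed)
  also have "\<dots> = F \<xi> m n"
    by (rule counit_right_lift [where f = "\<lambda>p. F p m n"]) (simp_all add: rules)
  finally show ?thesis .
qed

text \<open>It suffices to compare after \<xi> has been spread over all three arguments. When
  \<open>F\<close> is built from \<xi> \<blacktriangleright> D, the spread sum collapses to \<xi>
  acting on a value of D, where the properties of a connection apply.\<close>

lemma trilinear_eqI:
  assumes M: "h_module K H M" and N: "h_module K H N" and T: "module K T"
    and F: "k_trilinear K H M N T F" and G: "k_trilinear K H M N T G"
    and eq: "\<And>\<xi> m n. \<xi> \<in> carrier H \<Longrightarrow> m \<in> carrier M \<Longrightarrow> n \<in> carrier N \<Longrightarrow>
      tens_lift T (\<lambda>p q. tens_lift T (\<lambda>q1 q2. F p (hact M q1 m) (hact N q2 n)) (comult H q)) (comult H \<xi>) =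
      tens_lift T (\<lambda>p q. tens_lift T (\<lambda>q1 q2. G p (hact M q1 m) (hact N q2 n)) (comult H q)) (comult H \<xi>)"
    and x: "\<xi> \<in> carrier H" and mn: "m \<in> carrier M" "n \<in> carrier N"
  shows "F \<xi> m n = G \<xi> m n"
proof -
  note Gl = k_trilinearD(1) [OF G, THEN k_linear_comp] k_trilinearD(2) [OF G, THEN k_linear_comp]
    k_trilinearD(3) [OF G, THEN k_linear_comp] k_trilinear_closed [OF G] k_trilinearD(3) [OF G]
  note rules = lin Gl M N T x mn
  show ?thesis
    unfolding trilinear_recover [OF M N T F x mn, symmetric] trilinear_recover [OF M N T G x mn, symmetric]
  proof (rule lift_cong)
    fix y z assume yz: "y \<in> carrier H" "z \<in> carrier H"
    show "tens_lift T (\<lambda>s1 s2. tens_lift T (\<lambda>p q. tens_lift T (\<lambda>q1 q2.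
          F p (hact M q1 (hact M s1 m)) (hact N q2 (hact N s2 n))) (comult H q)) (comult H y)) (comult H (antipode H z)) =
        tens_lift T (\<lambda>s1 s2. tens_lift T (\<lambda>p q. tens_lift T (\<lambda>q1 q2.
          G p (hact M q1 (hact M s1 m)) (hact N q2 (hact N s2 n))) (comult H q)) (comult H y)) (comult H (antipode H z))"
      by (rule lift_cong) (simp_all add: rules eq yz)
  qed (simp_all add: rules)
qed

section \<open>The \<open>H\<close>-action on linear maps\<close>

context
  fixes W :: "('k, 'h, 'w, 'm1) hmod_scheme" and P :: "('k, 'h, 'w1, 'm2) hmod_scheme" and D
  assumes W: "h_module K H W" and P: "h_module K H P" and D: "k_linear K W P D"
begin

lemma hom_act_bilinear: "k_bilinear K H W P (\<lambda>\<xi> w. hom_act H W P \<xi> D w)"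
  unfolding hom_act_def by (simp add: lin W P k_linear_comp [OF D] k_linearD(1) [OF D])

text \<open>Expanding the right side gives \<xi>1 \<eta>1 acting on D(S(\<xi>2 \<eta>2) \<xi>3 w).
  By \<open>antipode_mult_left_lift\<close>, S(\<xi>2 \<eta>2) \<xi>3 becomes \<epsilon>(\<xi>2)
  S(\<eta>2); absorbing the counit leaves \<xi>\<eta>1 acting on D(S(\<eta>2) w).\<close>

lemma hact_hom_act:
  assumes x: "\<xi> \<in> carrier H" "\<eta> \<in> carrier H" and w: "w \<in> carrier W"
  shows "hact P \<xi> (hom_act H W P \<eta> D w) =
    tens_lift P (\<lambda>x y. hom_act H W P (x \<otimes> \<eta>) D (hact W y w)) (comult H \<xi>)"
proof -
  interpret P: module K P by (rule h_module_imp_module [OF P])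
  note rules = lin W P k_linear_comp [OF D] k_linearD(1) [OF D] x w
  let ?f = "\<lambda>x y z. tens_lift P (\<lambda>u v. hact P (x \<otimes> u) (D (hact W (antipode H (y \<otimes> v) \<otimes> z) w))) (comult H \<eta>)"
  have "tens_lift P (\<lambda>x z. hom_act H W P (x \<otimes> \<eta>) D (hact W z w)) (comult H \<xi>) =
    tens_lift P (\<lambda>x z. tens_lift P (\<lambda>x y. ?f x y z) (comult H x)) (comult H \<xi>)"
  proof (rule lift_cong)
    fix y z assume yz: "y \<in> carrier H" "z \<in> carrier H"
    have "hom_act H W P (y \<otimes> \<eta>) D (hact W z w) =
      tens_lift P (\<lambda>x y. tens_lift P (\<lambda>u v. hact P (x \<otimes> u) (D (hact W (antipode H (y \<otimes> v)) (hact W z w))))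
        (comult H \<eta>)) (comult H y)"
      unfolding hom_act_def by (rule comult_mult_lift) (simp_all add: rules yz)
    also have "\<dots> = tens_lift P (\<lambda>x y. ?f x y z) (comult H y)"
      by (intro lift_cong) (simp_all add: rules yz h_module.hact_mult [OF W])
    finally show "hom_act H W P (y \<otimes> \<eta>) D (hact W z w) = tens_lift P (\<lambda>x y. ?f x y z) (comult H y)" .
  qed (simp_all add: rules)
  also have "\<dots> = tens_lift P (\<lambda>x z. tens_lift P (?f x) (comult H z)) (comult H \<xi>)"
    by (rule coassoc_lift) (simp_all add: rules)
  also have "\<dots> = tens_lift P (\<lambda>x z. counit H z \<odot>\<^bsub>P\<^esub>
      tens_lift P (\<lambda>u v. hact P (x \<otimes> u) (D (hact W (antipode H v) w))) (comult H \<eta>)) (comult H \<xi>)"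
  proof (rule lift_cong)
    fix y z assume yz: "y \<in> carrier H" "z \<in> carrier H"
    have "tens_lift P (?f y) (comult H z) =
      tens_lift P (\<lambda>u v. tens_lift P (\<lambda>x z. hact P (y \<otimes> u) (D (hact W (antipode H (x \<otimes> v) \<otimes> z) w)))
        (comult H z)) (comult H \<eta>)"
      by (rule lift_swap) (simp_all add: rules yz)
    also have "\<dots> = tens_lift P (\<lambda>u v. counit H z \<odot>\<^bsub>P\<^esub>
        hact P (y \<otimes> u) (D (hact W (antipode H v) w))) (comult H \<eta>)"
      by (intro lift_cong antipode_mult_left_lift [where f = "\<lambda>x. hact P (y \<otimes> _) (D (hact W x w))"])
         (simp_all add: rules yz counit_closed)
    also have "\<dots> = counit H z \<odot>\<^bsub>P\<^esub> tens_lift P (\<lambda>u v. hact P (y \<otimes> u) (D (hact W (antipode H v) w))) (comult H \<eta>)"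
      by (rule lift_smult) (simp_all add: rules yz counit_closed)
    finally show "tens_lift P (?f y) (comult H z) = \<dots>" .
  qed (simp_all add: rules counit_closed)
  also have "\<dots> = tens_lift P (\<lambda>u v. hact P (\<xi> \<otimes> u) (D (hact W (antipode H v) w))) (comult H \<eta>)"
    by (rule counit_right_lift [where f = "\<lambda>x. tens_lift P (\<lambda>u v. hact P (x \<otimes> u) (D (hact W (antipode H v) w))) (comult H \<eta>)"])
       (simp_all add: rules)
  also have "\<dots> = tens_lift P (\<lambda>u v. hact P \<xi> (hact P u (D (hact W (antipode H v) w)))) (comult H \<eta>)"
    by (intro lift_cong) (simp_all add: rules h_module.hact_mult [OF P])
  also have "\<dots> = hact P \<xi> (hom_act H W P \<eta> D w)"
    unfolding hom_act_def by (rule lift_apply [symmetric]) (simp_all add: rules)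
  finally show ?thesis by simp
qed

lemma hom_act_one: "w \<in> carrier W \<Longrightarrow> hom_act H W P \<one> D w = D w"
  unfolding hom_act_def
  by (subst comult_one_lift)
     (simp_all add: lin W P k_linear_comp [OF D] k_linearD(1) [OF D] antipode_one
       h_module.hact_one [OF W] h_module.hact_one [OF P])

text \<open>The case \<eta> = 1 of \<open>hact_hom_act\<close>. It converts between acting on values
  of D and acting on D itself, the passage on which both Leibniz rules rest.\<close>

lemma hact_hom:
  assumes x: "\<xi> \<in> carrier H" and w: "w \<in> carrier W"
  shows "hact P \<xi> (D w) = tens_lift P (\<lambda>x y. hom_act H W P x D (hact W y w)) (comult H \<xi>)"
proof -
  note bil = k_bilinear_left [OF hom_act_bilinear] k_bilinear_right [OF hom_act_bilinear] k_bilinear_closed [OF hom_act_bilinear]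
  have "hact P \<xi> (D w) = tens_lift P (\<lambda>x y. hom_act H W P (x \<otimes> \<one>) D (hact W y w)) (comult H \<xi>)"
    using hact_hom_act [OF x one_closed w] by (simp add: hom_act_one w)
  also have "\<dots> = tens_lift P (\<lambda>x y. hom_act H W P x D (hact W y w)) (comult H \<xi>)"
    by (intro lift_cong) (simp_all add: bil lin W P x w)
  finally show ?thesis .
qed

end

end

section \<open>Leibniz rules for a connection under the H-action\<close>

locale hom_connection = quasitriangular_module_algebra K H R A
  for K and H :: "('k, 'h, 'p) hopf_scheme" (structure) and R
    and A :: "('k, 'h, 'a, 'n) hmod_scheme" +
  fixes W :: "('k, 'h, 'a, 'w, 'm1) hbimod_scheme" and F :: "('k, 'h, 'a, 'o, 'm2) hbimod_scheme"
    and P :: "('k, 'h, 'a, ('w, 'o) tens) hbimod" and \<delta> :: "'a \<Rightarrow> 'o" and D :: "'w \<Rightarrow> ('w, 'o) tens"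
  assumes W: "h_bimodule K H A W" and F: "h_bimodule K H A F" and P_def: "P = tensor_A H A W F"
    and qW: "quasi_commutative K H R A W" and qF: "quasi_commutative K H R A F"
    and \<delta>: "k_linear K A F \<delta>"
    and hact_\<delta>: "\<And>\<xi> a. \<xi> \<in> carrier H \<Longrightarrow> a \<in> carrier A \<Longrightarrow> hact F \<xi> (\<delta> a) = \<delta> (hact A \<xi> a)"
    and D: "k_linear K W P D"
    and D_ract: "\<And>w a. w \<in> carrier W \<Longrightarrow> a \<in> carrier A \<Longrightarrow>
      D (ract W w a) = ract P (D w) a \<oplus>\<^bsub>P\<^esub> pure_A A W F w (\<delta> a)"
begin

lemma P: "h_bimodule K H A P" by (rule h_bimodule_tensor_A_eq [OF W F P_def])
lemma hP: "h_module K H P" by (rule h_bimodule_imp_h_module [OF P])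
lemma hW: "h_module K H W" by (rule h_bimodule_imp_h_module [OF W])
lemma mP: "module K P" by (rule h_bimodule_imp_module [OF P])

lemma qP: "quasi_commutative K H R A P"
  unfolding P_def by (rule quasi_commutative_tensor_A [OF W F qW qF])

abbreviation (input) hD where "hD \<equiv> \<lambda>\<xi> w. hom_act H W P \<xi> D w"
abbreviation (input) wf_tensor (infixl "\<otimes>\<otimes>" 70) where "w \<otimes>\<otimes> \<theta> \<equiv> pure_A A W F w \<theta>"

lemmas hD_bilinear = hom_act_bilinear [OF hW hP D]
lemmas linD = tensor_A_linear [OF W F P_def] tensor_A_closed [OF W F P_def] linR W F P mP
  k_bilinear_left [OF hD_bilinear] k_bilinear_right [OF hD_bilinear] k_bilinear_closed [OF hD_bilinear]
  k_linear_comp [OF \<delta>] k_linearD(1) [OF \<delta>] k_linear_comp [OF D] k_linearD(1) [OF D]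
  k_linear_add [OF mP] k_linear_smult [OF mP] counit_fun_linear counit_closed

lemma P_add_closed: "X \<in> carrier P \<Longrightarrow> Y \<in> carrier P \<Longrightarrow> X \<oplus>\<^bsub>P\<^esub> Y \<in> carrier P"
proof -
  interpret P: module K P by (rule mP)
  show "X \<in> carrier P \<Longrightarrow> Y \<in> carrier P \<Longrightarrow> X \<oplus>\<^bsub>P\<^esub> Y \<in> carrier P" by simp
qed

lemma P_smult_closed: "k \<in> carrier K \<Longrightarrow> X \<in> carrier P \<Longrightarrow> k \<odot>\<^bsub>P\<^esub> X \<in> carrier P"
  by (rule module.smult_closed [OF mP])

text \<open>Spread as in \<open>trilinear_eqI\<close>, the left side is \<xi> acting on D(wa), to
  which the Leibniz rule of D applies. The action on D(w)a is spread again by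
  \<open>hact_hom\<close>; the action on w \<otimes> da involves no D, and this is the origin of the
  factor \<epsilon>(\<xi>).\<close>

lemma hom_act_ract:
  assumes x: "\<xi> \<in> carrier H" and wa: "w \<in> carrier W" "a \<in> carrier A"
  shows "hD \<xi> (ract W w a) = ract P (hD \<xi> w) a \<oplus>\<^bsub>P\<^esub> counit H \<xi> \<odot>\<^bsub>P\<^esub> (w \<otimes>\<otimes> \<delta> a)"
proof (rule trilinear_eqI [OF hW h_module_A mP, where
      F = "\<lambda>\<xi> w a. hD \<xi> (ract W w a)" and G = "\<lambda>\<xi> w a. ract P (hD \<xi> w) a \<oplus>\<^bsub>P\<^esub> counit H \<xi> \<odot>\<^bsub>P\<^esub> (w \<otimes>\<otimes> \<delta> a)"])
  show "k_trilinear K H W A P (\<lambda>\<xi> w a. hD \<xi> (ract W w a))"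
    "k_trilinear K H W A P (\<lambda>\<xi> w a. ract P (hD \<xi> w) a \<oplus>\<^bsub>P\<^esub> counit H \<xi> \<odot>\<^bsub>P\<^esub> (w \<otimes>\<otimes> \<delta> a))"
    by (simp_all add: linD)
  fix \<xi> w a assume a: "\<xi> \<in> carrier H" "w \<in> carrier W" "a \<in> carrier A"
  note rules = linD a P_add_closed P_smult_closed
  have "tens_lift P (\<lambda>x z. tens_lift P (\<lambda>u v. hD x (ract W (hact W u w) (hact A v a))) (comult H z)) (comult H \<xi>) =
    tens_lift P (\<lambda>x z. hD x (hact W z (ract W w a))) (comult H \<xi>)"
    by (intro lift_cong hact_ract_apply [OF W, where h = "hD _", symmetric]) (simp_all add: rules)
  also have "\<dots> = hact P \<xi> (D (ract W w a))"
    by (rule hact_hom [OF hW hP D, symmetric]) (simp_all add: rules)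
  also have "\<dots> = hact P \<xi> (ract P (D w) a) \<oplus>\<^bsub>P\<^esub> hact P \<xi> (w \<otimes>\<otimes> \<delta> a)"
    by (simp add: D_ract a rules k_linearD(2) [OF k_bilinearD(1) [OF hact_bilinear [OF hP]]])
  also have "hact P \<xi> (ract P (D w) a) = tens_lift P (\<lambda>x z. ract P (hact P x (D w)) (hact A z a)) (comult H \<xi>)"
    by (rule hact_ract_apply [OF P, where h = "\<lambda>t. t"]) (simp_all add: rules)
  also have "\<dots> = tens_lift P (\<lambda>x z. tens_lift P (\<lambda>u v. ract P (hD u (hact W v w)) (hact A z a)) (comult H x)) (comult H \<xi>)"
  proof (rule lift_cong)
    fix x z assume xz: "x \<in> carrier H" "z \<in> carrier H"
    show "ract P (hact P x (D w)) (hact A z a) =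
        tens_lift P (\<lambda>u v. ract P (hD u (hact W v w)) (hact A z a)) (comult H x)"
      unfolding hact_hom [OF hW hP D xz(1) a(2)]
      by (rule lift_apply [where h = "\<lambda>t. ract P t _"]) (simp_all add: rules xz)
  qed (simp_all add: rules)
  also have "\<dots> = tens_lift P (\<lambda>x z. tens_lift P (\<lambda>u v. ract P (hD x (hact W u w)) (hact A v a)) (comult H z)) (comult H \<xi>)"
    by (rule coassoc_lift) (simp_all add: rules)
  \<comment> \<open>A factor \<epsilon>(\<xi>1) is inserted to give this term the same three-leg
    form as the other one; it becomes the coefficient \<epsilon>(\<xi>) of the claim.\<close>
  also have "hact P \<xi> (w \<otimes>\<otimes> \<delta> a) = tens_lift P (\<lambda>x z. counit H x \<odot>\<^bsub>P\<^esub> hact P z (w \<otimes>\<otimes> \<delta> a)) (comult H \<xi>)"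
    by (rule counit_left_lift [where f = "\<lambda>z. hact P z (w \<otimes>\<otimes> \<delta> a)", symmetric]) (simp_all add: rules)
  also have "\<dots> = tens_lift P (\<lambda>x z. tens_lift P (\<lambda>u v. counit H x \<odot>\<^bsub>P\<^esub> (hact W u w \<otimes>\<otimes> \<delta> (hact A v a))) (comult H z)) (comult H \<xi>)"
  proof (rule lift_cong)
    fix x z assume xz: "x \<in> carrier H" "z \<in> carrier H"
    have "counit H x \<odot>\<^bsub>P\<^esub> hact P z (w \<otimes>\<otimes> \<delta> a) =
        tens_lift P (\<lambda>u v. counit H x \<odot>\<^bsub>P\<^esub> (hact W u w \<otimes>\<otimes> hact F v (\<delta> a))) (comult H z)"
      by (rule hact_tensor_A_apply [OF W F P_def, where h = "\<lambda>t. _ \<odot>\<^bsub>P\<^esub> t"]) (simp_all add: rules xz)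
    also have "\<dots> = tens_lift P (\<lambda>u v. counit H x \<odot>\<^bsub>P\<^esub> (hact W u w \<otimes>\<otimes> \<delta> (hact A v a))) (comult H z)"
      by (intro lift_cong) (simp_all add: rules xz hact_\<delta>)
    finally show "counit H x \<odot>\<^bsub>P\<^esub> hact P z (w \<otimes>\<otimes> \<delta> a) = \<dots>" .
  qed (simp_all add: rules)
  also have "tens_lift P (\<lambda>x z. tens_lift P (\<lambda>u v. ract P (hD x (hact W u w)) (hact A v a)) (comult H z)) (comult H \<xi>) \<oplus>\<^bsub>P\<^esub> \<dots> =
     tens_lift P (\<lambda>x z. tens_lift P (\<lambda>u v. ract P (hD x (hact W u w)) (hact A v a)) (comult H z) \<oplus>\<^bsub>P\<^esub>
       tens_lift P (\<lambda>u v. counit H x \<odot>\<^bsub>P\<^esub> (hact W u w \<otimes>\<otimes> \<delta> (hact A v a))) (comult H z)) (comult H \<xi>)"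
    by (rule lift_add [symmetric]) (simp_all add: rules)
  also have "\<dots> = tens_lift P (\<lambda>x z. tens_lift P (\<lambda>u v. ract P (hD x (hact W u w)) (hact A v a) \<oplus>\<^bsub>P\<^esub>
       counit H x \<odot>\<^bsub>P\<^esub> (hact W u w \<otimes>\<otimes> \<delta> (hact A v a))) (comult H z)) (comult H \<xi>)"
    by (intro lift_cong lift_add [symmetric]) (simp_all add: rules)
  finally show "tens_lift P (\<lambda>x z. tens_lift P (\<lambda>u v. hD x (ract W (hact W u w) (hact A v a))) (comult H z)) (comult H \<xi>) = \<dots>" .
qed (use x wa in auto)

end

context hom_connection
begin

lemmas rulesD = linD P_add_closed P_smult_closed

text \<open>The term E_a(w) of the overview, that is, the inverse braiding of da \<otimes> w with
  the action on da already moved inside d.\<close>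

definition "correction a w = tens_lift P (\<lambda>r s. hact W s w \<otimes>\<otimes> \<delta> (hact A r a)) R"

lemma correction_bilinear: "k_bilinear K A W P correction"
  unfolding correction_def by (simp add: rulesD)

lemmas rulesE = rulesD k_bilinear_left [OF correction_bilinear] k_bilinear_right [OF correction_bilinear] k_bilinear_closed [OF correction_bilinear]

text \<open>Writing aw as (R_\<alpha> w)(R^\<alpha> a) makes the right Leibniz rule applicable; its
  second term is the correction. The first term is turned back into a left action by
  quasi-commutativity of W \<otimes>_A F, at the cost of an R' that splits into two copies, one of
  which cancels R.\<close>

lemma D_lact:
  assumes wa: "w \<in> carrier W" "a \<in> carrier A"
  shows "D (lact W a w) = tens_lift P (\<lambda>r s. lact P (hact A r a) (hD s w)) R' \<oplus>\<^bsub>P\<^esub> correction a w"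
proof -
  note rules = rulesE wa
  let ?f = "\<lambda>r s x y z. lact P (hact A (x \<otimes> r) a) (hD y (hact W (z \<otimes> s) w))"
  let ?g = "\<lambda>r s. lact P (hact A r a) (hD s w)"
  have "D (lact W a w) = D (tens_lift W (\<lambda>r s. ract W (hact W s w) (hact A r a)) R)"
    by (simp add: lact_quasi_commutative [OF W qW wa])
  also have "\<dots> = tens_lift P (\<lambda>r s. D (ract W (hact W s w) (hact A r a))) R"
    by (rule lift_apply [where h = D]) (simp_all add: rules D)
  also have "\<dots> = tens_lift P (\<lambda>r s. ract P (D (hact W s w)) (hact A r a) \<oplus>\<^bsub>P\<^esub> (hact W s w \<otimes>\<otimes> \<delta> (hact A r a))) R"
    by (intro lift_cong) (simp_all add: rules D_ract)
  also have "\<dots> = tens_lift P (\<lambda>r s. ract P (D (hact W s w)) (hact A r a)) R \<oplus>\<^bsub>P\<^esub> correction a w"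
    unfolding correction_def by (rule lift_add) (simp_all add: rules)
  also have "tens_lift P (\<lambda>r s. ract P (D (hact W s w)) (hact A r a)) R =
    tens_lift P (\<lambda>r s. tens_lift P (\<lambda>r' s'. tens_lift P (\<lambda>r'' s''.
      lact P (hact A r' (hact A r'' (hact A r a))) (hD s' (hact W s'' (hact W s w)))) R') R') R"
  proof (rule lift_cong)
    fix r s assume rs: "r \<in> carrier H" "s \<in> carrier H"
    have "ract P (D (hact W s w)) (hact A r a) =
        tens_lift P (\<lambda>r' s'. lact P (hact A r' (hact A r a)) (hact P s' (D (hact W s w)))) R'"
      by (rule ract_quasi_commutative [OF qP]) (simp_all add: rules rs)
    \<comment> \<open>The second leg of R' acts on a value of D; \<open>hact_hom\<close> splits it
      into a part acting on D and a part acting on w.\<close>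
    also have "\<dots> = tens_lift P (\<lambda>r' s'. tens_lift P (?f r s r') (comult H s')) R'"
    proof (rule lift_cong)
      fix r' s' assume rs': "r' \<in> carrier H" "s' \<in> carrier H"
      have "lact P (hact A r' (hact A r a)) (hact P s' (D (hact W s w))) =
        lact P (hact A r' (hact A r a)) (tens_lift P (\<lambda>x y. hD x (hact W y (hact W s w))) (comult H s'))"
        using rs rs' by (simp add: hact_hom [OF hW hP D] rules)
      also have "\<dots> = tens_lift P (\<lambda>x y. lact P (hact A r' (hact A r a)) (hD x (hact W y (hact W s w)))) (comult H s')"
        by (rule lift_apply [where h = "lact P _"]) (simp_all add: rules rs rs')
      also have "\<dots> = tens_lift P (?f r s r') (comult H s')"
        by (intro lift_cong) (simp_all add: rules rs rs' A.hact_mult h_module.hact_mult [OF hW])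
      finally show "lact P (hact A r' (hact A r a)) (hact P s' (D (hact W s w))) = \<dots>" .
    qed (simp_all add: rules rs)
    \<comment> \<open>(id \<otimes> \<Delta>)(R') = R'_12 R'_13 turns the split leg into two copies
      of R', one with its second leg on D and one with it on w.\<close>
    also have "\<dots> = tens_lift P (\<lambda>r' s'. tens_lift P (\<lambda>r'' s''. ?f r s (r' \<otimes> r'') s' s'') R') R'"
      by (rule hex2'_lift) (simp_all add: rules rs)
    also have "\<dots> = tens_lift P (\<lambda>r' s'. tens_lift P (\<lambda>r'' s''.
        lact P (hact A r' (hact A r'' (hact A r a))) (hD s' (hact W s'' (hact W s w)))) R') R'"
    proof (rule lift_cong)
      fix r' s' assume rs': "r' \<in> carrier H" "s' \<in> carrier H"
      show "tens_lift P (\<lambda>r'' s''. ?f r s (r' \<otimes> r'') s' s'') R' = tens_lift P (\<lambda>r'' s''.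
        lact P (hact A r' (hact A r'' (hact A r a))) (hD s' (hact W s'' (hact W s w)))) R'"
        by (rule lift_cong) (simp_all add: rules rs rs' A.hact_mult h_module.hact_mult [OF hW])
    qed (simp_all add: rules rs)
    finally show "ract P (D (hact W s w)) (hact A r a) = \<dots>" .
  qed (simp_all add: rules)
  \<comment> \<open>The sum over R is brought next to the copy of R' acting on w, where
    \<open>act_R_R'\<close> cancels the two; the copy acting on D remains.\<close>
  also have "\<dots> = tens_lift P (\<lambda>r' s'. tens_lift P (\<lambda>r s. tens_lift P (\<lambda>r'' s''.
      lact P (hact A r' (hact A r'' (hact A r a))) (hD s' (hact W s'' (hact W s w)))) R') R) R'"
    by (rule lift_swap) (simp_all add: rules)
  also have "\<dots> = tens_lift P ?g R'"
  proof (rule lift_cong)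
    fix r' s' assume rs': "r' \<in> carrier H" "s' \<in> carrier H"
    show "tens_lift P (\<lambda>r s. tens_lift P (\<lambda>r'' s''.
      lact P (hact A r' (hact A r'' (hact A r a))) (hD s' (hact W s'' (hact W s w)))) R') R = ?g r' s'"
      by (rule act_R_R'(1) [where f = "\<lambda>a w. lact P (hact A r' a) (hD s' w)"]) (simp_all add: rules rs')
  qed (simp_all add: rules)
  finally show ?thesis .
qed

text \<open>Acting on the value multiplies R by the opposite coproduct from the left, since w stands
  first and a second; \<Delta>^cop R = R \<Delta> then moves the legs of \<xi> onto a and w.\<close>

lemma hact_correction:
  assumes x: "\<xi> \<in> carrier H" and wa: "w \<in> carrier W" "a \<in> carrier A"
  shows "hact P \<xi> (correction a w) = tens_lift P (\<lambda>x y. correction (hact A x a) (hact W y w)) (comult H \<xi>)"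
proof -
  note rules = rulesE wa x
  let ?f = "\<lambda>x y. hact W y w \<otimes>\<otimes> \<delta> (hact A x a)"
  have "hact P \<xi> (correction a w) = tens_lift P (\<lambda>r s. hact P \<xi> (?f r s)) R"
    unfolding correction_def by (rule lift_apply [where h = "hact P \<xi>"]) (simp_all add: rules)
  also have "\<dots> = tens_lift P (\<lambda>r s. tens_lift P (\<lambda>y z. ?f (z \<otimes> r) (y \<otimes> s)) (comult H \<xi>)) R"
  proof (rule lift_cong)
    fix r s assume rs: "r \<in> carrier H" "s \<in> carrier H"
    have "hact P \<xi> (?f r s) = tens_lift P (\<lambda>y z. hact W y (hact W s w) \<otimes>\<otimes> hact F z (\<delta> (hact A r a))) (comult H \<xi>)"
      by (rule hact_tensor_A(2) [OF W F P_def]) (simp_all add: rules rs)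
    also have "\<dots> = tens_lift P (\<lambda>y z. ?f (z \<otimes> r) (y \<otimes> s)) (comult H \<xi>)"
      by (intro lift_cong) (simp_all add: rules rs hact_\<delta> A.hact_mult h_module.hact_mult [OF hW])
    finally show "hact P \<xi> (?f r s) = \<dots>" .
  qed (simp_all add: rules)
  also have "\<dots> = tens_lift P (\<lambda>y z. tens_lift P (\<lambda>r s. ?f (z \<otimes> r) (y \<otimes> s)) R) (comult H \<xi>)"
    by (rule lift_swap) (simp_all add: rules)
  also have "\<dots> = tens_lift P (\<lambda>r s. tens_lift P (\<lambda>y z. ?f (r \<otimes> y) (s \<otimes> z)) (comult H \<xi>)) R"
    by (rule R_comult_lift(1)) (simp_all add: rules)
  also have "\<dots> = tens_lift P (\<lambda>y z. tens_lift P (\<lambda>r s. ?f (r \<otimes> y) (s \<otimes> z)) R) (comult H \<xi>)"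
    by (rule lift_swap) (simp_all add: rules)
  also have "\<dots> = tens_lift P (\<lambda>x y. correction (hact A x a) (hact W y w)) (comult H \<xi>)"
  proof (rule lift_cong)
    fix y z assume yz: "y \<in> carrier H" "z \<in> carrier H"
    show "tens_lift P (\<lambda>r s. ?f (r \<otimes> y) (s \<otimes> z)) R = correction (hact A y a) (hact W z w)"
      unfolding correction_def
      by (intro lift_cong) (simp_all add: rules yz A.hact_mult h_module.hact_mult [OF hW])
  qed (simp_all add: rules)
  finally show ?thesis .
qed

text \<open>Spread over the arguments, the left side is \<xi> acting on D(aw), and
  \<open>D_lact\<close> applies. On its first term \<xi> produces the coefficients \<xi>1 r and
  \<xi>2 s; the exchange \<Delta> R' = R' \<Delta>^cop turns them into r \<xi>2 and s \<xi>1, which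
  is why \<xi> stands to the right of s. The second term is treated by
  \<open>hact_correction\<close>.\<close>

lemma hom_act_lact:
  assumes x: "\<xi> \<in> carrier H" and wa: "w \<in> carrier W" "a \<in> carrier A"
  shows "hD \<xi> (lact W a w) =
    tens_lift P (\<lambda>r s. lact P (hact A r a) (hD (s \<otimes> \<xi>) w)) R' \<oplus>\<^bsub>P\<^esub> counit H \<xi> \<odot>\<^bsub>P\<^esub> correction a w"
proof (rule trilinear_eqI [OF h_module_A hW mP, where
      F = "\<lambda>\<xi> a w. hD \<xi> (lact W a w)" and G = "\<lambda>\<xi> a w.
        tens_lift P (\<lambda>r s. lact P (hact A r a) (hD (s \<otimes> \<xi>) w)) R' \<oplus>\<^bsub>P\<^esub> counit H \<xi> \<odot>\<^bsub>P\<^esub> correction a w"])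
  show "k_trilinear K H A W P (\<lambda>\<xi> a w. hD \<xi> (lact W a w))"
    "k_trilinear K H A W P (\<lambda>\<xi> a w.
        tens_lift P (\<lambda>r s. lact P (hact A r a) (hD (s \<otimes> \<xi>) w)) R' \<oplus>\<^bsub>P\<^esub> counit H \<xi> \<odot>\<^bsub>P\<^esub> correction a w)"
    by (simp_all add: rulesE)
  fix \<xi> a w assume a: "\<xi> \<in> carrier H" "a \<in> carrier A" "w \<in> carrier W"
  note rules = rulesE a
  let ?L = "\<lambda>a w r s. lact P (hact A r a) (hD s w)"
  have "tens_lift P (\<lambda>x z. tens_lift P (\<lambda>u v. hD x (lact W (hact A u a) (hact W v w))) (comult H z)) (comult H \<xi>) =
    tens_lift P (\<lambda>x z. hD x (hact W z (lact W a w))) (comult H \<xi>)"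
    by (intro lift_cong hact_lact_apply [OF W, where h = "hD _", symmetric]) (simp_all add: rules)
  also have "\<dots> = hact P \<xi> (D (lact W a w))"
    by (rule hact_hom [OF hW hP D, symmetric]) (simp_all add: rules)
  also have "\<dots> = hact P \<xi> (tens_lift P (\<lambda>r s. lact P (hact A r a) (hD s w)) R') \<oplus>\<^bsub>P\<^esub> hact P \<xi> (correction a w)"
    by (simp add: D_lact rules k_linearD(2) [OF k_bilinearD(1) [OF hact_bilinear [OF hP]]])
  also have "hact P \<xi> (tens_lift P (\<lambda>r s. lact P (hact A r a) (hD s w)) R') =
      tens_lift P (\<lambda>r s. hact P \<xi> (lact P (hact A r a) (hD s w))) R'"
    by (rule lift_apply [where h = "hact P \<xi>"]) (simp_all add: rules)
  \<comment> \<open>\<open>hact_hom_act\<close> is used in full here, since D already carries the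
    leg s of R'; the third leg of \<xi> falls on w.\<close>
  also have "\<dots> = tens_lift P (\<lambda>r s. tens_lift P (\<lambda>x t. tens_lift P (\<lambda>z z2.
       lact P (hact A x (hact A r a)) (hD (z \<otimes> s) (hact W z2 w))) (comult H t)) (comult H \<xi>)) R'"
  proof (rule lift_cong)
    fix r s assume rs: "r \<in> carrier H" "s \<in> carrier H"
    have "hact P \<xi> (lact P (hact A r a) (hD s w)) =
      tens_lift P (\<lambda>x t. lact P (hact A x (hact A r a)) (hact P t (hD s w))) (comult H \<xi>)"
      by (rule hact_lact_apply [OF P, where h = "\<lambda>t. t"]) (simp_all add: rules rs)
    also have "\<dots> = tens_lift P (\<lambda>x t. tens_lift P (\<lambda>z z2.
       lact P (hact A x (hact A r a)) (hD (z \<otimes> s) (hact W z2 w))) (comult H t)) (comult H \<xi>)"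
    proof (rule lift_cong)
      fix x t assume xt: "x \<in> carrier H" "t \<in> carrier H"
      show "lact P (hact A x (hact A r a)) (hact P t (hD s w)) = tens_lift P (\<lambda>z z2.
          lact P (hact A x (hact A r a)) (hD (z \<otimes> s) (hact W z2 w))) (comult H t)"
        unfolding hact_hom_act [OF hW hP D xt(2) rs(2) a(3)]
        by (rule lift_apply [where h = "lact P _"]) (simp_all add: rules rs xt)
    qed (simp_all add: rules rs)
    finally show "hact P \<xi> (lact P (hact A r a) (hD s w)) = \<dots>" .
  qed (simp_all add: rules)
  also have "\<dots> = tens_lift P (\<lambda>x t. tens_lift P (\<lambda>r s. tens_lift P (\<lambda>z z2.
       lact P (hact A x (hact A r a)) (hD (z \<otimes> s) (hact W z2 w))) (comult H t)) R') (comult H \<xi>)"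
    by (rule lift_swap) (simp_all add: rules)
  also have "\<dots> = tens_lift P (\<lambda>x t. tens_lift P (\<lambda>z z2. tens_lift P (\<lambda>r s.
       ?L a (hact W z2 w) (x \<otimes> r) (z \<otimes> s)) R') (comult H t)) (comult H \<xi>)"
  proof (rule lift_cong)
    fix x t assume xt: "x \<in> carrier H" "t \<in> carrier H"
    have "tens_lift P (\<lambda>r s. tens_lift P (\<lambda>z z2.
       lact P (hact A x (hact A r a)) (hD (z \<otimes> s) (hact W z2 w))) (comult H t)) R' =
      tens_lift P (\<lambda>z z2. tens_lift P (\<lambda>r s.
       lact P (hact A x (hact A r a)) (hD (z \<otimes> s) (hact W z2 w))) R') (comult H t)"
      by (rule lift_swap) (simp_all add: rules xt)
    also have "\<dots> = tens_lift P (\<lambda>z z2. tens_lift P (\<lambda>r s.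
       ?L a (hact W z2 w) (x \<otimes> r) (z \<otimes> s)) R') (comult H t)"
      by (intro lift_cong) (simp_all add: rules xt A.hact_mult cong: lift_cong)
    finally show "tens_lift P (\<lambda>r s. tens_lift P (\<lambda>z z2.
       lact P (hact A x (hact A r a)) (hD (z \<otimes> s) (hact W z2 w))) (comult H t)) R' = \<dots>" .
  qed (simp_all add: rules)
  \<comment> \<open>Rebracketing collects the two legs that multiply R' into one coproduct, as the
    exchange relation requires.\<close>
  also have "\<dots> = tens_lift P (\<lambda>t z2. tens_lift P (\<lambda>x z. tens_lift P (\<lambda>r s.
       ?L a (hact W z2 w) (x \<otimes> r) (z \<otimes> s)) R') (comult H t)) (comult H \<xi>)"
    by (rule coassoc_lift [symmetric]) (simp_all add: rules)
  also have "\<dots> = tens_lift P (\<lambda>t z2. tens_lift P (\<lambda>x z. tens_lift P (\<lambda>r s.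
       ?L (hact A z a) (hact W z2 w) r (s \<otimes> x)) R') (comult H t)) (comult H \<xi>)"
  proof (rule lift_cong)
    fix t z2 assume tz: "t \<in> carrier H" "z2 \<in> carrier H"
    have "tens_lift P (\<lambda>x z. tens_lift P (\<lambda>r s. ?L a (hact W z2 w) (x \<otimes> r) (z \<otimes> s)) R') (comult H t) =
      tens_lift P (\<lambda>r s. tens_lift P (\<lambda>x z. ?L a (hact W z2 w) (r \<otimes> z) (s \<otimes> x)) (comult H t)) R'"
      by (rule R_comult_lift(2) [where f = "?L a (hact W z2 w)"]) (simp_all add: rules tz)
    also have "\<dots> = tens_lift P (\<lambda>x z. tens_lift P (\<lambda>r s. ?L a (hact W z2 w) (r \<otimes> z) (s \<otimes> x)) R') (comult H t)"
      by (rule lift_swap) (simp_all add: rules tz)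
    also have "\<dots> = tens_lift P (\<lambda>x z. tens_lift P (\<lambda>r s. ?L (hact A z a) (hact W z2 w) r (s \<otimes> x)) R') (comult H t)"
    proof (rule lift_cong)
      fix x z assume xz: "x \<in> carrier H" "z \<in> carrier H"
      show "tens_lift P (\<lambda>r s. ?L a (hact W z2 w) (r \<otimes> z) (s \<otimes> x)) R' =
        tens_lift P (\<lambda>r s. ?L (hact A z a) (hact W z2 w) r (s \<otimes> x)) R'"
        by (rule lift_cong) (simp_all add: rules xz tz A.hact_mult)
    qed (simp_all add: rules tz)
    finally show "tens_lift P (\<lambda>x z. tens_lift P (\<lambda>r s. ?L a (hact W z2 w) (x \<otimes> r) (z \<otimes> s)) R') (comult H t) = \<dots>" .
  qed (simp_all add: rules)
  also have "\<dots> = tens_lift P (\<lambda>x t. tens_lift P (\<lambda>z z2. tens_lift P (\<lambda>r s.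
       ?L (hact A z a) (hact W z2 w) r (s \<otimes> x)) R') (comult H t)) (comult H \<xi>)"
    by (rule coassoc_lift) (simp_all add: rules)
  also have "hact P \<xi> (correction a w) = tens_lift P (\<lambda>x z. counit H x \<odot>\<^bsub>P\<^esub> hact P z (correction a w)) (comult H \<xi>)"
    by (rule counit_left_lift [where f = "\<lambda>z. hact P z (correction a w)", symmetric]) (simp_all add: rules)
  also have "\<dots> = tens_lift P (\<lambda>x z. tens_lift P (\<lambda>u v. counit H x \<odot>\<^bsub>P\<^esub> correction (hact A u a) (hact W v w)) (comult H z)) (comult H \<xi>)"
  proof (rule lift_cong)
    fix x z assume xz: "x \<in> carrier H" "z \<in> carrier H"
    show "counit H x \<odot>\<^bsub>P\<^esub> hact P z (correction a w) =
        tens_lift P (\<lambda>u v. counit H x \<odot>\<^bsub>P\<^esub> correction (hact A u a) (hact W v w)) (comult H z)"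
      unfolding hact_correction [OF xz(2) a(3,2)]
      by (rule lift_smult [symmetric]) (simp_all add: rules xz)
  qed (simp_all add: rules)
  also have "tens_lift P (\<lambda>x t. tens_lift P (\<lambda>z z2. tens_lift P (\<lambda>r s.
       ?L (hact A z a) (hact W z2 w) r (s \<otimes> x)) R') (comult H t)) (comult H \<xi>) \<oplus>\<^bsub>P\<^esub> \<dots> =
     tens_lift P (\<lambda>x z. tens_lift P (\<lambda>z z2. tens_lift P (\<lambda>r s.
       ?L (hact A z a) (hact W z2 w) r (s \<otimes> x)) R') (comult H z) \<oplus>\<^bsub>P\<^esub>
       tens_lift P (\<lambda>u v. counit H x \<odot>\<^bsub>P\<^esub> correction (hact A u a) (hact W v w)) (comult H z)) (comult H \<xi>)"
    by (rule lift_add [symmetric]) (simp_all add: rules)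
  also have "\<dots> = tens_lift P (\<lambda>x z. tens_lift P (\<lambda>u v. tens_lift P (\<lambda>r s.
       ?L (hact A u a) (hact W v w) r (s \<otimes> x)) R' \<oplus>\<^bsub>P\<^esub>
       counit H x \<odot>\<^bsub>P\<^esub> correction (hact A u a) (hact W v w)) (comult H z)) (comult H \<xi>)"
    by (intro lift_cong lift_add [symmetric]) (simp_all add: rules)
  finally show "tens_lift P (\<lambda>x z. tens_lift P (\<lambda>u v. hD x (lact W (hact A u a) (hact W v w))) (comult H z)) (comult H \<xi>) = \<dots>" .
qed (use x wa in auto)

end

section \<open>Associativity of the tensor product over \<open>A\<close>\<close>

context hopf_module_algebra
begin

lemma h_bimodule_tensor_A:
  "h_bimodule K H A V \<Longrightarrow> h_bimodule K H A W \<Longrightarrow> h_bimodule K H A (tensor_A H A V W)"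
  by (rule h_bimodule_tensor_A_eq [OF _ _ refl])

context
  fixes U :: "('k, 'h, 'a, 'u, 'm1) hbimod_scheme" and V :: "('k, 'h, 'a, 'v, 'm2) hbimod_scheme"
    and W :: "('k, 'h, 'a, 'w, 'm3) hbimod_scheme"
  assumes U: "h_bimodule K H A U" and V: "h_bimodule K H A V" and W: "h_bimodule K H A W"
begin

abbreviation (input) "UV \<equiv> tensor_A H A U V"
abbreviation (input) "VW \<equiv> tensor_A H A V W"
abbreviation (input) "UV_W \<equiv> tensor_A H A (tensor_A H A U V) W"
abbreviation (input) "U_VW \<equiv> tensor_A H A U (tensor_A H A V W)"

lemmas UV = h_bimodule_tensor_A [OF U V]
lemmas VW = h_bimodule_tensor_A [OF V W]
lemmas UV_W = h_bimodule_tensor_A [OF UV W]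
lemmas U_VW = h_bimodule_tensor_A [OF U VW]
lemmas rulesA = lin U V W UV VW UV_W U_VW
lemmas opsA = ract_tensor_A(2) [OF U V refl] ract_tensor_A(2) [OF V W refl] ract_tensor_A(2) [OF UV W refl] ract_tensor_A(2) [OF U VW refl]
  lact_tensor_A(2) [OF U V refl] lact_tensor_A(2) [OF V W refl] lact_tensor_A(2) [OF UV W refl] lact_tensor_A(2) [OF U VW refl]
lemmas balA = pure_A_balanced [OF k_algebra_A U V] pure_A_balanced [OF k_algebra_A V W]
  pure_A_balanced [OF k_algebra_A UV W] pure_A_balanced [OF k_algebra_A U VW]
lemmas eqA = tensor_A_eqI [OF k_algebra_A U V] tensor_A_eqI [OF k_algebra_A V W]
  tensor_A_eqI [OF k_algebra_A UV W] tensor_A_eqI [OF k_algebra_A U VW]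

lemma ract_pure_eq: "u \<in> carrier U \<Longrightarrow> v \<in> carrier V \<Longrightarrow> b \<in> carrier A \<Longrightarrow> w \<in> carrier W \<Longrightarrow>
   pure_A A UV W (pure_A A U V u (ract V v b)) w = pure_A A UV W (pure_A A U V u v) (lact W b w)"
  by (subst balA(3) [symmetric]) (simp_all add: rulesA opsA)

lemma lact_pure_eq: "u \<in> carrier U \<Longrightarrow> v \<in> carrier V \<Longrightarrow> b \<in> carrier A \<Longrightarrow> w \<in> carrier W \<Longrightarrow>
   pure_A A U VW (ract U u b) (pure_A A V W v w) = pure_A A U VW u (pure_A A V W (lact V b v) w)"
  by (subst balA(4)) (simp_all add: rulesA opsA)

text \<open>The map is built in two stages. For fixed u the balanced map from v and w to (u
  \<otimes> v) \<otimes> w is lifted here; the next two lemmas show that the result is linear and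
  balanced in u, so that it can be lifted again.\<close>

lemma tensor_assoc_inv_inner:
  assumes u: "u \<in> carrier U"
  shows "k_linear K VW UV_W (tens_lift UV_W (\<lambda>v w. pure_A A UV W (pure_A A U V u v) w))"
    and "v \<in> carrier V \<Longrightarrow> w \<in> carrier W \<Longrightarrow>
      tens_lift UV_W (\<lambda>v w. pure_A A UV W (pure_A A U V u v) w) (pure_A A V W v w) = pure_A A UV W (pure_A A U V u v) w"
proof -
  show "k_linear K VW UV_W (tens_lift UV_W (\<lambda>v w. pure_A A UV W (pure_A A U V u v) w))"
    by (rule tens_lift_A_linear [OF k_algebra_A V W]) (simp_all add: u rulesA ract_pure_eq)
  show "tens_lift UV_W (\<lambda>v w. pure_A A UV W (pure_A A U V u v) w) (pure_A A V W v w) = pure_A A UV W (pure_A A U V u v) w"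
    if "v \<in> carrier V" "w \<in> carrier W"
    by (rule tens_lift_A_pure [OF k_algebra_A V W _ _ _ that]) (simp_all add: u rulesA ract_pure_eq)
qed

lemma tensor_assoc_inv_param:
  "y \<in> carrier VW \<Longrightarrow> k_linear K U UV_W (\<lambda>u. tens_lift UV_W (\<lambda>v w. pure_A A UV W (pure_A A U V u v) w) y)"
  by (rule tens_lift_A_param [OF k_algebra_A V W]) (simp_all add: rulesA ract_pure_eq)

lemma tensor_assoc_inv_bal:
  assumes "u \<in> carrier U" "b \<in> carrier A" "y \<in> carrier VW"
  shows "tens_lift UV_W (\<lambda>v w. pure_A A UV W (pure_A A U V (ract U u b) v) w) y =
    tens_lift UV_W (\<lambda>v w. pure_A A UV W (pure_A A U V u v) w) (lact VW b y)"
  by (rule eqA(2) [where U = UV_W, OF _ _ assms(3)])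
     (use assms in \<open>simp_all add: tensor_assoc_inv_inner rulesA opsA balA k_linear_comp [OF tensor_assoc_inv_inner(1)]\<close>)

lemma tensor_assoc_inv:
  shows tensor_assoc_inv_linear: "k_linear K U_VW UV_W (tensor_assoc_inv H A U V W)"
    and tensor_assoc_inv_pure: "u \<in> carrier U \<Longrightarrow> v \<in> carrier V \<Longrightarrow> w \<in> carrier W \<Longrightarrow>
      tensor_assoc_inv H A U V W (pure_A A U VW u (pure_A A V W v w)) = pure_A A UV W (pure_A A U V u v) w"
proof -
  have b: "k_bilinear K U VW UV_W (\<lambda>u y. tens_lift UV_W (\<lambda>v w. pure_A A UV W (pure_A A U V u v) w) y)"
    by (simp add: rulesA tensor_assoc_inv_inner tensor_assoc_inv_param)
  show "k_linear K U_VW UV_W (tensor_assoc_inv H A U V W)"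
    unfolding tensor_assoc_inv_def Let_def
    by (rule tens_lift_A_linear [OF k_algebra_A U VW _ b]) (simp_all add: rulesA tensor_assoc_inv_bal)
  show "tensor_assoc_inv H A U V W (pure_A A U VW u (pure_A A V W v w)) = pure_A A UV W (pure_A A U V u v) w"
    if "u \<in> carrier U" "v \<in> carrier V" "w \<in> carrier W"
    unfolding tensor_assoc_inv_def Let_def
    by (subst tens_lift_A_pure [OF k_algebra_A U VW _ b])
       (use that in \<open>simp_all add: rulesA tensor_assoc_inv_bal tensor_assoc_inv_inner\<close>)
qed

text \<open>The right action touches only the last factor in either bracketing, so pure tensors
  decide. It transports the Leibniz rule through the rebracketing.\<close>

lemma tensor_assoc_inv_ract:
  assumes X: "X \<in> carrier U_VW" and a: "a \<in> carrier A"
  shows "tensor_assoc_inv H A U V W (ract U_VW X a) = ract UV_W (tensor_assoc_inv H A U V W X) a"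
proof (rule eqA(4) [OF _ _ X])
  note l = k_linear_comp [OF tensor_assoc_inv_linear] tensor_assoc_inv_linear k_linearD(1) [OF tensor_assoc_inv_linear]
  show "k_linear K U_VW UV_W (\<lambda>X. tensor_assoc_inv H A U V W (ract U_VW X a))"
    "k_linear K U_VW UV_W (\<lambda>X. ract UV_W (tensor_assoc_inv H A U V W X) a)"
    using a by (simp_all add: rulesA l)
  fix u y assume u: "u \<in> carrier U" and y: "y \<in> carrier VW"
  show "tensor_assoc_inv H A U V W (ract U_VW (pure_A A U VW u y) a) =
     ract UV_W (tensor_assoc_inv H A U V W (pure_A A U VW u y)) a"
    by (rule eqA(2) [where U = UV_W, OF _ _ y])
       (use a u in \<open>simp_all add: rulesA l opsA tensor_assoc_inv_pure\<close>)
qed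

text \<open>Mirror image of the construction of \<open>tensor_assoc_inv\<close>, with w as the
  parameter.\<close>

lemma tensor_assoc_inner:
  assumes w: "w \<in> carrier W"
  shows "k_linear K UV U_VW (tens_lift U_VW (\<lambda>u v. pure_A A U VW u (pure_A A V W v w)))"
    and "u \<in> carrier U \<Longrightarrow> v \<in> carrier V \<Longrightarrow>
      tens_lift U_VW (\<lambda>u v. pure_A A U VW u (pure_A A V W v w)) (pure_A A U V u v) = pure_A A U VW u (pure_A A V W v w)"
proof -
  show "k_linear K UV U_VW (tens_lift U_VW (\<lambda>u v. pure_A A U VW u (pure_A A V W v w)))"
    by (rule tens_lift_A_linear [OF k_algebra_A U V]) (simp_all add: w rulesA lact_pure_eq)
  show "tens_lift U_VW (\<lambda>u v. pure_A A U VW u (pure_A A V W v w)) (pure_A A U V u v) = pure_A A U VW u (pure_A A V W v w)"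
    if "u \<in> carrier U" "v \<in> carrier V"
    by (rule tens_lift_A_pure [OF k_algebra_A U V _ _ _ that]) (simp_all add: w rulesA lact_pure_eq)
qed

lemma tensor_assoc_param:
  "y \<in> carrier UV \<Longrightarrow> k_linear K W U_VW (\<lambda>w. tens_lift U_VW (\<lambda>u v. pure_A A U VW u (pure_A A V W v w)) y)"
  by (rule tens_lift_A_param [OF k_algebra_A U V]) (simp_all add: rulesA lact_pure_eq)

lemma tensor_assoc_bal:
  assumes "w \<in> carrier W" "b \<in> carrier A" "y \<in> carrier UV"
  shows "tens_lift U_VW (\<lambda>u v. pure_A A U VW u (pure_A A V W v w)) (ract UV y b) =
    tens_lift U_VW (\<lambda>u v. pure_A A U VW u (pure_A A V W v (lact W b w))) y"
  by (rule eqA(1) [where U = U_VW, OF _ _ assms(3)])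
     (use assms in \<open>simp_all add: tensor_assoc_inner rulesA opsA balA k_linear_comp [OF tensor_assoc_inner(1)]\<close>)

lemma tensor_assoc:
  shows tensor_assoc_linear: "k_linear K UV_W U_VW (tensor_assoc H A U V W)"
    and tensor_assoc_pure: "u \<in> carrier U \<Longrightarrow> v \<in> carrier V \<Longrightarrow> w \<in> carrier W \<Longrightarrow>
      tensor_assoc H A U V W (pure_A A UV W (pure_A A U V u v) w) = pure_A A U VW u (pure_A A V W v w)"
proof -
  have b: "k_bilinear K UV W U_VW (\<lambda>y w. tens_lift U_VW (\<lambda>u v. pure_A A U VW u (pure_A A V W v w)) y)"
    by (simp add: rulesA tensor_assoc_inner tensor_assoc_param)
  show "k_linear K UV_W U_VW (tensor_assoc H A U V W)"
    unfolding tensor_assoc_def Let_def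
    by (rule tens_lift_A_linear [OF k_algebra_A UV W _ b]) (simp_all add: rulesA tensor_assoc_bal)
  show "tensor_assoc H A U V W (pure_A A UV W (pure_A A U V u v) w) = pure_A A U VW u (pure_A A V W v w)"
    if "u \<in> carrier U" "v \<in> carrier V" "w \<in> carrier W"
    unfolding tensor_assoc_def Let_def
    by (subst tens_lift_A_pure [OF k_algebra_A UV W _ b])
       (use that in \<open>simp_all add: rulesA tensor_assoc_bal tensor_assoc_inner\<close>)
qed

end

end

section \<open>Sums of connections\<close>

lemma map_tensor_linear:
  assumes V: "module K V" and W: "module K W" and V': "module K V'" and W': "module K W'"
    and f: "k_linear K V V' f" and g: "k_linear K W W' g"
  shows "k_linear K (tensor_K K V W) (tensor_K K V' W') (map_tensor K V' W' f g)"
    and "v \<in> carrier V \<Longrightarrow> w \<in> carrier W \<Longrightarrow> map_tensor K V' W' f g (pure_K K V W v w) = pure_K K V' W' (f v) (g w)"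
proof -
  have b: "k_bilinear K V W (tensor_K K V' W') (\<lambda>v w. pure_K K V' W' (f v) (g w))"
    by (intro k_bilinearI k_bilinear_left [OF pure_K_bilinear] k_bilinear_right [OF pure_K_bilinear] V' W' f g
        k_linearD(1) [OF f] k_linearD(1) [OF g])
  show "k_linear K (tensor_K K V W) (tensor_K K V' W') (map_tensor K V' W' f g)"
    unfolding map_tensor_def by (rule tens_lift_K_linear [OF V W module_tensor_K [OF V' W'] b])
  show "v \<in> carrier V \<Longrightarrow> w \<in> carrier W \<Longrightarrow> map_tensor K V' W' f g (pure_K K V W v w) = pure_K K V' W' (f v) (g w)"
    unfolding map_tensor_def by (rule tens_lift_K_pure [OF V W module_tensor_K [OF V' W'] b])
qed

lemma tensor_proj_linear:
  assumes A: "k_algebra K A" and V: "h_bimodule K H A V" and W: "h_bimodule K H A W"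
  shows "k_linear K (tensor_K K V W) (tensor_A H A V W) (tensor_proj H A V W)"
    and "v \<in> carrier V \<Longrightarrow> w \<in> carrier W \<Longrightarrow> tensor_proj H A V W (pure_K K V W v w) = pure_A A V W v w"
  unfolding tensor_proj_def
  by (rule tens_lift_K_linear tens_lift_K_pure; use assms in
      \<open>simp add: h_bimodule_imp_module module_tensor_A pure_A_bilinear\<close>)+

context quasitriangular
begin

lemma map_tensor_R:
  assumes V: "h_module K H V" and W: "h_module K H W" and V': "h_module K H V'" and W': "h_module K H W'"
    and P: "k_linear K V V' P" and Q: "k_linear K W W' Q"
  shows "k_linear K (tensor_K K V W) (tensor_K K V' W') (map_tensor_R K H R V W V' W' P Q)"
    and "v \<in> carrier V \<Longrightarrow> w \<in> carrier W \<Longrightarrow> map_tensor_R K H R V W V' W' P Q (pure_K K V W v w) =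
      tens_lift (tensor_K K V' W') (\<lambda>r s. pure_K K V' W' (P (hact V r v)) (hom_act H W W' s Q w)) R'"
proof -
  note m = h_module_imp_module [OF V] h_module_imp_module [OF W] h_module_imp_module [OF V'] h_module_imp_module [OF W']
  note mT = module_tensor_K [OF m(3,4)]
  let ?T = "tensor_K K V' W'"
  note h = k_linear_hact [OF V] k_linear_hact [OF W] hact_closed [OF V] hact_closed [OF W] hact_bilinear [OF V]
  have hom: "k_bilinear K H W W' (\<lambda>\<xi> w. hom_act H W W' \<xi> Q w)"
  proof -
    show ?thesis
      unfolding hom_act_def
      by (simp add: k_bilinearI lift_fun_linear lift_arg_linear comult_linear comult_closed module_H m
        k_linear_hact [OF W'] hact_closed [OF W'] k_linear_comp [OF Q] k_linearD(1) [OF Q] h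
        antipode_linear antipode_closed k_linear_ident)
  qed
  note rules = k_bilinearI k_linear_tens_lift_K [OF m(1,2) mT] m mT module_H h k_linear_comp [OF P] k_linearD(1) [OF P]
    k_bilinear_left [OF hom] k_bilinear_right [OF hom] k_bilinear_closed [OF hom] k_linear_ident
    k_bilinear_left [OF pure_K_bilinear [OF m(3,4)]] k_bilinear_right [OF pure_K_bilinear [OF m(3,4)]]
    pure_K_closed [OF m(3,4)]
  have lin: "k_linear K (tensor_K K V W) ?T (map_tensor K V' W' (\<lambda>v. P (hact V r v)) (hom_act H W W' s Q))"
    if "r \<in> carrier H" "s \<in> carrier H" for r s
    using that by (intro map_tensor_linear(1)) (simp_all add: rules k_bilinearD(1) [OF hom])
  have bil: "k_bilinear K H H ?T (\<lambda>r s. map_tensor K V' W' (\<lambda>v. P (hact V r v)) (hom_act H W W' s Q) X)"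
    if "X \<in> carrier (tensor_K K V W)" for X
    using that unfolding map_tensor_def by (simp add: rules)
  show "k_linear K (tensor_K K V W) ?T (map_tensor_R K H R V W V' W' P Q)"
    unfolding map_tensor_R_def
    by (rule lift_fun_linear [OF mT R'_closed module_tensor_K [OF m(1,2)]]) (simp_all add: bil lin)
  show "map_tensor_R K H R V W V' W' P Q (pure_K K V W v w) =
      tens_lift ?T (\<lambda>r s. pure_K K V' W' (P (hact V r v)) (hom_act H W W' s Q w)) R'"
    if vw: "v \<in> carrier V" "w \<in> carrier W"
    unfolding map_tensor_R_def
  proof (rule lift_cong [OF mT R'_closed])
    fix r s assume rs: "r \<in> carrier H" "s \<in> carrier H"
    show "map_tensor K V' W' (\<lambda>v. P (hact V r v)) (hom_act H W W' s Q) (pure_K K V W v w) =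
        pure_K K V' W' (P (hact V r v)) (hom_act H W W' s Q w)"
      by (rule map_tensor_linear(2) [OF m]) (simp_all add: rules rs vw k_bilinearD(1) [OF hom])
  qed (simp add: rules vw)
qed

text \<open>The identity commutes with the action, so \<xi>1 and S(\<xi>2) are multiplied and the
  antipode axiom applies.\<close>

lemma hom_act_id:
  assumes W: "h_module K H W" and x: "\<xi> \<in> carrier H" and w: "w \<in> carrier W"
  shows "hom_act H W W \<xi> id w = counit H \<xi> \<odot>\<^bsub>W\<^esub> w"
proof -
  have "hom_act H W W \<xi> id w = tens_lift W (\<lambda>y z. hact W (y \<otimes> antipode H z) w) (comult H \<xi>)"
    unfolding hom_act_def id_apply
    by (intro lift_cong) (simp_all add: h_module_imp_module [OF W] comult_closed x w hact_closed [OF W]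
        antipode_closed h_module.hact_mult [OF W])
  also have "\<dots> = counit H \<xi> \<odot>\<^bsub>W\<^esub> hact W \<one> w"
    by (rule antipode_right_lift [where f = "\<lambda>x. hact W x w"])
       (simp_all add: h_module_imp_module [OF W] x w k_linear_hact [OF W] k_linear_ident)
  finally show ?thesis by (simp add: h_module.hact_one [OF W] w)
qed

text \<open>By H-invariance of the identity the second leg of R' enters only through its counit, and
  (id \<otimes> \<epsilon>)(R') = 1. So the only R-matrix in the first summand is that of the
  inverse braiding.\<close>

lemma map_tensor_R_id:
  assumes V: "h_module K H V" and W: "h_module K H W" and V': "h_module K H V'"
    and P: "k_linear K V V' P" and vw: "v \<in> carrier V" "w \<in> carrier W"
  shows "map_tensor_R K H R V W V' W P id (pure_K K V W v w) = pure_K K V' W (P v) w"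
proof -
  note m = h_module_imp_module [OF V] h_module_imp_module [OF W] h_module_imp_module [OF V']
  note mT = module_tensor_K [OF m(3,2)]
  have Q: "k_linear K W W id" by (simp add: k_linear_def)
  note b = pure_K_bilinear [OF m(3,2)]
  let ?f = "\<lambda>r. pure_K K V' W (P (hact V r v)) w"
  have "map_tensor_R K H R V W V' W P id (pure_K K V W v w) =
    tens_lift (tensor_K K V' W) (\<lambda>r s. pure_K K V' W (P (hact V r v)) (hom_act H W W s id w)) R'"
    by (rule map_tensor_R(2) [OF V W V' W P Q vw])
  also have "\<dots> = tens_lift (tensor_K K V' W) (\<lambda>r s. counit H s \<odot>\<^bsub>tensor_K K V' W\<^esub> ?f r) R'"
    by (rule lift_cong [OF mT R'_closed])
       (simp_all add: hom_act_id [OF W] vw k_linearD(3) [OF k_bilinearD(1) [OF b]] k_linearD(1) [OF P]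
         hact_closed [OF V] counit_closed pure_K_closed [OF m(3,2)] module.smult_closed [OF mT])
  also have "\<dots> = ?f \<one>"
    by (rule counit_right_R' [OF mT, where f = ?f])
       (simp add: k_bilinear_left [OF b] k_linear_comp [OF P] k_linear_hact [OF V] k_linear_ident vw)
  finally show ?thesis by (simp add: h_module.hact_one [OF V] vw)
qed

end

text \<open>
  The assumption \<open>lact_F\<close> is graded quasi-commutativity in degrees 0 and 1; \<open>qF\<close> is the same in degrees 1
  and 0.  The two are independent, since \<open>R\<close> need not be triangular.
\<close>

locale connection_sum = hom_connection K H R A W F P \<delta> D
  for K and H :: "('k, 'h, 'p) hopf_scheme" (structure) and R
    and A :: "('k, 'h, 'a, 'n) hmod_scheme"
    and W :: "('k, 'h, 'a, 'w, 'm1) hbimod_scheme" and F :: "('k, 'h, 'a, 'o, 'm2) hbimod_scheme"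
    and P and \<delta> and D +
  fixes V :: "('k, 'h, 'a, 'v, 'm3) hbimod_scheme" and D\<^sub>V :: "'v \<Rightarrow> ('v, 'o) tens"
  assumes V: "h_bimodule K H A V"
    and lact_F: "\<And>a \<theta>. a \<in> carrier A \<Longrightarrow> \<theta> \<in> carrier F \<Longrightarrow>
      lact F a \<theta> = tens_lift F (\<lambda>r s. ract F (hact F r \<theta>) (hact A s a)) R'"
    and DV: "k_linear K V (tensor_A H A V F) D\<^sub>V"
    and DV_ract: "\<And>v a. v \<in> carrier V \<Longrightarrow> a \<in> carrier A \<Longrightarrow>
      D\<^sub>V (ract V v a) = ract (tensor_A H A V F) (D\<^sub>V v) a \<oplus>\<^bsub>tensor_A H A V F\<^esub> pure_A A V F v (\<delta> a)"
begin

text \<open>\<open>lact_F\<close> is inverted as in \<open>lact_quasi_commutative\<close>. Here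
  R^\<alpha> acts on the form and R_\<alpha> on the algebra element, the distribution in which they
  occur in the inverse braiding.\<close>

lemma ract_F:
  assumes a: "a \<in> carrier A" "\<theta> \<in> carrier F"
  shows "ract F \<theta> a = tens_lift F (\<lambda>r s. lact F (hact A s a) (hact F r \<theta>)) R"
proof -
  have "ract F \<theta> a = tens_lift F (\<lambda>r s. tens_lift F (\<lambda>r' s'.
      ract F (hact F r' (hact F r \<theta>)) (hact A s' (hact A s a))) R') R"
    by (rule act_R_R'(1) [symmetric]) (simp_all add: lin F a ract_bilinear [OF F])
  also have "\<dots> = tens_lift F (\<lambda>r s. lact F (hact A s a) (hact F r \<theta>)) R"
    by (intro lift_cong) (simp_all add: linR F a lact_F)
  finally show ?thesis .
qed

text \<open>The inverse braiding as a function of two arguments, available before balancing is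
  known; \<open>braid_balanced\<close> then lets it descend.\<close>

definition "braid \<theta> w = tens_lift P (\<lambda>r s. hact W s w \<otimes>\<otimes> hact F r \<theta>) R"

lemma braid_bilinear: "k_bilinear K F W P braid"
  unfolding braid_def by (simp add: rulesD)

lemmas rulesB = rulesE k_bilinear_left [OF braid_bilinear] k_bilinear_right [OF braid_bilinear]
  k_bilinear_closed [OF braid_bilinear] P
lemmas opsP = lact_tensor_A(2) [OF W F P_def] ract_tensor_A(2) [OF W F P_def]
lemmas balP = pure_A_balanced [OF k_algebra_A W F]

text \<open>The action on wa splits the second leg of R; by (id \<otimes> \<Delta>)(R) = R_13 R_12
  one copy acts on w and one on a. After balancing, the copy on a meets the form, and
  \<open>ract_F\<close> turns it into right multiplication by a.\<close>

lemma braid_ract: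
  assumes a: "\<theta> \<in> carrier F" "w \<in> carrier W" "a \<in> carrier A"
  shows "braid \<theta> (ract W w a) = ract P (braid \<theta> w) a"
proof -
  note rules = rulesB a
  let ?f = "\<lambda>r y y'. ract W (hact W y w) (hact A y' a) \<otimes>\<otimes> hact F r \<theta>"
  have "braid \<theta> (ract W w a) = tens_lift P (\<lambda>r s. tens_lift P (?f r) (comult H s)) R"
    unfolding braid_def
    by (intro lift_cong hact_ract_apply [OF W, where h = "\<lambda>t. t \<otimes>\<otimes> hact F _ \<theta>"]) (simp_all add: rules)
  also have "\<dots> = tens_lift P (\<lambda>r s. tens_lift P (\<lambda>r' s'. ?f (r \<otimes> r') s' s) R) R"
    by (rule hex2_lift) (simp_all add: rules)
  also have "\<dots> = tens_lift P (\<lambda>r' s'. tens_lift P (\<lambda>r s. ?f (r \<otimes> r') s' s) R) R"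
    by (rule lift_swap) (simp_all add: rules)
  also have "\<dots> = tens_lift P (\<lambda>r' s'. ract P (hact W s' w \<otimes>\<otimes> hact F r' \<theta>) a) R"
  proof (rule lift_cong)
    fix r' s' assume rs': "r' \<in> carrier H" "s' \<in> carrier H"
    have "tens_lift P (\<lambda>r s. ?f (r \<otimes> r') s' s) R =
      tens_lift P (\<lambda>r s. hact W s' w \<otimes>\<otimes> lact F (hact A s a) (hact F r (hact F r' \<theta>))) R"
      by (rule lift_cong) (simp_all add: rules rs' balP h_module.hact_mult [of K H F])
    also have "\<dots> = hact W s' w \<otimes>\<otimes> ract F (hact F r' \<theta>) a"
      using rs' by (simp add: ract_F rules, intro lift_apply [symmetric]) (simp_all add: rules)
    also have "\<dots> = ract P (hact W s' w \<otimes>\<otimes> hact F r' \<theta>) a"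
      using rs' by (simp add: opsP rules)
    finally show "tens_lift P (\<lambda>r s. ?f (r \<otimes> r') s' s) R = \<dots>" .
  qed (simp_all add: rules)
  also have "\<dots> = ract P (braid \<theta> w) a"
    unfolding braid_def by (rule lift_apply [where h = "\<lambda>X. ract P X a", symmetric]) (simp_all add: rules)
  finally show ?thesis .
qed

text \<open>Here the first leg is split; by (\<Delta> \<otimes> id)(R) = R_13 R_23 one copy pairs a
  with w. Balancing puts a to the right of w, where quasi-commutativity of W makes it a left
  action.\<close>

lemma braid_lact:
  assumes a: "\<theta> \<in> carrier F" "w \<in> carrier W" "a \<in> carrier A"
  shows "braid (lact F a \<theta>) w = lact P a (braid \<theta> w)"
proof -
  note rules = rulesB a
  let ?f = "\<lambda>u v s. hact W s w \<otimes>\<otimes> lact F (hact A u a) (hact F v \<theta>)"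
  have "braid (lact F a \<theta>) w = tens_lift P (\<lambda>r s. tens_lift P (\<lambda>u v. ?f u v s) (comult H r)) R"
    unfolding braid_def
    by (intro lift_cong hact_lact_apply [OF F, where h = "\<lambda>t. hact W _ w \<otimes>\<otimes> t"]) (simp_all add: rules)
  also have "\<dots> = tens_lift P (\<lambda>r s. tens_lift P (\<lambda>r' s'. ?f r r' (s \<otimes> s')) R) R"
    by (rule hex1_lift) (simp_all add: rules)
  also have "\<dots> = tens_lift P (\<lambda>r' s'. tens_lift P (\<lambda>r s. ?f r r' (s \<otimes> s')) R) R"
    by (rule lift_swap) (simp_all add: rules)
  also have "\<dots> = tens_lift P (\<lambda>r' s'. lact P a (hact W s' w \<otimes>\<otimes> hact F r' \<theta>)) R"
  proof (rule lift_cong)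
    fix r' s' assume rs': "r' \<in> carrier H" "s' \<in> carrier H"
    have "tens_lift P (\<lambda>r s. ?f r r' (s \<otimes> s')) R =
      tens_lift P (\<lambda>r s. ract W (hact W s (hact W s' w)) (hact A r a) \<otimes>\<otimes> hact F r' \<theta>) R"
      by (rule lift_cong) (simp_all add: rules rs' balP h_module.hact_mult [OF hW])
    also have "\<dots> = lact W a (hact W s' w) \<otimes>\<otimes> hact F r' \<theta>"
      using rs' by (simp add: lact_quasi_commutative [OF W qW] rules, intro lift_apply [where h = "\<lambda>t. t \<otimes>\<otimes> _", symmetric])
        (simp_all add: rules)
    also have "\<dots> = lact P a (hact W s' w \<otimes>\<otimes> hact F r' \<theta>)"
      using rs' by (simp add: opsP rules)
    finally show "tens_lift P (\<lambda>r s. ?f r r' (s \<otimes> s')) R = \<dots>" .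
  qed (simp_all add: rules)
  also have "\<dots> = lact P a (braid \<theta> w)"
    unfolding braid_def by (rule lift_apply [where h = "lact P a", symmetric]) (simp_all add: rules)
  finally show ?thesis .
qed

text \<open>The same hexagon splits off a copy of R between w and a. The right action on the form is
  absorbed into the braiding by \<open>braid_ract\<close>, and the remaining (R_\<alpha>
  w)(R^\<alpha> a) is aw by quasi-commutativity.\<close>

lemma braid_balanced:
  assumes a: "\<theta> \<in> carrier F" "a \<in> carrier A" "w \<in> carrier W"
  shows "braid (ract F \<theta> a) w = braid \<theta> (lact W a w)"
proof -
  note rules = rulesB a
  let ?f = "\<lambda>u v s. hact W s w \<otimes>\<otimes> ract F (hact F u \<theta>) (hact A v a)"
  have "braid (ract F \<theta> a) w = tens_lift P (\<lambda>r s. tens_lift P (\<lambda>u v. ?f u v s) (comult H r)) R"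
    unfolding braid_def
    by (intro lift_cong hact_ract_apply [OF F, where h = "\<lambda>t. hact W _ w \<otimes>\<otimes> t"]) (simp_all add: rules)
  also have "\<dots> = tens_lift P (\<lambda>r s. tens_lift P (\<lambda>r' s'. ?f r r' (s \<otimes> s')) R) R"
    by (rule hex1_lift) (simp_all add: rules)
  also have "\<dots> = tens_lift P (\<lambda>r' s'. tens_lift P (\<lambda>r s. ?f r r' (s \<otimes> s')) R) R"
    by (rule lift_swap) (simp_all add: rules)
  also have "\<dots> = tens_lift P (\<lambda>r' s'. braid \<theta> (ract W (hact W s' w) (hact A r' a))) R"
  proof (rule lift_cong)
    fix r' s' assume rs': "r' \<in> carrier H" "s' \<in> carrier H"
    have "tens_lift P (\<lambda>r s. ?f r r' (s \<otimes> s')) R =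
      tens_lift P (\<lambda>r s. ract P (hact W s (hact W s' w) \<otimes>\<otimes> hact F r \<theta>) (hact A r' a)) R"
      by (rule lift_cong) (simp_all add: rules rs' opsP h_module.hact_mult [OF hW])
    also have "\<dots> = ract P (braid \<theta> (hact W s' w)) (hact A r' a)"
      unfolding braid_def
      by (rule lift_apply [where h = "\<lambda>X. ract P X _", symmetric]) (simp_all add: rules rs')
    finally show "tens_lift P (\<lambda>r s. ?f r r' (s \<otimes> s')) R = braid \<theta> (ract W (hact W s' w) (hact A r' a))"
      using rs' by (simp add: braid_ract rules)
  qed (simp_all add: rules)
  also have "\<dots> = braid \<theta> (lact W a w)"
    unfolding lact_quasi_commutative [OF W qW a(3,2)]
    by (rule lift_apply [where h = "braid \<theta>", symmetric]) (simp_all add: rules k_bilinearD(1) [OF braid_bilinear])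
  finally show ?thesis .
qed

section \<open>The inverse braiding on the second and third factors\<close>

abbreviation (input) "FW \<equiv> tensor_A H A F W"
abbreviation (input) "VF \<equiv> tensor_A H A V F"
abbreviation (input) "VP \<equiv> tensor_A H A V P"
abbreviation (input) "V_FW \<equiv> tensor_A H A V (tensor_A H A F W)"
abbreviation (input) "U \<equiv> tensor_A H A V W"
abbreviation (input) "UF \<equiv> tensor_A H A (tensor_A H A V W) F"
abbreviation (input) "VF_W \<equiv> tensor_A H A (tensor_A H A V F) W"

lemmas bims = V W F P h_bimodule_tensor_A [OF F W] h_bimodule_tensor_A [OF V F] h_bimodule_tensor_A [OF V P]
  h_bimodule_tensor_A [OF V W]
lemmas bims2 = h_bimodule_tensor_A [OF V h_bimodule_tensor_A [OF F W]]
   h_bimodule_tensor_A [OF h_bimodule_tensor_A [OF V W] F]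
   h_bimodule_tensor_A [OF h_bimodule_tensor_A [OF V F] W]

lemma ainv: "k_linear K VP UF (tensor_assoc_inv H A V W F)"
    "\<And>v w \<theta>. v \<in> carrier V \<Longrightarrow> w \<in> carrier W \<Longrightarrow> \<theta> \<in> carrier F \<Longrightarrow>
      tensor_assoc_inv H A V W F (pure_A A V P v (w \<otimes>\<otimes> \<theta>)) = pure_A A U F (pure_A A V W v w) \<theta>"
    "\<And>X a. X \<in> carrier VP \<Longrightarrow> a \<in> carrier A \<Longrightarrow>
      tensor_assoc_inv H A V W F (ract VP X a) = ract UF (tensor_assoc_inv H A V W F X) a"
  using tensor_assoc_inv_linear [OF V W F] tensor_assoc_inv_pure [OF V W F] tensor_assoc_inv_ract [OF V W F]
  by (simp_all add: P_def)

lemmas rulesS = rulesB bims bims2 k_linear_comp [OF ainv(1)] ainv(1) k_linearD(1) [OF ainv(1)]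
  k_linear_comp [OF DV] k_linearD(1) [OF DV]

lemma inv_braiding_pure:
  "k_linear K FW P (inv_braiding H R A F W)"
  "\<theta> \<in> carrier F \<Longrightarrow> w \<in> carrier W \<Longrightarrow> inv_braiding H R A F W (pure_A A F W \<theta> w) = braid \<theta> w"
proof -
  have eq: "inv_braiding H R A F W = tens_lift P (\<lambda>\<theta> w. braid \<theta> w)"
    unfolding inv_braiding_def braid_def P_def [symmetric] by (rule refl)
  show "k_linear K FW P (inv_braiding H R A F W)"
    unfolding eq
    by (rule tens_lift_A_linear [OF k_algebra_A F W mP]) (simp_all add: braid_bilinear braid_balanced)
  show "inv_braiding H R A F W (pure_A A F W \<theta> w) = braid \<theta> w"
    if "\<theta> \<in> carrier F" "w \<in> carrier W"
    unfolding eq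
    by (rule tens_lift_A_pure [OF k_algebra_A F W mP _ _ that]) (simp_all add: braid_bilinear braid_balanced)
qed

lemmas rulesS2 = rulesS k_linear_comp [OF inv_braiding_pure(1)] inv_braiding_pure(1) k_linearD(1) [OF inv_braiding_pure(1)]

text \<open>Left linearity over \<open>A\<close>, inherited from \<open>braid_lact\<close>, is what
  lets the map be tensored over \<open>A\<close> with the identity of V.\<close>

lemma inv_braiding_lact:
  assumes y: "y \<in> carrier FW" and a: "a \<in> carrier A"
  shows "inv_braiding H R A F W (lact FW a y) = lact P a (inv_braiding H R A F W y)"
  by (rule tensor_A_eqI [OF k_algebra_A F W, where U = P, OF _ _ y])
     (use a in \<open>simp_all add: rulesS2 lact_tensor_A(2) [OF F W refl] inv_braiding_pure braid_lact\<close>)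

lemma id_tensor_inv_braiding:
  "k_linear K V_FW VP (tens_lift VP (\<lambda>v y. pure_A A V P v (inv_braiding H R A F W y)))"
  "v \<in> carrier V \<Longrightarrow> y \<in> carrier FW \<Longrightarrow>
    tens_lift VP (\<lambda>v y. pure_A A V P v (inv_braiding H R A F W y)) (pure_A A V FW v y) =
    pure_A A V P v (inv_braiding H R A F W y)"
proof -
  have b: "k_bilinear K V FW VP (\<lambda>v y. pure_A A V P v (inv_braiding H R A F W y))"
    by (simp add: rulesS2)
  have c: "pure_A A V P (ract V v a) (inv_braiding H R A F W y) = pure_A A V P v (inv_braiding H R A F W (lact FW a y))"
    if "v \<in> carrier V" "a \<in> carrier A" "y \<in> carrier FW" for v a y
    using that by (simp add: rulesS2 inv_braiding_lact pure_A_balanced [OF k_algebra_A V P])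
  show "k_linear K V_FW VP (tens_lift VP (\<lambda>v y. pure_A A V P v (inv_braiding H R A F W y)))"
    by (rule tens_lift_A_linear [OF k_algebra_A V _ _ b]) (simp_all add: rulesS2 c)
  show "tens_lift VP (\<lambda>v y. pure_A A V P v (inv_braiding H R A F W y)) (pure_A A V FW v y) =
      pure_A A V P v (inv_braiding H R A F W y)" if "v \<in> carrier V" "y \<in> carrier FW"
    by (rule tens_lift_A_pure [OF k_algebra_A V _ _ b _ that]) (simp_all add: rulesS2 c)
qed

definition "tau23 = inv_braiding_23 H R A V F W"

lemma tau23_eq: "tau23 X = tensor_assoc_inv H A V W F
    (tens_lift VP (\<lambda>v y. pure_A A V P v (inv_braiding H R A F W y)) (tensor_assoc H A V F W X))"
  by (simp add: tau23_def inv_braiding_23_def P_def)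

lemma tau23_linear: "k_linear K VF_W UF tau23"
  unfolding tau23_eq [abs_def]
  by (intro k_linear_comp [OF ainv(1)] k_linear_comp [OF id_tensor_inv_braiding(1)] tensor_assoc_linear [OF V F W])

lemma tau23_pure:
  "v \<in> carrier V \<Longrightarrow> \<theta> \<in> carrier F \<Longrightarrow> w \<in> carrier W \<Longrightarrow>
    tau23 (pure_A A VF W (pure_A A V F v \<theta>) w) = tensor_assoc_inv H A V W F (pure_A A V P v (braid \<theta> w))"
  by (simp add: tau23_eq tensor_assoc_pure [OF V F W] id_tensor_inv_braiding inv_braiding_pure rulesS2)

lemmas rulesS3 = rulesS2 k_linear_comp [OF tau23_linear] k_linearD(1) [OF tau23_linear]

text \<open>Inherited from \<open>braid_ract\<close> and the right linearity of the rebracketing.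
  Consequently the first summand contributes no inhomogeneous term to the Leibniz rule on V
  \<otimes>_A W.\<close>

lemma tau23_ract:
  assumes X: "X \<in> carrier VF" and a: "w \<in> carrier W" "a \<in> carrier A"
  shows "tau23 (pure_A A VF W X (ract W w a)) = ract UF (tau23 (pure_A A VF W X w)) a"
  by (rule tensor_A_eqI [OF k_algebra_A V F, where U = UF, OF _ _ X])
     (use a in \<open>simp_all add: rulesS3 tau23_pure braid_ract ract_tensor_A(2) [OF V P refl, symmetric] ainv(3) [symmetric]\<close>)

section \<open>Balancing and Leibniz rule of the sum\<close>

definition "left_summand v w = tau23 (pure_A A VF W (D\<^sub>V v) w)"
definition "right_summand v w = tens_lift UF (\<lambda>r s. tensor_assoc_inv H A V W F (pure_A A V P (hact V r v) (hD s w))) R'"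

lemma summand_bilinear: "k_bilinear K V W UF left_summand" "k_bilinear K V W UF right_summand"
  unfolding left_summand_def right_summand_def by (simp_all add: rulesS3)

definition "sum_map v w = left_summand v w \<oplus>\<^bsub>UF\<^esub> right_summand v w"

lemma mUF: "module K UF" by (simp add: rulesS3)

lemma sum_map_bilinear: "k_bilinear K V W UF sum_map"
  unfolding sum_map_def
  by (intro k_bilinearI k_linear_add [OF mUF] k_bilinearD [OF summand_bilinear(1)] k_bilinearD [OF summand_bilinear(2)])

lemmas rulesG = rulesS3 mUF k_bilinear_closed [OF summand_bilinear(1)] k_bilinear_closed [OF summand_bilinear(2)]
  k_linear_add [OF mUF] k_linear_smult [OF mUF] module.smult_closed [OF mUF]

lemma sum_map_balanced:
  assumes a: "v \<in> carrier V" "a \<in> carrier A" "w \<in> carrier W"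
  shows "sum_map (ract V v a) w = sum_map v (lact W a w)"
proof -
  interpret UF: module K UF by (rule mUF)
  note rules = rulesG a
  let ?i = "tensor_assoc_inv H A V W F"
  let ?p = "pure_A A V P"
  note add = k_linearD(2) [OF tau23_linear] k_linearD(2) [OF ainv(1)]
  \<comment> \<open>The term v \<otimes> da of the Leibniz rule for \<open>D\<^sub>V\<close> passes
    through \<open>tau23\<close>, where da and w are braided into the correction.\<close>
  have 1: "left_summand (ract V v a) w = left_summand v (lact W a w) \<oplus>\<^bsub>UF\<^esub> ?i (?p v (correction a w))"
  proof -
    have "left_summand (ract V v a) w = tau23 (pure_A A VF W (ract VF (D\<^sub>V v) a \<oplus>\<^bsub>VF\<^esub> pure_A A V F v (\<delta> a)) w)"
      by (simp add: left_summand_def DV_ract a)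
    also have "\<dots> = tau23 (pure_A A VF W (ract VF (D\<^sub>V v) a) w \<oplus>\<^bsub>VF_W\<^esub> pure_A A VF W (pure_A A V F v (\<delta> a)) w)"
      by (subst k_linearD(2) [OF k_bilinearD(2) [OF pure_A_bilinear [OF k_algebra_A bims(6) W] a(3)]])
         (simp_all add: rules)
    also have "\<dots> = tau23 (pure_A A VF W (ract VF (D\<^sub>V v) a) w) \<oplus>\<^bsub>UF\<^esub> tau23 (pure_A A VF W (pure_A A V F v (\<delta> a)) w)"
      by (rule add) (simp_all add: rules)
    also have "tau23 (pure_A A VF W (ract VF (D\<^sub>V v) a) w) = left_summand v (lact W a w)"
      by (simp add: left_summand_def pure_A_balanced [OF k_algebra_A bims(6) W] rules)
    also have "tau23 (pure_A A VF W (pure_A A V F v (\<delta> a)) w) = ?i (?p v (braid (\<delta> a) w))"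
      by (simp add: tau23_pure rules)
    also have "braid (\<delta> a) w = correction a w"
      unfolding braid_def correction_def by (rule lift_cong) (simp_all add: rules hact_\<delta>)
    finally show ?thesis .
  qed
  \<comment> \<open>For each leg s of R', \<open>hom_act_lact\<close> expands s
    \<blacktriangleright> D on aw into a term with a second copy of R' and \<epsilon>(s) times the
    correction.\<close>
  have 2: "right_summand v (lact W a w) = right_summand (ract V v a) w \<oplus>\<^bsub>UF\<^esub> ?i (?p v (correction a w))"
  proof -
    let ?f = "\<lambda>x y z. ?i (?p (hact V x v) (lact P (hact A y a) (hD z w)))"
    have "right_summand v (lact W a w) = tens_lift UF (\<lambda>r s. ?i (?p (hact V r v)
        (tens_lift P (\<lambda>r' s'. lact P (hact A r' a) (hD (s' \<otimes> s) w)) R' \<oplus>\<^bsub>P\<^esub> counit H s \<odot>\<^bsub>P\<^esub> correction a w))) R'"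
      unfolding right_summand_def by (rule lift_cong) (simp_all add: rules hom_act_lact)
    also have "\<dots> = tens_lift UF (\<lambda>r s. tens_lift UF (\<lambda>r' s'. ?f r r' (s' \<otimes> s)) R' \<oplus>\<^bsub>UF\<^esub>
        counit H s \<odot>\<^bsub>UF\<^esub> ?i (?p (hact V r v) (correction a w))) R'"
    proof (rule lift_cong)
      fix r s assume rs: "r \<in> carrier H" "s \<in> carrier H"
      have l: "k_linear K P UF (\<lambda>t. ?i (?p (hact V r v) t))" by (simp add: rules rs)
      have "?i (?p (hact V r v) (tens_lift P (\<lambda>r' s'. lact P (hact A r' a) (hD (s' \<otimes> s) w)) R' \<oplus>\<^bsub>P\<^esub>
          counit H s \<odot>\<^bsub>P\<^esub> correction a w)) =
        ?i (?p (hact V r v) (tens_lift P (\<lambda>r' s'. lact P (hact A r' a) (hD (s' \<otimes> s) w)) R')) \<oplus>\<^bsub>UF\<^esub>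
        ?i (?p (hact V r v) (counit H s \<odot>\<^bsub>P\<^esub> correction a w))"
        by (rule k_linearD(2) [OF l]) (simp_all add: rules rs)
      also have "?i (?p (hact V r v) (tens_lift P (\<lambda>r' s'. lact P (hact A r' a) (hD (s' \<otimes> s) w)) R')) =
         tens_lift UF (\<lambda>r' s'. ?f r r' (s' \<otimes> s)) R'"
        by (rule lift_apply [OF _ _ _ l]) (simp_all add: rules rs)
      also have "?i (?p (hact V r v) (counit H s \<odot>\<^bsub>P\<^esub> correction a w)) = counit H s \<odot>\<^bsub>UF\<^esub> ?i (?p (hact V r v) (correction a w))"
        by (rule k_linearD(3) [OF l]) (simp_all add: rules rs)
      finally show "?i (?p (hact V r v) (tens_lift P (\<lambda>r' s'. lact P (hact A r' a) (hD (s' \<otimes> s) w)) R' \<oplus>\<^bsub>P\<^esub>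
          counit H s \<odot>\<^bsub>P\<^esub> correction a w)) =
        tens_lift UF (\<lambda>r' s'. ?f r r' (s' \<otimes> s)) R' \<oplus>\<^bsub>UF\<^esub> counit H s \<odot>\<^bsub>UF\<^esub> ?i (?p (hact V r v) (correction a w))" .
    qed (simp_all add: rules)
    also have "\<dots> = tens_lift UF (\<lambda>r s. tens_lift UF (\<lambda>r' s'. ?f r r' (s' \<otimes> s)) R') R' \<oplus>\<^bsub>UF\<^esub>
       tens_lift UF (\<lambda>r s. counit H s \<odot>\<^bsub>UF\<^esub> ?i (?p (hact V r v) (correction a w))) R'"
      by (rule lift_add) (simp_all add: rules)
    \<comment> \<open>(id \<otimes> \<epsilon>)(R') = 1 removes R' from the correction, which is
      left standing beside the bare v.\<close>
    also have "tens_lift UF (\<lambda>r s. counit H s \<odot>\<^bsub>UF\<^esub> ?i (?p (hact V r v) (correction a w))) R' = ?i (?p (hact V \<one> v) (correction a w))"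
      by (rule counit_right_R' [where f = "\<lambda>r. ?i (?p (hact V r v) (correction a w))"]) (simp_all add: rules)
    also have "hact V \<one> v = v" by (simp add: h_module.hact_one [of K H V] rules)
    \<comment> \<open>The copy applied to a multiplies s from the left, so its sum must become the
      outer one; the product is then R'_23 R'_13 in the order of \<open>hex1'_lift\<close>.\<close>
    also have "tens_lift UF (\<lambda>r s. tens_lift UF (\<lambda>r' s'. ?f r r' (s' \<otimes> s)) R') R' =
      tens_lift UF (\<lambda>r' s'. tens_lift UF (\<lambda>r s. ?f r r' (s' \<otimes> s)) R') R'"
      by (rule lift_swap) (simp_all add: rules)
    also have "\<dots> = tens_lift UF (\<lambda>r s. tens_lift UF (\<lambda>u v. ?f u v s) (comult H r)) R'"
      by (rule hex1'_lift [symmetric]) (simp_all add: rules)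
    \<comment> \<open>The two parts of the split leg act on v and on a; by balancing over
      \<open>A\<close> together they are the action on va.\<close>
    also have "\<dots> = right_summand (ract V v a) w"
      unfolding right_summand_def
    proof (rule lift_cong)
      fix r s assume rs: "r \<in> carrier H" "s \<in> carrier H"
      have "?i (?p (hact V r (ract V v a)) (hD s w)) =
        tens_lift UF (\<lambda>x y. ?i (?p (ract V (hact V x v) (hact A y a)) (hD s w))) (comult H r)"
        by (rule hact_ract_apply [OF V, where h = "\<lambda>t. ?i (?p t (hD s w))"]) (simp_all add: rules rs)
      also have "\<dots> = tens_lift UF (\<lambda>u v. ?f u v s) (comult H r)"
        by (rule lift_cong) (simp_all add: rules rs pure_A_balanced [OF k_algebra_A V P])
      finally show "tens_lift UF (\<lambda>u v. ?f u v s) (comult H r) = ?i (?p (hact V r (ract V v a)) (hD s w))" by simp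
    qed (simp_all add: rules)
    finally show ?thesis .
  qed
  \<comment> \<open>The same correction is added to the left summand on one side and to the right
    summand on the other.\<close>
  show ?thesis
    unfolding sum_map_def 1 2 by (rule trans [OF UF.a_assoc]) (simp_all add: rules UF.a_comm)
qed

text \<open>The first summand is right linear by \<open>tau23_ract\<close>. In the second,
  \<open>hom_act_ract\<close> adds \<epsilon>(s) times w \<otimes> da for each leg s of R', and (id
  \<otimes> \<epsilon>)(R') = 1 leaves v \<otimes> w \<otimes> da.\<close>

lemma sum_map_ract:
  assumes a: "v \<in> carrier V" "w \<in> carrier W" "a \<in> carrier A"
  shows "sum_map v (ract W w a) = ract UF (sum_map v w) a \<oplus>\<^bsub>UF\<^esub> pure_A A U F (pure_A A V W v w) (\<delta> a)"
proof -
  interpret UF: module K UF by (rule mUF)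
  note rules = rulesG a
  let ?i = "tensor_assoc_inv H A V W F"
  let ?p = "pure_A A V P"
  have rl: "k_linear K UF UF (\<lambda>X. ract UF X a)" by (simp add: rules)
  have 1: "left_summand v (ract W w a) = ract UF (left_summand v w) a"
    by (simp add: left_summand_def tau23_ract rules)
  have "right_summand v (ract W w a) = tens_lift UF (\<lambda>r s. ract UF (?i (?p (hact V r v) (hD s w))) a \<oplus>\<^bsub>UF\<^esub>
      counit H s \<odot>\<^bsub>UF\<^esub> ?i (?p (hact V r v) (w \<otimes>\<otimes> \<delta> a))) R'"
    unfolding right_summand_def
  proof (rule lift_cong)
    fix r s assume rs: "r \<in> carrier H" "s \<in> carrier H"
    have l: "k_linear K P UF (\<lambda>t. ?i (?p (hact V r v) t))" by (simp add: rules rs)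
    have "?i (?p (hact V r v) (hD s (ract W w a))) =
      ?i (?p (hact V r v) (ract P (hD s w) a)) \<oplus>\<^bsub>UF\<^esub> ?i (?p (hact V r v) (counit H s \<odot>\<^bsub>P\<^esub> (w \<otimes>\<otimes> \<delta> a)))"
      unfolding hom_act_ract [OF rs(2) a(2,3)] by (rule k_linearD(2) [OF l]) (simp_all add: rules rs)
    also have "?i (?p (hact V r v) (ract P (hD s w) a)) = ract UF (?i (?p (hact V r v) (hD s w))) a"
      using rs by (simp add: rules ract_tensor_A(2) [OF V P refl, symmetric] ainv(3))
    also have "?i (?p (hact V r v) (counit H s \<odot>\<^bsub>P\<^esub> (w \<otimes>\<otimes> \<delta> a))) =
        counit H s \<odot>\<^bsub>UF\<^esub> ?i (?p (hact V r v) (w \<otimes>\<otimes> \<delta> a))"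
      by (rule k_linearD(3) [OF l]) (simp_all add: rules rs)
    finally show "?i (?p (hact V r v) (hD s (ract W w a))) =
        ract UF (?i (?p (hact V r v) (hD s w))) a \<oplus>\<^bsub>UF\<^esub> counit H s \<odot>\<^bsub>UF\<^esub> ?i (?p (hact V r v) (w \<otimes>\<otimes> \<delta> a))" .
  qed (simp_all add: rules)
  also have "\<dots> = tens_lift UF (\<lambda>r s. ract UF (?i (?p (hact V r v) (hD s w))) a) R' \<oplus>\<^bsub>UF\<^esub>
      tens_lift UF (\<lambda>r s. counit H s \<odot>\<^bsub>UF\<^esub> ?i (?p (hact V r v) (w \<otimes>\<otimes> \<delta> a))) R'"
    by (rule lift_add) (simp_all add: rules)
  also have "tens_lift UF (\<lambda>r s. ract UF (?i (?p (hact V r v) (hD s w))) a) R' = ract UF (right_summand v w) a"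
    unfolding right_summand_def by (rule lift_apply [OF _ _ _ rl, symmetric]) (simp_all add: rules)
  also have "tens_lift UF (\<lambda>r s. counit H s \<odot>\<^bsub>UF\<^esub> ?i (?p (hact V r v) (w \<otimes>\<otimes> \<delta> a))) R' = ?i (?p (hact V \<one> v) (w \<otimes>\<otimes> \<delta> a))"
    by (rule counit_right_R' [where f = "\<lambda>r. ?i (?p (hact V r v) (w \<otimes>\<otimes> \<delta> a))"]) (simp_all add: rules)
  also have "\<dots> = pure_A A U F (pure_A A V W v w) (\<delta> a)"
    by (simp add: h_module.hact_one [of K H V] rules ainv(2))
  finally show ?thesis
    unfolding sum_map_def 1 by (simp add: k_linearD(2) [OF rl] rules UF.a_assoc)
qed

text \<open>The counterpart of \<open>connection_sum_hat\<close> for the abstract \<open>F\<close>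
  and \<open>P\<close>; with one-forms for \<open>F\<close> both unfold to the same
  expression.\<close>

definition "sum_hat X = inv_braiding_23 H R A V F W (tensor_proj H A VF W (map_tensor_R K H R V W VF W D\<^sub>V id X))
    \<oplus>\<^bsub>UF\<^esub> tensor_assoc_inv H A V W F (tensor_proj H A V P (map_tensor_R K H R V W V P id D X))"

lemma id_linear: "k_linear K X X id"
  by (simp add: k_linear_def)

lemma hV: "h_module K H V" by (rule h_bimodule_imp_h_module [OF V])
lemma hVF: "h_module K H VF" by (rule h_bimodule_imp_h_module [OF bims(6)])

lemma sum_hat_linear: "k_linear K (tensor_K K V W) UF sum_hat"
  unfolding sum_hat_def [abs_def] tau23_def [symmetric]
  by (intro k_linear_add [OF mUF] k_linear_comp [OF tau23_linear] k_linear_comp [OF ainv(1)]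
      k_linear_comp [OF tensor_proj_linear(1)] map_tensor_R(1) k_algebra_A hV hW hVF hP bims id_linear D DV)

text \<open>In the first summand \<open>map_tensor_R_id\<close> removes R'; in the second the sum
  over R' commutes with the projection and the rebracketing, which are linear.\<close>

lemma sum_hat_pure:
  assumes vw: "v \<in> carrier V" "w \<in> carrier W"
  shows "sum_hat (pure_K K V W v w) = sum_map v w"
proof -
  note rules = rulesG vw
  have 1: "tau23 (tensor_proj H A VF W (map_tensor_R K H R V W VF W D\<^sub>V id (pure_K K V W v w))) = left_summand v w"
    unfolding left_summand_def map_tensor_R_id [OF hV hW hVF DV vw]
    by (simp add: tensor_proj_linear(2) [OF k_algebra_A bims(6) W] rules)
  note l = k_linear_comp [OF ainv(1) tensor_proj_linear(1) [OF k_algebra_A V P]]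
  note mV = h_bimodule_imp_module [OF V]
  note b = pure_K_bilinear [OF mV mP]
  have "tensor_assoc_inv H A V W F (tensor_proj H A V P (map_tensor_R K H R V W V P id D (pure_K K V W v w))) =
      tens_lift UF (\<lambda>r s. tensor_assoc_inv H A V W F (tensor_proj H A V P (pure_K K V P (hact V r v) (hD s w)))) R'"
    unfolding map_tensor_R(2) [OF hV hW hV hP id_linear D vw] id_apply
    by (rule lift_apply [OF module_tensor_K [OF mV mP] mUF _ l R'_closed])
       (simp add: rules k_bilinear_left [OF b] k_bilinear_right [OF b])
  also have "\<dots> = right_summand v w"
    unfolding right_summand_def by (rule lift_cong) (simp_all add: tensor_proj_linear(2) [OF k_algebra_A V P] rules)
  finally show ?thesis
    unfolding sum_hat_def sum_map_def tau23_def [symmetric] 1 by simp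
qed

text \<open>Restricted to the carrier because members of \<open>connections\<close> are extensional;
  uniqueness can then be an equality of functions.\<close>

definition "sum_connection = restrict (tens_lift UF sum_map) (carrier U)"

lemma sum_connection:
  shows "k_linear K U UF sum_connection"
    and "v \<in> carrier V \<Longrightarrow> w \<in> carrier W \<Longrightarrow> sum_connection (pure_A A V W v w) = sum_map v w"
proof -
  have l: "k_linear K U UF (tens_lift UF sum_map)"
    by (rule tens_lift_A_linear [OF k_algebra_A V W mUF sum_map_bilinear sum_map_balanced])
  then show "k_linear K U UF sum_connection"
    unfolding sum_connection_def
    by (subst k_linear_cong [where g = "tens_lift UF sum_map"]) (simp_all add: rulesG)
  show "sum_connection (pure_A A V W v w) = sum_map v w" if "v \<in> carrier V" "w \<in> carrier W"
    using that tens_lift_A_pure [OF k_algebra_A V W mUF sum_map_bilinear sum_map_balanced that]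
    by (simp add: sum_connection_def rulesG)
qed

lemma sum_connection_ract:
  assumes X: "X \<in> carrier U" and a: "a \<in> carrier A"
  shows "sum_connection (ract U X a) = ract UF (sum_connection X) a \<oplus>\<^bsub>UF\<^esub> pure_A A U F X (\<delta> a)"
  by (rule tensor_A_eqI [OF k_algebra_A V W, where U = UF, OF _ _ X])
     (use a in \<open>simp_all add: rulesG k_linear_comp [OF sum_connection(1)] sum_connection
        ract_tensor_A(2) [OF V W refl] sum_map_ract\<close>)

lemma sum_connection_unique:
  assumes "k_linear K U UF C" "C \<in> extensional (carrier U)"
    and "\<And>v w. v \<in> carrier V \<Longrightarrow> w \<in> carrier W \<Longrightarrow> C (pure_A A V W v w) = sum_map v w"
  shows "C = sum_connection"
proof (rule extensionalityI [OF assms(2)])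
  show "sum_connection \<in> extensional (carrier U)" by (simp add: sum_connection_def)
  show "C X = sum_connection X" if "X \<in> carrier U" for X
    by (rule tensor_A_eqI [OF k_algebra_A V W assms(1) sum_connection(1) that])
       (simp add: assms(3) sum_connection(2))
qed

end

section \<open>The bimodule of one-forms\<close>

lemma one_form_bimod_sel [simp]:
  "carrier (one_form_bimod \<Omega>) = grade \<Omega> (Suc 0)" "ring.zero (one_form_bimod \<Omega>) = \<zero>\<^bsub>\<Omega>\<^esub>"
  "ring.add (one_form_bimod \<Omega>) = ring.add \<Omega>" "smult (one_form_bimod \<Omega>) = smult \<Omega>"
  "hact (one_form_bimod \<Omega>) = hact \<Omega>" "lact (one_form_bimod \<Omega>) = monoid.mult \<Omega>"
  "ract (one_form_bimod \<Omega>) = monoid.mult \<Omega>"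
  by (simp_all add: one_form_bimod_def)

locale covariant_calculus = hopf_algebra K H + calc: h_covariant_calculus K H A \<Omega>
  for K and H :: "('k, 'h, 'p) hopf_scheme" (structure)
    and A :: "('k, 'h, 'o, 'n) hmod_scheme" and \<Omega> :: "('k, 'h, 'o, 'm) dcalc_scheme"
begin

abbreviation (input) "F \<equiv> one_form_bimod \<Omega>"

lemma grade_subset: "x \<in> grade \<Omega> n \<Longrightarrow> x \<in> carrier \<Omega>"
  using module.submoduleE(1) [OF calc.\<Omega>.module_axioms calc.grade_submodule] by blast

lemma one_form_subset: "\<theta> \<in> grade \<Omega> (Suc 0) \<Longrightarrow> \<theta> \<in> carrier \<Omega>"
  by (rule grade_subset)

lemma A_grade: "a \<in> carrier A \<longleftrightarrow> a \<in> grade \<Omega> 0"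
  by (simp add: calc.grade_zero)

lemma A_subset: "a \<in> carrier A \<Longrightarrow> a \<in> carrier \<Omega>"
  by (simp add: A_grade grade_subset)

lemma one_form_mult:
  "a \<in> carrier A \<Longrightarrow> \<theta> \<in> grade \<Omega> (Suc 0) \<Longrightarrow> a \<otimes>\<^bsub>\<Omega>\<^esub> \<theta> \<in> grade \<Omega> (Suc 0)"
  "a \<in> carrier A \<Longrightarrow> \<theta> \<in> grade \<Omega> (Suc 0) \<Longrightarrow> \<theta> \<otimes>\<^bsub>\<Omega>\<^esub> a \<in> grade \<Omega> (Suc 0)"
  using calc.grade_mult [of a 0 \<theta> "Suc 0"] calc.grade_mult [of \<theta> "Suc 0" a 0] by (simp_all add: A_grade)

lemma module_one_form: "module K F"
proof -
  interpret G: module K "\<Omega>\<lparr>carrier := grade \<Omega> (Suc 0)\<rparr>"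
    by (rule submodule.submodule_is_module [OF calc.grade_submodule calc.\<Omega>.module_axioms])
  have "\<exists>y\<in>grade \<Omega> (Suc 0). y \<oplus>\<^bsub>\<Omega>\<^esub> x = \<zero>\<^bsub>\<Omega>\<^esub>" if "x \<in> grade \<Omega> (Suc 0)" for x
    using G.a_inv_closed [of x] G.l_neg [of x] that by auto
  then have "abelian_group F"
    using G.a_closed G.zero_closed G.a_assoc G.a_comm G.l_zero
    by (intro abelian_groupI) simp_all
  then show ?thesis
    using G.smult_closed G.smult_l_distr G.smult_r_distr G.smult_assoc1 G.smult_one
    by (intro moduleI is_cring) simp_all
qed

lemma one_form_incl: "k_linear K F \<Omega> (\<lambda>x. x)"
  by (rule k_linearI) (simp_all add: one_form_subset)

text \<open>The inclusion of \<Omega>^1 is linear and hence commutes with lifts. The axioms of the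
  calculus take their Sweedler sums in \<Omega>, whereas the bimodule of one-forms takes them in
  degree 1.\<close>

lemma lift_one_form:
  assumes "k_bilinear K H H F f" "X \<in> carrier (tensor2 K H)"
  shows "tens_lift \<Omega> f X = tens_lift F f X"
  by (rule lift_apply [OF module_one_form calc.\<Omega>.module_axioms assms(1) one_form_incl assms(2), symmetric])

lemma hact_\<Omega>_bilinear: "k_bilinear K H \<Omega> \<Omega> (hact \<Omega>)"
  by (rule hact_bilinear [OF h_module_algebra_imp_h_module [OF calc.\<Omega>.h_module_algebra_axioms]])

lemma h_module_one_form: "h_module K H F"
proof (intro h_module.intro module_one_form h_module_axioms.intro)
  show "k_linear K F F (hact F \<xi>)" if "\<xi> \<in> carrier H" for \<xi>
    using calc.\<Omega>.hact_linear [OF that] calc.hact_grade [OF that]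
    by (intro k_linearI) (simp_all add: one_form_subset k_linearD)
qed (simp_all add: one_form_subset calc.\<Omega>.hact_add calc.\<Omega>.hact_smult calc.\<Omega>.hact_mult calc.\<Omega>.hact_one)

lemma mult_bilinear:
  "k_bilinear K A F F (\<otimes>\<^bsub>\<Omega>\<^esub>)" "k_bilinear K F A F (\<otimes>\<^bsub>\<Omega>\<^esub>)"
  by (intro k_bilinearI k_linearI; simp add: one_form_mult A_subset one_form_subset calc.A_add calc.A_smult
      calc.\<Omega>.l_distr calc.\<Omega>.r_distr calc.\<Omega>.smult_mult_left calc.\<Omega>.smult_mult_right)+

lemma h_module_A: "h_module K H A"
  by (rule h_module_algebra_imp_h_module [OF calc.A.h_module_algebra_axioms])

lemma mult_act_bilinear:
  assumes "a \<in> carrier A" "\<theta> \<in> grade \<Omega> (Suc 0)"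
  shows "k_bilinear K H H F (\<lambda>x y. hact A x a \<otimes>\<^bsub>\<Omega>\<^esub> hact \<Omega> y \<theta>)"
    "k_bilinear K H H F (\<lambda>x y. hact \<Omega> x \<theta> \<otimes>\<^bsub>\<Omega>\<^esub> hact A y a)"
proof -
  note h = k_linear_hact [OF h_module_one_form, simplified] k_linear_hact [OF h_module_A] k_linear_ident
    hact_closed [OF h_module_A] calc.hact_grade assms
  note m = k_bilinear_left [OF mult_bilinear(1)] k_bilinear_right [OF mult_bilinear(1)]
    k_bilinear_left [OF mult_bilinear(2)] k_bilinear_right [OF mult_bilinear(2)]
  show "k_bilinear K H H F (\<lambda>x y. hact A x a \<otimes>\<^bsub>\<Omega>\<^esub> hact \<Omega> y \<theta>)"
    by (rule k_bilinearI; rule m; simp add: h)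
  show "k_bilinear K H H F (\<lambda>x y. hact \<Omega> x \<theta> \<otimes>\<^bsub>\<Omega>\<^esub> hact A y a)"
    by (rule k_bilinearI; rule m; simp add: h)
qed

text \<open>Both action rules come from the module algebra rule of \<Omega> for a product of an
  element of degree 0 and one of degree 1; \<open>A_hact\<close> identifies the actions on
  \<open>A\<close>, and \<open>lift_one_form\<close> moves the sum to degree 1.\<close>

lemma h_bimodule_one_form: "h_bimodule K H A F"
proof (intro h_bimodule.intro h_module_one_form h_bimodule_axioms.intro)
  fix \<xi> a v assume x: "\<xi> \<in> carrier H" "a \<in> carrier A" "v \<in> carrier F"
  then have v: "v \<in> grade \<Omega> (Suc 0)" by simp
  have "hact \<Omega> \<xi> (a \<otimes>\<^bsub>\<Omega>\<^esub> v) = tens_lift \<Omega> (\<lambda>\<xi>1 \<xi>2. hact \<Omega> \<xi>1 a \<otimes>\<^bsub>\<Omega>\<^esub> hact \<Omega> \<xi>2 v) (comult H \<xi>)"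
    by (rule calc.\<Omega>.hact_alg_mult [OF x(1) A_subset [OF x(2)] one_form_subset [OF v]])
  also have "\<dots> = tens_lift \<Omega> (\<lambda>\<xi>1 \<xi>2. hact A \<xi>1 a \<otimes>\<^bsub>\<Omega>\<^esub> hact \<Omega> \<xi>2 v) (comult H \<xi>)"
    using x(2) v hact_closed [OF h_module_A]
    by (intro lift_cong [OF calc.\<Omega>.module_axioms comult_closed [OF x(1)]])
       (simp_all add: calc.A_hact A_subset one_form_subset calc.hact_grade one_form_mult)
  finally show "hact F \<xi> (lact F a v) = tens_lift F (\<lambda>\<xi>1 \<xi>2. lact F (hact A \<xi>1 a) (hact F \<xi>2 v)) (comult H \<xi>)"
    by (simp add: lift_one_form [OF mult_act_bilinear(1) [OF x(2) v] comult_closed [OF x(1)]])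
  have "hact \<Omega> \<xi> (v \<otimes>\<^bsub>\<Omega>\<^esub> a) = tens_lift \<Omega> (\<lambda>\<xi>1 \<xi>2. hact \<Omega> \<xi>1 v \<otimes>\<^bsub>\<Omega>\<^esub> hact \<Omega> \<xi>2 a) (comult H \<xi>)"
    by (rule calc.\<Omega>.hact_alg_mult [OF x(1) one_form_subset [OF v] A_subset [OF x(2)]])
  also have "\<dots> = tens_lift \<Omega> (\<lambda>\<xi>1 \<xi>2. hact \<Omega> \<xi>1 v \<otimes>\<^bsub>\<Omega>\<^esub> hact A \<xi>2 a) (comult H \<xi>)"
    using x(2) v hact_closed [OF h_module_A]
    by (intro lift_cong [OF calc.\<Omega>.module_axioms comult_closed [OF x(1)]])
       (simp_all add: calc.A_hact A_subset one_form_subset calc.hact_grade one_form_mult)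
  finally show "hact F \<xi> (ract F v a) = tens_lift F (\<lambda>\<xi>1 \<xi>2. ract F (hact F \<xi>1 v) (hact A \<xi>2 a)) (comult H \<xi>)"
    by (simp add: lift_one_form [OF mult_act_bilinear(2) [OF x(2) v] comult_closed [OF x(1)]])
qed (use mult_bilinear [THEN k_bilinearD(1)] mult_bilinear [THEN k_bilinearD(2)] in
    \<open>simp_all add: k_linearD(2,3) A_subset one_form_subset calc.A_mult calc.A_one calc.A_add calc.A_smult calc.\<Omega>.m_assoc
      calc.\<Omega>.l_distr calc.\<Omega>.r_distr calc.\<Omega>.smult_mult_left calc.\<Omega>.smult_mult_right\<close>)

lemma diff_linear_A: "k_linear K A F (diff \<Omega>)"
  using calc.diff_linear [of 0]
  by (intro k_linearI) (auto simp: A_grade calc.A_add calc.A_smult dest: k_linearD)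

end

locale quasi_commutative_calculus = quasitriangular K H R + covariant_calculus K H A \<Omega>
  for K and H :: "('k, 'h, 'p) hopf_scheme" (structure) and R
    and A :: "('k, 'h, 'o, 'n) hmod_scheme" and \<Omega> :: "('k, 'h, 'o, 'm) dcalc_scheme" +
  assumes gqc: "graded_quasi_commutative K H R \<Omega>"
begin

text \<open>Graded quasi-commutativity in degrees 1 and 0, then 0 and 1. The sign is (-1)^0 in both
  cases and appears as the integer multiple by 1 in the proof. The first makes the one-forms a
  quasi-commutative bimodule, the second is the assumption \<open>lact_F\<close> of
  \<open>connection_sum\<close>.\<close>

lemma one_form_swap:
  assumes a: "a \<in> carrier A" and v: "\<theta> \<in> grade \<Omega> (Suc 0)"
  shows "\<theta> \<otimes>\<^bsub>\<Omega>\<^esub> a = tens_lift F (\<lambda>r s. hact A r a \<otimes>\<^bsub>\<Omega>\<^esub> hact \<Omega> s \<theta>) R'"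
    and "a \<otimes>\<^bsub>\<Omega>\<^esub> \<theta> = tens_lift F (\<lambda>r s. hact \<Omega> r \<theta> \<otimes>\<^bsub>\<Omega>\<^esub> hact A s a) R'"
proof -
  have a0: "a \<in> grade \<Omega> 0" using a by (simp add: A_grade)
  note h = hact_closed [OF h_module_A]
  have "\<theta> \<otimes>\<^bsub>\<Omega>\<^esub> a = [(1 :: int)] \<cdot>\<^bsub>\<Omega>\<^esub> tens_lift \<Omega> (\<lambda>r s. hact \<Omega> r a \<otimes>\<^bsub>\<Omega>\<^esub> hact \<Omega> s \<theta>) R'"
    using gqc v a0 unfolding graded_quasi_commutative_def by fastforce
  also have "tens_lift \<Omega> (\<lambda>r s. hact \<Omega> r a \<otimes>\<^bsub>\<Omega>\<^esub> hact \<Omega> s \<theta>) R' =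
      tens_lift \<Omega> (\<lambda>r s. hact A r a \<otimes>\<^bsub>\<Omega>\<^esub> hact \<Omega> s \<theta>) R'"
    using a v h by (intro lift_cong [OF calc.\<Omega>.module_axioms R'_closed])
      (simp_all add: calc.A_hact A_subset one_form_subset calc.hact_grade one_form_mult)
  also have "\<dots> = tens_lift F (\<lambda>r s. hact A r a \<otimes>\<^bsub>\<Omega>\<^esub> hact \<Omega> s \<theta>) R'"
    by (rule lift_one_form [OF mult_act_bilinear(1) [OF a v] R'_closed])
  finally show "\<theta> \<otimes>\<^bsub>\<Omega>\<^esub> a = tens_lift F (\<lambda>r s. hact A r a \<otimes>\<^bsub>\<Omega>\<^esub> hact \<Omega> s \<theta>) R'"
    using lift_closed [OF module_one_form mult_act_bilinear(1) [OF a v] R'_closed] by (simp add: one_form_subset)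
  have "a \<otimes>\<^bsub>\<Omega>\<^esub> \<theta> = [(1 :: int)] \<cdot>\<^bsub>\<Omega>\<^esub> tens_lift \<Omega> (\<lambda>r s. hact \<Omega> r \<theta> \<otimes>\<^bsub>\<Omega>\<^esub> hact \<Omega> s a) R'"
    using gqc v a0 unfolding graded_quasi_commutative_def by fastforce
  also have "tens_lift \<Omega> (\<lambda>r s. hact \<Omega> r \<theta> \<otimes>\<^bsub>\<Omega>\<^esub> hact \<Omega> s a) R' =
      tens_lift \<Omega> (\<lambda>r s. hact \<Omega> r \<theta> \<otimes>\<^bsub>\<Omega>\<^esub> hact A s a) R'"
    using a v h by (intro lift_cong [OF calc.\<Omega>.module_axioms R'_closed])
      (simp_all add: calc.A_hact A_subset one_form_subset calc.hact_grade one_form_mult)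
  also have "\<dots> = tens_lift F (\<lambda>r s. hact \<Omega> r \<theta> \<otimes>\<^bsub>\<Omega>\<^esub> hact A s a) R'"
    by (rule lift_one_form [OF mult_act_bilinear(2) [OF a v] R'_closed])
  finally show "a \<otimes>\<^bsub>\<Omega>\<^esub> \<theta> = tens_lift F (\<lambda>r s. hact \<Omega> r \<theta> \<otimes>\<^bsub>\<Omega>\<^esub> hact A s a) R'"
    using lift_closed [OF module_one_form mult_act_bilinear(2) [OF a v] R'_closed] by (simp add: one_form_subset)
qed

end

theorem theorem4p4:
  fixes K :: "'k ring"
    and H :: "('k, 'h) hopf"
    and R :: "('h, 'h) tens"
    and A :: "('k, 'h, 'o) hmod"
    and \<Omega> :: "('k, 'h, 'o) dcalc"
    and V :: "('k, 'h, 'o, 'v) hbimod"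
    and W :: "('k, 'h, 'o, 'w) hbimod"
    and D\<^sub>V :: "'v \<Rightarrow> ('v, 'o) tens"
    and D\<^sub>W :: "'w \<Rightarrow> ('w, 'o) tens"
  assumes "quasitriangular K H R"
    and "h_module_algebra K H A"
    and "h_bimodule K H A V" and "quasi_commutative K H R A V"
    and "h_bimodule K H A W" and "quasi_commutative K H R A W"
    and "h_covariant_calculus K H A \<Omega>" and "graded_quasi_commutative K H R \<Omega>"
    and "D\<^sub>V \<in> connections K H A \<Omega> V"
    and "D\<^sub>W \<in> connections K H A \<Omega> W"
  shows "k_linear K (tensor_K K V W) (tensor_A H A (tensor_A H A V W) (one_form_bimod \<Omega>))
           (connection_sum_hat K H R A \<Omega> V W D\<^sub>V D\<^sub>W)
       \<and> (\<exists>!D. D \<in> connections K H A \<Omega> (tensor_A H A V W) \<and>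
            (\<forall>v\<in>carrier V. \<forall>w\<in>carrier W.
               D (pure_A A V W v w) =
               connection_sum_hat K H R A \<Omega> V W D\<^sub>V D\<^sub>W (pure_K K V W v w)))"
proof -
  interpret q: quasitriangular K H R by fact
  interpret qc: quasi_commutative_calculus K H R A \<Omega>
    by (intro quasi_commutative_calculus.intro covariant_calculus.intro q.hopf_algebra_axioms
        quasi_commutative_calculus_axioms.intro assms)
  define F where "F = one_form_bimod \<Omega>"
  have DV: "k_linear K V (tensor_A H A V F) D\<^sub>V"
      "\<And>v a. v \<in> carrier V \<Longrightarrow> a \<in> carrier A \<Longrightarrow>
        D\<^sub>V (ract V v a) = ract (tensor_A H A V F) (D\<^sub>V v) a \<oplus>\<^bsub>tensor_A H A V F\<^esub> pure_A A V F v (diff \<Omega> a)"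
    and DW: "k_linear K W (tensor_A H A W F) D\<^sub>W"
      "\<And>w a. w \<in> carrier W \<Longrightarrow> a \<in> carrier A \<Longrightarrow>
        D\<^sub>W (ract W w a) = ract (tensor_A H A W F) (D\<^sub>W w) a \<oplus>\<^bsub>tensor_A H A W F\<^esub> pure_A A W F w (diff \<Omega> a)"
    using assms(9,10) by (auto simp: connections_def F_def)
  \<comment> \<open>\<open>P\<close> is instantiated by the tensor product itself, so that its
    defining equation is reflexivity, and \<open>\<delta>\<close> by \<open>diff \<Omega>\<close>,
    whose restriction to \<open>A\<close> is what the assumptions on \<open>\<delta>\<close>
    concern.\<close>
  interpret s: connection_sum K H R A W F "tensor_A H A W F" "diff \<Omega>" D\<^sub>W V D\<^sub>V
  proof (intro connection_sum.intro hom_connection.intro quasitriangular_module_algebra.intro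
      hopf_module_algebra.intro connection_sum_axioms.intro hom_connection_axioms.intro
      q.quasitriangular_axioms q.hopf_algebra_axioms assms refl DV DW)
    show "h_bimodule K H A F" unfolding F_def by (rule qc.h_bimodule_one_form)
    show "quasi_commutative K H R A F"
      unfolding quasi_commutative_def F_def by (simp add: qc.one_form_swap(1))
    show "k_linear K A F (diff \<Omega>)" unfolding F_def by (rule qc.diff_linear_A)
    show "hact F \<xi> (diff \<Omega> a) = diff \<Omega> (hact A \<xi> a)" if "\<xi> \<in> carrier H" "a \<in> carrier A" for \<xi> a
      using that qc.calc.hact_diff [of \<xi> a 0] by (simp add: F_def qc.A_grade qc.calc.A_hact)
    show "lact F a \<theta> = tens_lift F (\<lambda>r s. ract F (hact F r \<theta>) (hact A s a)) (inv\<^bsub>tensor2 K H\<^esub> R)"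
      if "a \<in> carrier A" "\<theta> \<in> carrier F" for a \<theta>
      using that by (simp add: F_def qc.one_form_swap(2))
  qed
  have hat: "connection_sum_hat K H R A \<Omega> V W D\<^sub>V D\<^sub>W = s.sum_hat"
    by (rule ext) (simp only: connection_sum_hat_def s.sum_hat_def Let_def F_def [symmetric])
  show ?thesis
    unfolding hat
  proof (intro conjI ex1I [where a = s.sum_connection])
    show "k_linear K (tensor_K K V W) (tensor_A H A (tensor_A H A V W) (one_form_bimod \<Omega>)) s.sum_hat"
      using s.sum_hat_linear by (simp add: F_def)
    show "s.sum_connection \<in> connections K H A \<Omega> (tensor_A H A V W)"
      using s.sum_connection(1) s.sum_connection_ract
      by (simp add: connections_def F_def [symmetric] s.sum_connection_def [symmetric])
         (simp add: s.sum_connection_def)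
    show "\<forall>v\<in>carrier V. \<forall>w\<in>carrier W. s.sum_connection (pure_A A V W v w) = s.sum_hat (pure_K K V W v w)"
      by (simp add: s.sum_connection(2) s.sum_hat_pure)
    fix C
    assume "C \<in> connections K H A \<Omega> (tensor_A H A V W) \<and>
      (\<forall>v\<in>carrier V. \<forall>w\<in>carrier W. C (pure_A A V W v w) = s.sum_hat (pure_K K V W v w))"
    then show "C = s.sum_connection"
      by (intro s.sum_connection_unique) (simp_all add: connections_def F_def [symmetric] s.sum_hat_pure)
  qed
qed

end
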